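(* Let $n,\nu\geq 1$ and $a\in U_1=1+pR$, and let $\mu^a_{p^\nu}=\mathrm{Spec}\,R[x]/(x^{p^\nu}-a)$, $\mu_{p^\nu}=\mu^1_{p^\nu}$. 1) If $a\notin U_{\nu+1}=1+p^{\nu+1}R$, then $\widetilde{\mathcal{O}^n(\mu^a_{p^\nu})}=0$. 2) If $a\in U_{\nu+1}$, then $$\widetilde{\mathcal{O}^n(\mu^a_{p^\nu})}\simeq\widetilde{\mathcal{O}^n(\mu_{p^\nu})}\simeq\frac{k[x,x',\dots,x^{(n)}]}{((x-1)^{p^\nu},(x')^{p^\nu},\dots,(x^{(n)})^{p^\nu})},$$ $$\overline{\mathcal{O}^n(\mu^a_{p^\nu})}\simeq\overline{\mathcal{O}^n(\mu_{p^\nu})}\simeq\frac{k[x,x',\dots,x^{(n)}]}{(x^{p^\nu}-1)}\quad\text{if } n\leq\nu,$$ $$\overline{\mathcal{O}^n(\mu^a_{p^\nu})}\simeq\overline{\mathcal{O}^n(\mu_{p^\nu})}\simeq\frac{k[x,x',\dots,x^{(n)}]}{(x^{p^\nu}-1,(x')^{p^\nu},\dots,(x^{(n-\nu)})^{p^\nu})}\quad\text{if } n\geq\nu+1.$$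
   Context: $p$ is an odd prime, $R$ is the $p$-adic completion of the maximal unramified extension of $\mathbb{Z}_p$, $k=R/pR$, $\phi$ the Frobenius lift on $R$ and $\delta a=(\phi(a)-a^p)/p$ its $p$-derivation. A $p$-derivation on a ring $A$ is a map $\delta$ with $\delta(x+y)=\delta x+\delta y+(x^p+y^p-(x+y)^p)/p$, $\delta(xy)=x^p\delta y+y^p\delta x+p\,\delta x\,\delta y$; $R\{x\}=R[x,x',x'',\dots]$ carries the $p$-derivation extending that of $R$ with $\delta x=x'$, $\delta x'=x''$, etc. For $X=\mathrm{Spec}\,R[x]/(f)$ of finite type, $J^n(X)=\mathrm{Spf}\,R[x,\dots,x^{(n)}]^{\wedge}/(f,\delta f,\dots,\delta^nf)$ ($p$-adic completion), $\mathcal{O}^n(X)=\mathcal{O}(J^n(X))$, $\mathcal{O}^\infty(X)=\varinjlim_n\mathcal{O}^n(X)$, $\overline{\mathcal{O}^n(X)}=\mathcal{O}^n(X)\otimes_Rk$, $\widetilde{\mathcal{O}^n(X)}$ = image of $\overline{\mathcal{O}^n(X)}$ in $\mathcal{O}^\infty(X)\otimes_Rk$. *)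

theory Defs
  imports
    "HOL-Library.Poly_Mapping"
    "HOL-Computational_Algebra.Primes"
    "HOL-Algebra.IntRing"
    "HOL-Algebra.Algebraic_Closure_Type"
begin

subsection \<open>Completions, cosets and direct limits\<close>

definition padic_ideal :: "nat \<Rightarrow> ('a, 'm) ring_scheme \<Rightarrow> nat \<Rightarrow> 'a set" where
  "padic_ideal p A m = PIdl\<^bsub>A\<^esub> (add_pow A (p ^ m) \<one>\<^bsub>A\<^esub>)"

text \<open>
  If \<open>g\<close> is a homomorphism into \<open>B\<close> that maps the ideal \<open>I\<close> into the ideal \<open>J\<close>, then on a coset
  \<open>I + x\<close> all members of the union below coincide, and \<open>coset_map B J g\<close> is the induced map
  from the quotient by \<open>I\<close> to \<open>B Quot J\<close>.
\<close>

definition coset_map ::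
  "('b, 'm) ring_scheme \<Rightarrow> 'b set \<Rightarrow> ('a \<Rightarrow> 'b) \<Rightarrow> 'a set \<Rightarrow> 'b set" where
  "coset_map B J g C = (\<Union>x\<in>C. J +>\<^bsub>B\<^esub> g x)"

text \<open>The inverse limit of the rings \<open>A / p\<^sup>mA\<close>.\<close>

definition padic_completion ::
  "nat \<Rightarrow> ('a, 'm) ring_scheme \<Rightarrow> (nat \<Rightarrow> 'a set) ring" where
  "padic_completion p A =
     \<lparr>carrier = {s. (\<forall>m. s m \<in> carrier (A Quot padic_ideal p A m)) \<and>
                    (\<forall>m. coset_map A (padic_ideal p A m) id (s (Suc m)) = s m)},
      monoid.mult = (\<lambda>s t m. s m \<otimes>\<^bsub>A Quot padic_ideal p A m\<^esub> t m),
      one = (\<lambda>m. \<one>\<^bsub>A Quot padic_ideal p A m\<^esub>),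
      zero = (\<lambda>m. \<zero>\<^bsub>A Quot padic_ideal p A m\<^esub>),
      add = (\<lambda>s t m. s m \<oplus>\<^bsub>A Quot padic_ideal p A m\<^esub> t m)\<rparr>"

definition to_completion ::
  "nat \<Rightarrow> ('a, 'm) ring_scheme \<Rightarrow> 'a \<Rightarrow> nat \<Rightarrow> 'a set" where
  "to_completion p A a = (\<lambda>m. padic_ideal p A m +>\<^bsub>A\<^esub> a)"

definition completion_map ::
  "nat \<Rightarrow> ('b, 'm) ring_scheme \<Rightarrow> ('a \<Rightarrow> 'b) \<Rightarrow> (nat \<Rightarrow> 'a set) \<Rightarrow> nat \<Rightarrow> 'b set" where
  "completion_map p B g s = (\<lambda>m. coset_map B (padic_ideal p B m) g (s m))"

text \<open>
  The direct limit of a sequence of rings \<open>A 0 \<rightarrow> A 1 \<rightarrow> \<dots>\<close> with transition maps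
  \<open>t n\<close> from \<open>A n\<close> to \<open>A (Suc n)\<close>.  Its elements are the classes of pairs \<open>(n, x)\<close> with \<open>x\<close> in
  \<open>A n\<close>, two pairs being identified if they become equal at some later stage; \<open>dl_shift t n d\<close>
  is the composite map from \<open>A n\<close> to \<open>A (n + d)\<close>.
\<close>

primrec dl_shift :: "(nat \<Rightarrow> 'a \<Rightarrow> 'a) \<Rightarrow> nat \<Rightarrow> nat \<Rightarrow> 'a \<Rightarrow> 'a" where
  "dl_shift t n 0 x = x"
| "dl_shift t n (Suc d) x = t (n + d) (dl_shift t n d x)"

definition dl_class ::
  "(nat \<Rightarrow> ('a, 'm) ring_scheme) \<Rightarrow> (nat \<Rightarrow> 'a \<Rightarrow> 'a) \<Rightarrow> nat \<Rightarrow> 'a \<Rightarrow> (nat \<times> 'a) set" where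
  "dl_class A t n x =
     {(m, y). y \<in> carrier (A m) \<and>
        (\<exists>d e. n + d = m + e \<and> dl_shift t n d x = dl_shift t m e y)}"

definition direct_limit ::
  "(nat \<Rightarrow> ('a, 'm) ring_scheme) \<Rightarrow> (nat \<Rightarrow> 'a \<Rightarrow> 'a) \<Rightarrow> (nat \<times> 'a) set ring" where
  "direct_limit A t =
     \<lparr>carrier = {dl_class A t n x | n x. x \<in> carrier (A n)},
      monoid.mult = (\<lambda>C D. \<Union>(n, x)\<in>C. \<Union>(m, y)\<in>D.
        dl_class A t (n + m) (dl_shift t n m x \<otimes>\<^bsub>A (n + m)\<^esub> dl_shift t m n y)),
      one = dl_class A t 0 \<one>\<^bsub>A 0\<^esub>,
      zero = dl_class A t 0 \<zero>\<^bsub>A 0\<^esub>,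
      add = (\<lambda>C D. \<Union>(n, x)\<in>C. \<Union>(m, y)\<in>D.
        dl_class A t (n + m) (dl_shift t n m x \<oplus>\<^bsub>A (n + m)\<^esub> dl_shift t m n y))\<rparr>"


subsection \<open>The base ring\<close>

abbreviation padic_integers :: "nat \<Rightarrow> (nat \<Rightarrow> int set) ring" where
  "padic_integers p \<equiv> padic_completion p \<Z>"

definition integral_over :: "('a, 'm) ring_scheme \<Rightarrow> 'a set \<Rightarrow> 'a \<Rightarrow> bool" where
  "integral_over A K x \<longleftrightarrow>
     (\<exists>P\<in>carrier (K [X]\<^bsub>A\<^esub>). P \<noteq> [] \<and> hd P = \<one>\<^bsub>A\<^esub> \<and> ring.eval A P x = \<zero>\<^bsub>A\<^esub>)"

text \<open>
  Unramified: \<open>A\<close> is local and its maximal ideal is generated by that of the \<open>p\<close>-adic integers.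
  The residue field extension is algebraic over the perfect field with \<open>p\<close> elements, hence
  automatically separable.
\<close>

definition unramified_extension ::
  "nat \<Rightarrow> 'a ring \<Rightarrow> ((nat \<Rightarrow> int set) \<Rightarrow> 'a) \<Rightarrow> bool" where
  "unramified_extension p A \<iota> \<longleftrightarrow>
     domain A \<and>
     \<iota> \<in> ring_hom (padic_integers p) A \<and> inj_on \<iota> (carrier (padic_integers p)) \<and>
     (\<forall>x\<in>carrier A. integral_over A (\<iota> ` carrier (padic_integers p)) x) \<and>
     {M. maximalideal M A} = {padic_ideal p A 1}"

text \<open>
  An integral extension of the infinite domain \<open>A\<close> has the same cardinality as \<open>A\<close>, so it is no
  restriction that the competing extensions \<open>B\<close> live on the element type of \<open>A\<close>.
\<close>

definition maximal_unramified_extension ::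
  "nat \<Rightarrow> 'a ring \<Rightarrow> ((nat \<Rightarrow> int set) \<Rightarrow> 'a) \<Rightarrow> bool" where
  "maximal_unramified_extension p A \<iota> \<longleftrightarrow>
     unramified_extension p A \<iota> \<and>
     (\<forall>(B :: 'a ring) j. j \<in> ring_hom A B \<and> inj_on j (carrier A) \<and>
        unramified_extension p B (j \<circ> \<iota>) \<longrightarrow> j ` carrier A = carrier B)"

definition frobenius_lift :: "nat \<Rightarrow> ('r::comm_ring_1 \<Rightarrow> 'r) \<Rightarrow> bool" where
  "frobenius_lift p \<phi> \<longleftrightarrow>
     \<phi> \<in> ring_hom ring_of_type_algebra ring_of_type_algebra \<and>
     (\<forall>a. of_nat p dvd \<phi> a - a ^ p)"

definition residue_map :: "nat \<Rightarrow> ('r::comm_ring_1 \<Rightarrow> 'k::comm_ring_1) \<Rightarrow> bool" where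
  "residue_map p \<rho> \<longleftrightarrow>
     \<rho> \<in> ring_hom ring_of_type_algebra ring_of_type_algebra \<and> surj \<rho> \<and>
     (\<forall>c. \<rho> c = 0 \<longleftrightarrow> of_nat p dvd c)"

definition principal_units :: "nat \<Rightarrow> nat \<Rightarrow> 'r::comm_ring_1 set" where
  "principal_units p m = {1 + of_nat (p ^ m) * c | c. True}"


subsection \<open>\<open>p\<close>-derivations\<close>

text \<open>The integral polynomial \<open>(x\<^sup>p + y\<^sup>p - (x + y)\<^sup>p) / p\<close>.\<close>

definition carry_poly :: "nat \<Rightarrow> 'a::comm_ring_1 \<Rightarrow> 'a \<Rightarrow> 'a" where
  "carry_poly p x y = - (\<Sum>i = 1..<p. of_nat ((p choose i) div p) * x ^ i * y ^ (p - i))"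

definition p_derivation :: "nat \<Rightarrow> ('a::comm_ring_1 \<Rightarrow> 'a) \<Rightarrow> bool" where
  "p_derivation p \<delta> \<longleftrightarrow>
     (\<forall>x y. \<delta> (x + y) = \<delta> x + \<delta> y + carry_poly p x y) \<and>
     (\<forall>x y. \<delta> (x * y) = x ^ p * \<delta> y + y ^ p * \<delta> x + of_nat p * \<delta> x * \<delta> y)"

definition frobenius_derivation ::
  "nat \<Rightarrow> ('r::comm_ring_1 \<Rightarrow> 'r) \<Rightarrow> 'r \<Rightarrow> 'r" where
  "frobenius_derivation p \<phi> a = (THE b. of_nat p * b = \<phi> a - a ^ p)"

text \<open>
  The ring \<open>R{x} = R[x, x', x'', \<dots>]\<close> is the type of all polynomials in countably many variables;
  the variable with index \<open>i\<close> stands for the \<open>i\<close>-th derivative of \<open>x\<close>.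
\<close>

type_synonym 'r dpoly = "(nat \<Rightarrow>\<^sub>0 nat) \<Rightarrow>\<^sub>0 'r"

definition dvar :: "nat \<Rightarrow> 'r::comm_ring_1 dpoly" where
  "dvar i = Poly_Mapping.single (Poly_Mapping.single i 1) 1"

definition dconst :: "'r::comm_ring_1 \<Rightarrow> 'r dpoly" where
  "dconst c = Poly_Mapping.single 0 c"

definition dpoly_ring :: "nat \<Rightarrow> 'r::comm_ring_1 dpoly ring" where
  "dpoly_ring n =
     ring_of_type_algebra\<lparr>carrier := {P. \<forall>t\<in>Poly_Mapping.keys P. Poly_Mapping.keys t \<subseteq> {..n}}\<rparr>"

definition prolongation ::
  "nat \<Rightarrow> ('r::comm_ring_1 \<Rightarrow> 'r) \<Rightarrow> ('r dpoly \<Rightarrow> 'r dpoly) \<Rightarrow> bool" where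
  "prolongation p \<delta>\<^sub>0 \<delta> \<longleftrightarrow>
     p_derivation p \<delta> \<and> (\<forall>c. \<delta> (dconst c) = dconst (\<delta>\<^sub>0 c)) \<and> (\<forall>i. \<delta> (dvar i) = dvar (Suc i))"


subsection \<open>Rings of functions on \<open>p\<close>-jet spaces\<close>

text \<open>
  Throughout, \<open>f\<close> is a polynomial in \<open>x = dvar 0\<close> and the affine scheme is \<open>Spec R[x]/(f)\<close>.
\<close>

definition jet_ideal ::
  "nat \<Rightarrow> ('r::comm_ring_1 dpoly \<Rightarrow> 'r dpoly) \<Rightarrow> 'r dpoly \<Rightarrow> nat \<Rightarrow> (nat \<Rightarrow> 'r dpoly set) set" where
  "jet_ideal p \<delta> f n =
     Idl\<^bsub>padic_completion p (dpoly_ring n)\<^esub>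
       ((\<lambda>i. to_completion p (dpoly_ring n) ((\<delta> ^^ i) f)) ` {..n})"

definition jet_ring ::
  "nat \<Rightarrow> ('r::comm_ring_1 dpoly \<Rightarrow> 'r dpoly) \<Rightarrow> 'r dpoly \<Rightarrow> nat \<Rightarrow> (nat \<Rightarrow> 'r dpoly set) set ring" where
  "jet_ring p \<delta> f n = padic_completion p (dpoly_ring n) Quot jet_ideal p \<delta> f n"

definition jet_step ::
  "nat \<Rightarrow> ('r::comm_ring_1 dpoly \<Rightarrow> 'r dpoly) \<Rightarrow> 'r dpoly \<Rightarrow> nat \<Rightarrow>
    (nat \<Rightarrow> 'r dpoly set) set \<Rightarrow> (nat \<Rightarrow> 'r dpoly set) set" where
  "jet_step p \<delta> f n =
     coset_map (padic_completion p (dpoly_ring (Suc n))) (jet_ideal p \<delta> f (Suc n))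
       (completion_map p (dpoly_ring (Suc n)) id)"

definition jet_ring_inf ::
  "nat \<Rightarrow> ('r::comm_ring_1 dpoly \<Rightarrow> 'r dpoly) \<Rightarrow> 'r dpoly \<Rightarrow>
    (nat \<times> (nat \<Rightarrow> 'r dpoly set) set) set ring" where
  "jet_ring_inf p \<delta> f = direct_limit (jet_ring p \<delta> f) (jet_step p \<delta> f)"

text \<open>The base change of an \<open>R\<close>-algebra \<open>A\<close> to \<open>k = R/pR\<close> is \<open>A/pA\<close>.\<close>

definition mod_p :: "nat \<Rightarrow> ('a, 'm) ring_scheme \<Rightarrow> 'a set ring" where
  "mod_p p A = A Quot padic_ideal p A 1"

definition jet_bar ::
  "nat \<Rightarrow> ('r::comm_ring_1 dpoly \<Rightarrow> 'r dpoly) \<Rightarrow> 'r dpoly \<Rightarrow> nat \<Rightarrow>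
    (nat \<Rightarrow> 'r dpoly set) set set ring" where
  "jet_bar p \<delta> f n = mod_p p (jet_ring p \<delta> f n)"

definition jet_tilde ::
  "nat \<Rightarrow> ('r::comm_ring_1 dpoly \<Rightarrow> 'r dpoly) \<Rightarrow> 'r dpoly \<Rightarrow> nat \<Rightarrow>
    (nat \<times> (nat \<Rightarrow> 'r dpoly set) set) set set ring" where
  "jet_tilde p \<delta> f n =
     (mod_p p (jet_ring_inf p \<delta> f))
       \<lparr>carrier :=
          coset_map (jet_ring_inf p \<delta> f) (padic_ideal p (jet_ring_inf p \<delta> f) 1)
            (dl_class (jet_ring p \<delta> f) (jet_step p \<delta> f) n) ` carrier (jet_bar p \<delta> f n)\<rparr>"

text \<open>The structure maps of these rings as algebras over the base ring.\<close>

definition jet_const ::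
  "nat \<Rightarrow> ('r::comm_ring_1 dpoly \<Rightarrow> 'r dpoly) \<Rightarrow> 'r dpoly \<Rightarrow> nat \<Rightarrow>
    'r \<Rightarrow> (nat \<Rightarrow> 'r dpoly set) set" where
  "jet_const p \<delta> f n c =
     jet_ideal p \<delta> f n +>\<^bsub>padic_completion p (dpoly_ring n)\<^esub>
       to_completion p (dpoly_ring n) (dconst c)"

definition jet_bar_const ::
  "nat \<Rightarrow> ('r::comm_ring_1 dpoly \<Rightarrow> 'r dpoly) \<Rightarrow> 'r dpoly \<Rightarrow> nat \<Rightarrow>
    'r \<Rightarrow> (nat \<Rightarrow> 'r dpoly set) set set" where
  "jet_bar_const p \<delta> f n c =
     padic_ideal p (jet_ring p \<delta> f n) 1 +>\<^bsub>jet_ring p \<delta> f n\<^esub> jet_const p \<delta> f n c"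

definition jet_tilde_const ::
  "nat \<Rightarrow> ('r::comm_ring_1 dpoly \<Rightarrow> 'r dpoly) \<Rightarrow> 'r dpoly \<Rightarrow> nat \<Rightarrow>
    'r \<Rightarrow> (nat \<times> (nat \<Rightarrow> 'r dpoly set) set) set set" where
  "jet_tilde_const p \<delta> f n c =
     padic_ideal p (jet_ring_inf p \<delta> f) 1 +>\<^bsub>jet_ring_inf p \<delta> f\<^esub>
       dl_class (jet_ring p \<delta> f) (jet_step p \<delta> f) n (jet_const p \<delta> f n c)"

definition quot_const :: "nat \<Rightarrow> 'k::comm_ring_1 dpoly set \<Rightarrow> 'k \<Rightarrow> 'k dpoly set" where
  "quot_const n S c = (Idl\<^bsub>dpoly_ring n\<^esub> S) +>\<^bsub>dpoly_ring n\<^esub> dconst c"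

text \<open>
  Isomorphism of algebras over the base ring \<open>R\<close>, the type \<open>'r\<close>, with structure maps \<open>s\<close> and \<open>t\<close>.
  For algebras over \<open>k\<close> this is the same as isomorphism of \<open>k\<close>-algebras, because
  \<open>R \<rightarrow> k\<close> is surjective.
\<close>

definition alg_iso ::
  "('a, 'm) ring_scheme \<Rightarrow> ('r \<Rightarrow> 'a) \<Rightarrow> ('b, 'n) ring_scheme \<Rightarrow> ('r \<Rightarrow> 'b) \<Rightarrow> bool" where
  "alg_iso A s B t \<longleftrightarrow> (\<exists>h\<in>ring_iso A B. \<forall>c. h (s c) = t c)"

definition mu_poly :: "nat \<Rightarrow> nat \<Rightarrow> 'r::comm_ring_1 \<Rightarrow> 'r dpoly" where
  "mu_poly p \<nu> a = dvar 0 ^ (p ^ \<nu>) - dconst a"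

end

theory Submission
  imports Defs
begin

text \<open>
  Let \<open>B\<close> be the \<open>p\<close>-torsion free ring \<open>R{x}\<close>. For an ideal \<open>J\<close> containing \<open>p\<close>, the set of all \<open>b\<close> with
  \<open>b, \<delta> b, \<dots>, \<delta>\<^sup>n b \<in> J\<close> is again an ideal (the kernel of \<open>B \<rightarrow> W\<^sub>n\<^sub>+\<^sub>1(B/J)\<close> in terms of Witt
  vectors), and the ideal generated by \<open>p, f, \<dots>, \<delta>\<^sup>n f\<close> is the least \<open>J\<close> for which it contains \<open>f\<close>.
  If \<open>v \<equiv> 1\<close> modulo \<open>J\<close>, then \<open>u\<^sup>p - v\<^sup>p\<close> lies in the ideal of order \<open>n + 1\<close> attached to \<open>J\<close> if and
  only if \<open>u - v\<close> lies in the ideal of order \<open>n\<close> attached to \<open>{b. b\<^sup>p \<in> J}\<close>; for odd \<open>p\<close> the terms of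
  \<open>u\<^sup>p - v\<^sup>p\<close> other than \<open>p (u - v)\<close> times a unit are negligible. Iterating, and writing
  \<open>a \<equiv> b\<^bsup>p^\<nu>\<^esup>\<close> to sufficiently high \<open>p\<close>-adic order, the ideal of the equation \<open>x\<^bsup>p^\<nu>\<^esup> = a\<close> becomes
  modulo \<open>p\<close> the one generated by the powers \<open>(x\<^sup>(\<^sup>i\<^sup>) - \<delta>\<^sup>i b)\<^bsup>p^\<nu>\<^esup>\<close> with \<open>i \<le> n - \<nu>\<close>, and a translation of
  the variables removes the constants \<open>\<delta>\<^sup>i b\<close>. If no such \<open>b\<close> exists, then \<open>a = 1 + p\<^sup>j c\<close> with
  \<open>1 \<le> j \<le> \<nu>\<close> and \<open>c\<close> a unit modulo \<open>p\<close>, and the ideal contains a power of \<open>c\<close>.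
\<close>

section \<open>Ideals of jets in rings with a \<open>p\<close>-derivation\<close>

text \<open>Testing against all ideals \<open>J\<close> that contain \<open>p\<close> replaces an
  explicit computation of the derivatives of f modulo \<open>p\<close>: two ideals containing
  \<open>p\<close> agree once they lie in the same \<open>J\<close>. Each extraction of a p-th root
  lowers the order by one until it reaches 0, where the p-th power is additive modulo
  \<open>p\<close> and nothing is lost; this is the source of the truncated difference n - \<nu>.
  Oddness of \<open>p\<close> enters because the term p^(p-1) (\<delta> z)^p of \<delta> (z^p) must
  carry at least two factors \<open>p\<close>. Multiples of p^(m+1) lie in every ideal of order m,
  so an approximate root b, which may change with m, does the work of an exact one. For the image in
  the direct limit one needs the polynomials in x, ..., x^(n) that lie in the union of the ideals of
  all levels k. As each generator involves a single variable, they all occur at level n + \<nu>.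
  Completion leaves no trace modulo \<open>p\<close>, because for a p-torsion free ring A the kernel
  of the map from its completion to A/p is generated by \<open>p\<close>.\<close>

text \<open>Subspaces of a ring as a module over itself are its ideals, and spans are generated ideals.\<close>

global_interpretation idl: Modules.module "(*) :: 'a::comm_ring_1 \<Rightarrow> 'a \<Rightarrow> 'a"
  by unfold_locales (simp_all add: algebra_simps)

text \<open>As a simplification rule this reverses associativity of multiplication.\<close>

declare idl.scale_scale [simp del]

lemma idl_mult_right: "idl.subspace J \<Longrightarrow> x \<in> J \<Longrightarrow> x * r \<in> J"
  using idl.subspace_scale[of J x r] by (simp add: mult.commute)

lemma idl_dvd: "idl.subspace J \<Longrightarrow> x \<in> J \<Longrightarrow> x dvd y \<Longrightarrow> y \<in> J"
  by (auto elim!: dvdE intro: idl_mult_right)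

lemma idl_cong: "idl.subspace J \<Longrightarrow> x - y \<in> J \<Longrightarrow> x \<in> J \<longleftrightarrow> y \<in> J"
  using idl.subspace_add[of J "x - y" y] idl.subspace_diff[of J x "x - y"] by auto

lemma idl_span_le_iff: "idl.subspace J \<Longrightarrow> idl.span G \<subseteq> J \<longleftrightarrow> G \<subseteq> J"
  using idl.span_minimal idl.span_superset order_trans by metis

lemma all_le_Suc_shift: "(\<forall>i\<le>Suc n. Q i) \<longleftrightarrow> Q 0 \<and> (\<forall>i\<le>n. Q (Suc i))"
  using All_less_Suc2[of "Suc n" Q] by (simp add: less_Suc_eq_le)

section \<open>Binomial coefficients and the carry polynomial\<close>

lemma prime_dvd_choose_middle:
  assumes "Factorial_Ring.prime (p::nat)" "0 < i" "i < p"
  shows "p * ((p choose i) div p) = p choose i"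
  using assms by (intro dvd_mult_div_cancel dvd_choose_prime) auto

text \<open>Binomial theorem with the two end terms split off. The remaining coefficients are
  divided by \<open>p\<close> as integers, so the identity holds in every commutative ring,
  including those where \<open>p\<close> is zero.\<close>

lemma of_nat_mult_carry_poly:
  assumes "Factorial_Ring.prime p"
  shows "of_nat p * carry_poly p x y = x ^ p + y ^ p - (x + y) ^ p"
proof -
  let ?S = "\<Sum>i = 1..<p. of_nat (p choose i) * x ^ i * y ^ (p - i)"
  have p: "0 < p" using assms prime_gt_0_nat by blast
  have "{..p} = insert 0 (insert p {1..<p})" using p by auto
  then have "(x + y) ^ p = (\<Sum>i\<in>insert 0 (insert p {1..<p}). of_nat (p choose i) * x ^ i * y ^ (p - i))"
    by (metis binomial_ring)
  also have "\<dots> = y ^ p + (x ^ p + ?S)" using p by simp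
  finally have "(x + y) ^ p = y ^ p + (x ^ p + ?S)" .
  moreover have "?S = of_nat p * (\<Sum>i = 1..<p. of_nat ((p choose i) div p) * x ^ i * y ^ (p - i))"
    unfolding sum_distrib_left
  proof (rule sum.cong)
    fix i assume "i \<in> {1..<p}"
    then have "p choose i = p * ((p choose i) div p)"
      by (intro prime_dvd_choose_middle[OF assms, symmetric]) auto
    then have "of_nat (p choose i) = (of_nat p * of_nat ((p choose i) div p) :: 'a)"
      by (metis of_nat_mult)
    then show "of_nat (p choose i) * x ^ i * y ^ (p - i)
        = of_nat p * (of_nat ((p choose i) div p) * x ^ i * y ^ (p - i))"
      by (simp only: mult.assoc)
  qed simp
  ultimately show ?thesis unfolding carry_poly_def by simp
qed

text \<open>Every term has positive exponents in both variables. Hence the carry lies in any ideal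
  that contains one of the two arguments.\<close>

lemma carry_poly_factor: "x * y dvd carry_poly p x y"
proof -
  have "x * y dvd of_nat ((p choose i) div p) * x ^ i * y ^ (p - i)" if "i \<in> {1..<p}" for i
  proof -
    have "x dvd x ^ i" "y dvd y ^ (p - i)" using that by (auto intro!: dvd_power)
    then show ?thesis by (metis dvd_mult mult.assoc mult_dvd_mono)
  qed
  then show ?thesis unfolding carry_poly_def dvd_minus_iff by (rule dvd_sum)
qed

text \<open>At the index p - 1 the coefficient is p / p = 1, which contributes -x^(p-1) y; at
  smaller indices the exponent of y is at least 2.\<close>

lemma carry_poly_linear_term:
  assumes "Factorial_Ring.prime p"
  shows "y ^ 2 dvd carry_poly p x y + x ^ (p - 1) * y"
proof -
  have p: "1 < p" using assms prime_gt_1_nat by blast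
  have "{1..<p} = insert (p - 1) {1..<p - 1}" using p by auto
  moreover have "p choose (p - 1) = p" using p by (metis binomial_symmetric choose_one diff_diff_cancel less_imp_le_nat diff_le_self)
  ultimately have "carry_poly p x y + x ^ (p - 1) * y
      = - (\<Sum>i = 1..<p - 1. of_nat ((p choose i) div p) * x ^ i * y ^ (p - i))"
    using p by (simp add: carry_poly_def)
  moreover have "y ^ 2 dvd of_nat ((p choose i) div p) * x ^ i * y ^ (p - i)" if "i \<in> {1..<p - 1}" for i
    using that by (intro dvd_mult le_imp_power_dvd) auto
  ultimately show ?thesis by (simp only: dvd_minus_iff) (rule dvd_sum)
qed

text \<open>The ideal theory is carried out in any p-torsion free ring with a p-derivation. The
  condition \<open>delta_one\<close> is listed separately because the product rule by itself only
  makes 1 + p \<delta> 1 idempotent.\<close>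

locale delta_ring =
  fixes p :: nat and \<delta> :: "'b::comm_ring_1 \<Rightarrow> 'b"
  assumes p_prime: "Factorial_Ring.prime p" and p_odd: "odd p"
    and derivation: "p_derivation p \<delta>" and delta_one: "\<delta> 1 = 0"
    and torsion_free: "of_nat p * x = (0::'b) \<Longrightarrow> x = 0"
begin

abbreviation P :: 'b where "P \<equiv> of_nat p"

lemma p_ge_3: "3 \<le> p"
  using p_prime p_odd prime_ge_2_nat[of p] by (metis even_numeral le_antisym not_less_eq_eq numeral_2_eq_2 numeral_3_eq_3)

lemma P_cancel: "P * x = P * y \<Longrightarrow> x = y"
  using torsion_free[of "x - y"] by (simp add: algebra_simps)

lemma delta_add: "\<delta> (x + y) = \<delta> x + \<delta> y + carry_poly p x y"
  and delta_mult: "\<delta> (x * y) = x ^ p * \<delta> y + y ^ p * \<delta> x + P * \<delta> x * \<delta> y"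
  using derivation by (auto simp: p_derivation_def)

lemma delta_zero: "\<delta> 0 = 0"
  using delta_add[of 0 0] carry_poly_factor[of 0 "0 :: 'b" p] by (simp add: dvd_0_left_iff)

text \<open>The lift of Frobenius belonging to \<delta>. It is a ring endomorphism and,
  \<open>p\<close> being a non-zero-divisor, it determines \<delta>: identities for \<delta> are
  obtained by multiplying with \<open>p\<close>, computing with this map and cancelling.\<close>

definition frob :: "'b \<Rightarrow> 'b" where "frob x = x ^ p + P * \<delta> x"

lemma frob_add: "frob (x + y) = frob x + frob y"
  using of_nat_mult_carry_poly[OF p_prime, of x y] by (simp add: frob_def delta_add algebra_simps)

lemma frob_mult: "frob (x * y) = frob x * frob y"
  unfolding frob_def delta_mult power_mult_distrib by (simp only: algebra_simps)

lemma frob_one: "frob 1 = 1"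
  by (simp add: frob_def delta_one)

lemma frob_of_nat: "frob (of_nat k) = of_nat k"
  using p_ge_3 by (induction k) (simp_all add: frob_add frob_one, simp add: frob_def delta_zero power_0_left)

lemma frob_power: "frob (x ^ k) = frob x ^ k"
  by (induction k) (simp_all add: frob_one frob_mult)

lemma frob_diff: "frob (x - y) = frob x - frob y"
  using frob_add[of "x - y" y] by simp

lemma delta_frob: "\<delta> (frob x) = frob (\<delta> x)"
proof (rule P_cancel)
  have "P * \<delta> (frob x) = frob (frob x) - frob x ^ p" by (simp add: frob_def)
  also have "\<dots> = frob (frob x - x ^ p)" by (simp add: frob_diff frob_power)
  also have "\<dots> = frob (P * \<delta> x)" by (simp add: frob_def)
  finally show "P * \<delta> (frob x) = P * frob (\<delta> x)" by (simp add: frob_mult frob_of_nat)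
qed

lemma P_power_p: "P ^ p = P * P ^ (p - 1)"
  using p_ge_3 by (simp flip: power_Suc)

text \<open>The counterpart of the Witt vector identity p = VF in characteristic p: up to the term
  p^(p-1) x^p, applying \<delta> undoes the multiplication by \<open>p\<close> and leaves the
  Frobenius.\<close>

lemma delta_P_mult: "\<delta> (P * x) = frob x - P ^ (p - 1) * x ^ p"
proof (rule P_cancel)
  have "P * \<delta> (P * x) = frob (P * x) - (P * x) ^ p" by (simp add: frob_def)
  also have "\<dots> = P * frob x - P ^ p * x ^ p" by (simp add: frob_mult frob_of_nat power_mult_distrib)
  also have "P ^ p * x ^ p = P * (P ^ (p - 1) * x ^ p)"
    by (subst P_power_p) (rule mult.assoc)
  finally show "P * \<delta> (P * x) = P * (frob x - P ^ (p - 1) * x ^ p)"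
    by (simp only: right_diff_distrib)
qed

text \<open>Expand \<open>frob z ^ p\<close> with \<open>frob z = z ^ p + P * \<delta> z\<close>,
  subtract the p-th power of z^p and divide by \<open>p\<close>. The mixed terms are multiples of
  p^2 z^p, and the pure term gives p^(p-1) (\<delta> z)^p.\<close>

lemma delta_power_p: "\<exists>g. \<delta> (z ^ p) = P * z ^ p * g + P ^ (p - 1) * \<delta> z ^ p"
proof -
  obtain g where g: "carry_poly p (z ^ p) (P * \<delta> z) = z ^ p * (P * \<delta> z) * g"
    using carry_poly_factor by (metis dvdE)
  have "P * \<delta> (z ^ p) = (z ^ p + P * \<delta> z) ^ p - (z ^ p) ^ p"
    using frob_power[of z p] unfolding frob_def by (metis add_diff_cancel_left')
  also have "\<dots> = (P * \<delta> z) ^ p - P * (z ^ p * (P * \<delta> z) * g)"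
    unfolding g[symmetric] of_nat_mult_carry_poly[OF p_prime] by simp
  also have "(P * \<delta> z) ^ p = P * (P ^ (p - 1) * \<delta> z ^ p)"
    unfolding power_mult_distrib by (subst P_power_p) (rule mult.assoc)
  finally have "\<delta> (z ^ p) = P * z ^ p * (- \<delta> z * g) + P ^ (p - 1) * \<delta> z ^ p"
    by - (rule P_cancel, simp only: algebra_simps mult_minus_left mult_minus_right add_uminus_conv_diff)
  then show ?thesis by blast
qed

section \<open>Ideals of elements whose derivatives up to order n lie in a given ideal\<close>

primrec jets :: "nat \<Rightarrow> 'b set \<Rightarrow> 'b set" where
  "jets 0 J = J"
| "jets (Suc n) J = {b \<in> J. \<delta> b \<in> jets n J}"

definition proot :: "'b set \<Rightarrow> 'b set" where "proot J = {b. b ^ p \<in> J}"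

definition p_ideal :: "'b set \<Rightarrow> bool" where "p_ideal J \<longleftrightarrow> idl.subspace J \<and> P \<in> J"

lemma jets_iff: "b \<in> jets n J \<longleftrightarrow> (\<forall>i\<le>n. (\<delta> ^^ i) b \<in> J)"
proof (induction n arbitrary: b)
  case (Suc n)
  have "(\<forall>i\<le>Suc n. (\<delta> ^^ i) b \<in> J) \<longleftrightarrow> b \<in> J \<and> (\<forall>i\<le>n. (\<delta> ^^ i) (\<delta> b) \<in> J)"
    unfolding all_le_Suc_shift by (simp only: funpow_simps_right o_apply id_apply)
  then show ?case using Suc by simp
qed simp

lemma jets_Suc_subset: "jets (Suc n) J \<subseteq> jets n J"
  by (auto simp: jets_iff simp del: jets.simps)

lemma jets_mono: "J \<subseteq> J' \<Longrightarrow> jets n J \<subseteq> jets n J'"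
  by (intro subsetI) (metis jets_iff subsetD)

text \<open>The carry and x^p \<delta> c are multiples of x, which lies in the set of lower order,
  an ideal by induction; the remaining terms of the two rules contain \<delta> x or \<delta>
  y.\<close>

lemma ideal_jets: "idl.subspace J \<Longrightarrow> idl.subspace (jets n J)"
proof (induction n)
  case (Suc n)
  then have I: "idl.subspace (jets n J)" by simp
  have sub: "b \<in> jets n J" if "b \<in> jets (Suc n) J" for b using that jets_Suc_subset by blast
  have div: "b dvd c \<Longrightarrow> c \<in> jets n J" if "b \<in> jets n J" for b c
    using that I idl_dvd by blast
  show ?case
  proof (rule idl.subspaceI)
    show "0 \<in> jets (Suc n) J"
      using Suc.prems I by (simp add: idl.subspace_0 delta_zero)
    show "x + y \<in> jets (Suc n) J" if "x \<in> jets (Suc n) J" "y \<in> jets (Suc n) J" for x y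
    proof -
      have "carry_poly p x y \<in> jets n J"
        by (rule div[OF sub[OF that(1)] dvd_mult_left[OF carry_poly_factor]])
      then show ?thesis using that Suc.prems I by (simp add: idl.subspace_add delta_add)
    qed
    show "c * x \<in> jets (Suc n) J" if x: "x \<in> jets (Suc n) J" for c x
    proof -
      have "x ^ p \<in> jets n J" using div[OF sub[OF x]] p_ge_3 by (simp add: dvd_power)
      then have "x ^ p * \<delta> c \<in> jets n J" using I idl_mult_right by blast
      moreover have "c ^ p * \<delta> x \<in> jets n J" "P * \<delta> c * \<delta> x \<in> jets n J"
        using x I idl.subspace_scale by auto
      ultimately show ?thesis using x Suc.prems I
        by (simp add: idl.subspace_add idl.subspace_scale delta_mult)
    qed
  qed
qed simp

text \<open>The p-th power is additive modulo \<open>J\<close> since \<open>J\<close> contains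
  \<open>p\<close>; \<open>proot J\<close> is the kernel of the projection to B/J followed by the
  Frobenius of B/J.\<close>

lemma p_ideal_proot:
  assumes "p_ideal J" shows "p_ideal (proot J)" and "J \<subseteq> proot J"
proof -
  have J: "idl.subspace J" "P \<in> J" using assms by (auto simp: p_ideal_def)
  have "x ^ p \<in> J" if "x \<in> J" for x
    using that J(1) p_ge_3 idl_mult_right[of J x "x ^ (p - 1)"] by (simp flip: power_Suc)
  then show "J \<subseteq> proot J" by (auto simp: proot_def)
  moreover have "(x + y) ^ p \<in> J" if "x ^ p \<in> J" "y ^ p \<in> J" for x y
  proof -
    have "(x + y) ^ p = x ^ p + y ^ p - P * carry_poly p x y"
      using of_nat_mult_carry_poly[OF p_prime, of x y] by simp
    then show ?thesis using that J idl.subspace_add idl.subspace_diff idl_mult_right by metis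
  qed
  ultimately show "p_ideal (proot J)" using J p_ge_3
    by (auto simp: p_ideal_def proot_def power_mult_distrib idl.subspace_scale idl.subspace_0
      power_0_left intro!: idl.subspaceI)
qed

text \<open>\<delta> commutes with \<open>frob\<close>, and \<open>frob y\<close> is y^p modulo
  \<open>p\<close>: each condition on a derivative of \<open>frob x\<close> is a condition on the
  p-th power of a derivative of x.\<close>

lemma frob_in_jets:
  assumes "p_ideal J" shows "frob x \<in> jets n J \<longleftrightarrow> x \<in> jets n (proot J)"
proof -
  have "(\<delta> ^^ i) (frob x) = frob ((\<delta> ^^ i) x)" for i by (induction i) (simp_all add: delta_frob)
  moreover have "frob y \<in> J \<longleftrightarrow> y ^ p \<in> J" for y
    using assms by (intro idl_cong) (auto simp: frob_def p_ideal_def idl_mult_right)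
  ultimately show ?thesis by (simp add: jets_iff proot_def)
qed

text \<open>By \<open>delta_P_mult\<close>, \<delta> (p b) is \<open>frob b\<close> minus a multiple
  of p b, and \<open>frob_in_jets\<close> treats \<open>frob b\<close>. Thus multiplication by
  \<open>p\<close> gains one order at the price of a p-th root of the ideal.\<close>

lemma P_mult_in_jets:
  assumes "p_ideal J" shows "P * b \<in> jets (Suc n) J \<longleftrightarrow> b \<in> jets n (proot J)"
proof (induction n)
  case 0
  have "P * b \<in> J" using assms by (simp add: p_ideal_def idl_mult_right)
  moreover have "P ^ (p - 1) * b ^ p \<in> J"
    using assms p_ge_3 idl_dvd[of J P "P ^ (p - 1) * b ^ p"] by (simp add: p_ideal_def dvd_power)
  then have "frob b - P ^ (p - 1) * b ^ p \<in> J \<longleftrightarrow> frob b \<in> J"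
    using assms by (intro idl_cong) (auto simp: p_ideal_def idl.subspace_neg)
  ultimately show ?case using frob_in_jets[OF assms, of b 0] by (simp add: delta_P_mult)
next
  case (Suc n)
  have I: "idl.subspace (jets (Suc n) J)" using assms ideal_jets p_ideal_def by blast
  \<comment> \<open>The correction term is a multiple of p b, hence controlled by membership of p b
    one order lower; this serves both directions.\<close>
  have low: "P ^ (p - 1) * b ^ p \<in> jets (Suc n) J" if "P * b \<in> jets (Suc n) J"
  proof -
    have "P * b dvd P ^ (p - 1) * b ^ p" using p_ge_3 by (intro mult_dvd_mono dvd_power) auto
    then show ?thesis using that I idl_dvd by blast
  qed
  have "P * b \<in> J" using assms by (simp add: p_ideal_def idl_mult_right)
  then have eq: "P * b \<in> jets (Suc (Suc n)) J \<longleftrightarrow> frob b - P ^ (p - 1) * b ^ p \<in> jets (Suc n) J"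
    by (subst jets.simps(2)) (simp add: delta_P_mult del: jets.simps)
  show ?case
  proof
    assume L: "P * b \<in> jets (Suc (Suc n)) J"
    then have "P ^ (p - 1) * b ^ p \<in> jets (Suc n) J" using jets_Suc_subset low by blast
    then have "frob b \<in> jets (Suc n) J"
      using L eq I idl.subspace_add by (metis diff_add_cancel)
    then show "b \<in> jets (Suc n) (proot J)" using frob_in_jets[OF assms] by blast
  next
    assume R: "b \<in> jets (Suc n) (proot J)"
    then have "P ^ (p - 1) * b ^ p \<in> jets (Suc n) J" using Suc low jets_Suc_subset by blast
    then show "P * b \<in> jets (Suc (Suc n)) J"
      using R eq I idl.subspace_diff frob_in_jets[OF assms] by blast
  qed
qed

text \<open>One factor \<open>p\<close> is spent on each order and one more to enter
  \<open>J\<close>. Congruences modulo p^(n+1) are therefore invisible to the ideals of order n,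
  whatever \<open>J\<close> is.\<close>

lemma P_power_mult_in_jets: "p_ideal J \<Longrightarrow> P ^ Suc n * b \<in> jets n J"
proof (induction n arbitrary: J)
  case 0
  then show ?case by (simp add: p_ideal_def idl_mult_right)
next
  case (Suc n)
  then have "P ^ Suc n * b \<in> jets n (proot J)" using p_ideal_proot by blast
  then have "P * (P ^ Suc n * b) \<in> jets (Suc n) J" using P_mult_in_jets[OF Suc.prems] by blast
  then show ?case by (simp only: power_Suc mult.assoc)
qed

lemma P_mult_jets:
  assumes "p_ideal J" "b \<in> jets n J" shows "P * b \<in> jets (Suc n) J"
  using assms P_mult_in_jets jets_mono p_ideal_proot by blast

text \<open>In the successor step \<delta> (z^p) splits by \<open>delta_power_p\<close>. The first
  summand is covered by the induction hypothesis. The second needs p^2 \<delta> z in the ideal,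
  which the hypothesis on p z gives: divide by \<open>p\<close>, pass to \<delta> z, and multiply by
  \<open>p\<close> twice.\<close>

lemma power_p_in_jets:
  assumes J: "p_ideal J" and "z ^ p \<in> J" and z: "P * z \<in> jets n J"
  shows "z ^ p \<in> jets (Suc n) J"
  using z
proof (induction n)
  case 0
  obtain g where g: "\<delta> (z ^ p) = P * z ^ p * g + P ^ (p - 1) * \<delta> z ^ p" using delta_power_p by blast
  have "P dvd P * z ^ p * g" by (simp only: mult.assoc dvd_triv_left)
  moreover have "P dvd P ^ (p - 1) * \<delta> z ^ p" using p_ge_3 by (intro dvd_mult2 dvd_power) auto
  ultimately have "P dvd \<delta> (z ^ p)" unfolding g by (rule dvd_add)
  then show ?case using J assms(2) by (auto simp: p_ideal_def idl_dvd)
next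
  case (Suc n)
  obtain g where g: "\<delta> (z ^ p) = P * z ^ p * g + P ^ (p - 1) * \<delta> z ^ p" using delta_power_p by blast
  have I: "idl.subspace (jets (Suc n) J)" using J ideal_jets p_ideal_def by blast
  have zn: "P * z \<in> jets n J" using Suc.prems jets_Suc_subset by blast
  have "z \<in> jets n (proot J)" using Suc.prems P_mult_in_jets[OF J] by blast
  have "P * (P * \<delta> z) \<in> jets (Suc n) J"
  proof (cases n)
    \<comment> \<open>Here membership of z at order 0 says nothing about \<delta> z, but two factors
      \<open>p\<close> reach order 1 by themselves.\<close>
    case 0
    have "P ^ Suc (Suc 0) * \<delta> z \<in> jets (Suc 0) J" by (rule P_power_mult_in_jets[OF J])
    then show ?thesis unfolding 0 power_Suc power_0 mult.right_neutral mult.assoc .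
  next
    case (Suc m)
    then have "P * \<delta> z \<in> jets n J"
      using \<open>z \<in> jets n (proot J)\<close> P_mult_in_jets[OF J, of "\<delta> z" m] by simp
    then show ?thesis using P_mult_jets[OF J] by blast
  qed
  \<comment> \<open>The exponent p - 1 is at least 2 because \<open>p\<close> is odd; for p = 2 only
    one factor \<open>p\<close> would be available.\<close>
  moreover have "P * (P * \<delta> z) dvd P ^ (p - 1) * \<delta> z ^ p"
  proof -
    have "P ^ 2 * \<delta> z dvd P ^ (p - 1) * \<delta> z ^ p"
      using p_ge_3 by (intro mult_dvd_mono le_imp_power_dvd dvd_power) auto
    then show ?thesis by (simp only: power2_eq_square mult.assoc)
  qed
  ultimately have "P ^ (p - 1) * \<delta> z ^ p \<in> jets (Suc n) J"
    using I idl_dvd by blast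
  moreover have "P * z ^ p * g \<in> jets (Suc n) J"
    using Suc.IH[OF zn] I idl_mult_right by (simp only: mult.commute[of P] mult.assoc)
  ultimately have "\<delta> (z ^ p) \<in> jets (Suc n) J" using g I idl.subspace_add by metis
  then show ?case using assms(2) by (subst jets.simps(2)) blast
qed

text \<open>Raising to the p-th power increases the order by one, by
  \<open>power_p_in_jets\<close>.\<close>

lemma nilpotent_mod_jets:
  assumes J: "p_ideal J" and "e \<in> J" shows "\<exists>N. e ^ N \<in> jets n J"
proof (induction n)
  case 0
  then show ?case using assms by (auto intro: exI[of _ 1])
next
  case (Suc n)
  then obtain N where N: "e ^ N \<in> jets n J" by blast
  then have "e ^ N \<in> J" by (auto simp: jets_iff)
  moreover have "P * e ^ N \<in> jets n J"
    using N J ideal_jets idl.subspace_scale p_ideal_def by blast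
  ultimately have "(e ^ N) ^ p \<in> jets (Suc n) J"
    using power_p_in_jets[OF J] p_ideal_proot[OF J] unfolding proot_def by blast
  then show ?case by (metis power_mult)
qed

text \<open>As \<open>1 - w\<close> is nilpotent modulo the ideal, w is a unit there; its inverse is
  a finite geometric series.\<close>

lemma jets_cancel_unit:
  assumes J: "p_ideal J" and "1 - w \<in> J" and zw: "z * w \<in> jets n J"
  shows "z \<in> jets n J"
proof -
  define e where "e = 1 - w"
  obtain N where N: "e ^ N \<in> jets n J" using nilpotent_mod_jets[OF J] assms(2) e_def by blast
  have I: "idl.subspace (jets n J)" using J ideal_jets p_ideal_def by blast
  have "w * (\<Sum>i<N. e ^ i) + e ^ N = 1"
    using one_diff_power_eq[of e N] by (metis e_def add.commute diff_add_cancel add_diff_cancel_left' diff_diff_eq2)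
  then have "z = z * w * (\<Sum>i<N. e ^ i) + z * e ^ N"
    by (metis mult.assoc mult.right_neutral distrib_left)
  then show ?thesis using I N zw idl_mult_right idl.subspace_add idl.subspace_scale by metis
qed

text \<open>With z = u - v the difference is z^p + p z w, where w is 1 modulo \<open>proot J\<close>
  once z lies there. The summand z^p is negligible by \<open>power_p_in_jets\<close>, and dividing
  the other one by \<open>p\<close> costs one order and a p-th root of the ideal.\<close>

lemma power_p_diff_in_jets:
  assumes J: "p_ideal J" and v: "1 - v \<in> J"
  shows "u ^ p - v ^ p \<in> jets (Suc n) J \<longleftrightarrow> u - v \<in> jets n (proot J)"
proof -
  define z where "z = u - v"
  obtain g where g: "carry_poly p v z + v ^ (p - 1) * z = z ^ 2 * g"
    using carry_poly_linear_term[OF p_prime] by (metis dvdE)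
  \<comment> \<open>What stands beside p z in the expansion of (v + z)^p after v^p and z^p are set
    aside: v^(p-1) plus a multiple of z.\<close>
  define w where "w = v ^ (p - 1) - z * g"
  have eq: "u ^ p - v ^ p = z ^ p + P * (z * w)"
  proof -
    have "u ^ p = v ^ p + z ^ p - P * carry_poly p v z"
      using of_nat_mult_carry_poly[OF p_prime, of v z] by (simp add: z_def)
    moreover have "carry_poly p v z = z ^ 2 * g - v ^ (p - 1) * z" using g by (simp add: algebra_simps)
    ultimately show ?thesis
      unfolding w_def by (simp only: right_diff_distrib power2_eq_square mult_ac) simp
  qed
  note J' = p_ideal_proot[OF J]
  have I: "idl.subspace J" "idl.subspace (jets n J)" "idl.subspace (proot J)" for n
    using J J' ideal_jets p_ideal_def by blast+
  have zp: "z ^ p \<in> jets (Suc n) J" if "z \<in> proot J" "P * z \<in> jets n J" for n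
    using that power_p_in_jets[OF J] unfolding proot_def by blast
  have bwd: "u ^ p - v ^ p \<in> jets (Suc n) J" if "z \<in> jets n (proot J)" for n
  proof -
    have "P * z \<in> jets (Suc n) J" using that P_mult_in_jets[OF J] by blast
    moreover from this have "z ^ p \<in> jets (Suc n) J"
      using zp that jets_Suc_subset by (metis jets_iff le0 funpow_0 in_mono)
    ultimately show ?thesis
      unfolding eq using I(2) idl.subspace_add idl_mult_right by (metis mult.assoc)
  qed
  have zJ: "z \<in> proot J" if "u ^ p - v ^ p \<in> J"
  proof -
    have "P * (z * w) \<in> J" using J by (simp add: p_ideal_def idl_mult_right)
    then have "z ^ p \<in> J" using that I(1) idl.subspace_diff eq by (metis add_diff_cancel_right')
    then show ?thesis by (simp add: proot_def)
  qed
  \<comment> \<open>The forward direction climbs one order at a time: once z is known at order n,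
    the power z^p drops out at order n + 2, and cancelling the unit w gives z at order n +
    1.\<close>
  have fwd: "u ^ p - v ^ p \<in> jets (Suc n) J \<Longrightarrow> z \<in> jets n (proot J)" for n
  proof (induction n)
    case 0
    then show ?case using zJ by simp
  next
    case (Suc n)
    have "u ^ p - v ^ p \<in> J" using Suc.prems by (simp del: jets.simps(2) add: jets_iff) (metis funpow_0 le0)
    then have z: "z \<in> proot J" by (rule zJ)
    have "z \<in> jets n (proot J)" using Suc jets_Suc_subset by blast
    then have "z ^ p \<in> jets (Suc (Suc n)) J" using zp[OF z] P_mult_in_jets[OF J] by blast
    then have "P * (z * w) \<in> jets (Suc (Suc n)) J"
      using Suc.prems I(2) idl.subspace_diff unfolding eq by (metis add_diff_cancel_left')
    then have zw: "z * w \<in> jets (Suc n) (proot J)" using P_mult_in_jets[OF J] by blast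
    have "1 - v dvd 1 - v ^ (p - 1)" by (simp add: one_diff_power_eq)
    then have "1 - v ^ (p - 1) \<in> proot J" using v J'(2) I(3) idl_dvd by blast
    moreover have "z * g \<in> proot J" using z I(3) idl_mult_right by blast
    ultimately have "1 - w \<in> proot J"
      using I(3) idl.subspace_add unfolding w_def by (metis diff_diff_eq2 diff_add_eq)
    then show ?case using zw jets_cancel_unit[OF J'(1)] by blast
  qed
  show ?thesis using fwd bwd unfolding z_def by blast
qed

text \<open>The outermost p-th power is removed by \<open>power_p_diff_in_jets\<close>, and the
  induction hypothesis is applied to \<open>proot J\<close> in place of \<open>J\<close>.\<close>

lemma power_pk_diff_in_jets:
  assumes "p_ideal J" and "1 - v \<in> J"
  shows "u ^ (p ^ k) - v ^ (p ^ k) \<in> jets n J \<longleftrightarrow> u - v \<in> jets (n - k) {b. b ^ (p ^ k) \<in> J}"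
  using assms
proof (induction k arbitrary: n J)
  case (Suc k)
  note J' = p_ideal_proot[OF Suc.prems(1)]
  have v: "1 - v ^ (p ^ k) \<in> J"
  proof -
    have "1 - v dvd 1 - v ^ (p ^ k)" by (simp add: one_diff_power_eq)
    then show ?thesis using Suc.prems idl_dvd p_ideal_def by blast
  qed
  have IH: "u ^ (p ^ k) - v ^ (p ^ k) \<in> jets n (proot J) \<longleftrightarrow> u - v \<in> jets (n - k) {b. b ^ (p ^ k) \<in> proot J}" for n
    using Suc.IH[OF J'(1)] J'(2) Suc.prems(2) by blast
  have set: "{b. b ^ (p ^ k) \<in> proot J} = {b. b ^ (p ^ Suc k) \<in> J}"
    by (simp add: proot_def mult.commute flip: power_mult)
  show ?case
  proof (cases n)
    case 0
    \<comment> \<open>At order 0 the p-th power is additive modulo \<open>p\<close>, so no order is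
      lost; this agrees with the truncated difference.\<close>
    have "(u ^ (p ^ k)) ^ p - (v ^ (p ^ k)) ^ p \<in> J \<longleftrightarrow> u ^ (p ^ k) - v ^ (p ^ k) \<in> proot J"
    proof -
      let ?u = "u ^ (p ^ k)" and ?v = "v ^ (p ^ k)"
      have "?u ^ p - ?v ^ p = (?u - ?v) ^ p - P * carry_poly p ?v (?u - ?v)"
        using of_nat_mult_carry_poly[OF p_prime, of ?v "?u - ?v"] by simp
      moreover have "P * carry_poly p ?v (?u - ?v) \<in> J" using Suc.prems(1) by (simp add: p_ideal_def idl_mult_right)
      ultimately show ?thesis using Suc.prems(1) unfolding p_ideal_def proot_def mem_Collect_eq
        by (metis diff_add_cancel idl.subspace_add idl.subspace_diff)
    qed
    then show ?thesis using IH[of 0] 0 set by (simp add: power_mult mult.commute[of p])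
  next
    case (Suc m)
    have "(u ^ (p ^ k)) ^ p - (v ^ (p ^ k)) ^ p \<in> jets n J \<longleftrightarrow> u ^ (p ^ k) - v ^ (p ^ k) \<in> jets m (proot J)"
      unfolding Suc using power_p_diff_in_jets[OF Suc.prems(1) v] .
    then show ?thesis using IH[of m] set Suc by (simp add: power_mult mult.commute[of p])
  qed
qed simp

lemma p_ideal_pk_root: "p_ideal J \<Longrightarrow> p_ideal {b. b ^ (p ^ k) \<in> J}"
proof (induction k arbitrary: J)
  case (Suc k)
  have "{b. b ^ (p ^ Suc k) \<in> J} = {b. b ^ (p ^ k) \<in> proot J}"
    by (simp add: proot_def mult.commute flip: power_mult)
  then show ?case using Suc p_ideal_proot by metis
qed simp

text \<open>Although \<delta> is not additive, \<delta> (u - v) and \<delta> u - \<delta> v differ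
  by a carry divisible by u - v, which already lies in the ideal of lower order.\<close>

lemma diff_in_jets_iff:
  assumes "p_ideal J"
  shows "u - v \<in> jets n J \<longleftrightarrow> (\<forall>i\<le>n. (\<delta> ^^ i) u - (\<delta> ^^ i) v \<in> J)"
proof (induction n arbitrary: u v)
  case (Suc n)
  have I: "idl.subspace (jets n J)" using assms ideal_jets p_ideal_def by blast
  have *: "\<delta> (u - v) \<in> jets n J \<longleftrightarrow> \<delta> u - \<delta> v \<in> jets n J" if d: "u - v \<in> jets n J"
  proof -
    have "carry_poly p v (u - v) \<in> jets n J"
      by (rule idl_dvd[OF I d dvd_mult_right[OF carry_poly_factor]])
    moreover have "\<delta> u = \<delta> v + \<delta> (u - v) + carry_poly p v (u - v)"
      using delta_add[of v "u - v"] by simp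
    ultimately have "\<delta> (u - v) - (\<delta> u - \<delta> v) \<in> jets n J"
      using idl.subspace_neg[OF I] by (simp add: algebra_simps)
    then show ?thesis using I idl_cong by blast
  qed
  have split: "(\<forall>i\<le>Suc n. (\<delta> ^^ i) u - (\<delta> ^^ i) v \<in> J) \<longleftrightarrow>
     u - v \<in> J \<and> (\<forall>i\<le>n. (\<delta> ^^ i) (\<delta> u) - (\<delta> ^^ i) (\<delta> v) \<in> J)"
    unfolding all_le_Suc_shift by (simp only: funpow_simps_right o_apply id_apply)
  have "u - v \<in> jets (Suc n) J \<longleftrightarrow> u - v \<in> J \<and> u - v \<in> jets n J \<and> \<delta> (u - v) \<in> jets n J"
    using jets_Suc_subset by auto
  also have "\<dots> \<longleftrightarrow> u - v \<in> J \<and> u - v \<in> jets n J \<and> \<delta> u - \<delta> v \<in> jets n J" using * by blast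
  also have "\<dots> \<longleftrightarrow> (\<forall>i\<le>Suc n. (\<delta> ^^ i) u - (\<delta> ^^ i) v \<in> J)"
    unfolding Suc.IH split using split by (meson le_SucI)
  finally show ?case .
qed simp

section \<open>Ideals generated by p and the derivatives of one element\<close>

definition jet_span :: "'b \<Rightarrow> nat \<Rightarrow> 'b set" where
  "jet_span f m = idl.span (insert P ((\<lambda>i. (\<delta> ^^ i) f) ` {..m}))"

lemma p_ideal_span: "P \<in> G \<Longrightarrow> p_ideal (idl.span G)"
  by (simp add: p_ideal_def idl.span_base)

lemma jet_span_subset_iff:
  assumes "p_ideal J" shows "jet_span f m \<subseteq> J \<longleftrightarrow> f \<in> jets m J"
  using assms by (auto simp: jet_span_def jets_iff p_ideal_def idl_span_le_iff)

text \<open>Both sides contain \<open>p\<close> and lie in the same ideals \<open>J\<close>, as a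
  chain of equivalences shows; taking for \<open>J\<close> each side in turn gives equality. The
  error in f has m + 1 factors \<open>p\<close> and is not seen at order m.\<close>

theorem jet_span_power_diff:
  assumes v: "P dvd v - 1" and f: "P ^ Suc m dvd (u ^ (p ^ k) - v ^ (p ^ k)) - f"
  shows "jet_span f m = idl.span (insert P ((\<lambda>i. ((\<delta> ^^ i) u - (\<delta> ^^ i) v) ^ (p ^ k)) ` {..m - k}))"
    (is "_ = idl.span ?G")
proof -
  have iff: "jet_span f m \<subseteq> J \<longleftrightarrow> idl.span ?G \<subseteq> J" if J: "p_ideal J" for J
  proof -
    have I: "idl.subspace J" "P \<in> J" "idl.subspace (jets m J)" using J ideal_jets by (auto simp: p_ideal_def)
    have "(u ^ (p ^ k) - v ^ (p ^ k)) - f \<in> jets m J"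
      using f P_power_mult_in_jets[OF J] by (auto elim!: dvdE simp del: power_Suc)
    then have "f \<in> jets m J \<longleftrightarrow> u ^ (p ^ k) - v ^ (p ^ k) \<in> jets m J"
      using I(3) idl_cong by blast
    also have "1 - v \<in> J"
      using v I idl_dvd[of J P] by (metis dvd_minus_iff minus_diff_eq)
    then have "u ^ (p ^ k) - v ^ (p ^ k) \<in> jets m J \<longleftrightarrow> u - v \<in> jets (m - k) {b. b ^ (p ^ k) \<in> J}"
      by (rule power_pk_diff_in_jets[OF J])
    also have "\<dots> \<longleftrightarrow> (\<forall>i\<le>m - k. ((\<delta> ^^ i) u - (\<delta> ^^ i) v) ^ (p ^ k) \<in> J)"
      using diff_in_jets_iff[OF p_ideal_pk_root[OF J]] by simp
    also have "\<dots> \<longleftrightarrow> ?G \<subseteq> J" using I by auto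
    also have "\<dots> \<longleftrightarrow> idl.span ?G \<subseteq> J"
      using idl_span_le_iff[OF I(1)] by simp
    finally show ?thesis using jet_span_subset_iff[OF J] by simp
  qed
  show ?thesis
    using iff[of "jet_span f m"] iff[of "idl.span ?G"] p_ideal_span unfolding jet_span_def by blast
qed

text \<open>\<open>P_mult_in_jets\<close> applied j times: each factor \<open>p\<close> is traded
  for one order and one p-th root of the ideal.\<close>

lemma P_power_mult_in_jets_imp: "p_ideal J \<Longrightarrow> P ^ j * c \<in> jets j J \<Longrightarrow> c ^ (p ^ j) \<in> J"
proof (induction j arbitrary: J)
  case (Suc j)
  have "P * (P ^ j * c) \<in> jets (Suc j) J" using Suc.prems(2) by (simp only: power_Suc mult.assoc)
  then have "P ^ j * c \<in> jets j (proot J)" using P_mult_in_jets[OF Suc.prems(1)] by blast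
  then have "c ^ (p ^ j) \<in> proot J" using Suc.IH p_ideal_proot[OF Suc.prems(1)] by blast
  then show ?case by (simp add: proot_def mult.commute flip: power_mult)
qed simp

text \<open>u^(p^k) - 1 is f plus p^j c, so it lies in \<open>J\<close>; as a difference of p^k-th
  powers it then has order k for free. Subtracting f forces p^j c to have order j, so that a power
  of c, a unit modulo \<open>p\<close>, lands in \<open>J\<close>.\<close>

lemma jet_span_eq_UNIV:
  assumes j: "1 \<le> j" "j \<le> k" and c: "P dvd d * c - 1" and f: "f = u ^ (p ^ k) - (1 + P ^ j * c)"
    and m: "k \<le> m"
  shows "jet_span f m = UNIV"
proof -
  define J where "J = jet_span f m"
  have J: "p_ideal J" by (simp add: J_def jet_span_def p_ideal_span)
  have I: "idl.subspace J" "P \<in> J" "idl.subspace (jets n J)" for n using J ideal_jets by (auto simp: p_ideal_def)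
  have fm: "f \<in> jets m J" using jet_span_subset_iff[OF J] J_def by blast
  have fk: "f \<in> jets i J" if "i \<le> m" for i using fm that by (simp add: jets_iff)
  have "P dvd P ^ j" using j by (simp add: dvd_power)
  then have "P ^ j * c \<in> J" using I idl_dvd dvd_mult2 by blast
  moreover have "f \<in> J" using fk[of 0] by simp
  ultimately have "f + P ^ j * c \<in> J" using I(1) idl.subspace_add by blast
  then have "u ^ (p ^ k) - 1 ^ (p ^ k) \<in> jets 0 J" by (simp add: f)
  moreover have "1 - 1 \<in> J" using I(1) idl.subspace_0 by simp
  \<comment> \<open>At the orders 0 and k alike the truncated difference with k is 0, so both
    memberships amount to the same condition on u - 1.\<close>
  ultimately have "u ^ (p ^ k) - 1 ^ (p ^ k) \<in> jets k J"
    using power_pk_diff_in_jets[OF J, of 1 u k 0] power_pk_diff_in_jets[OF J, of 1 u k k] by simp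
  then have "u ^ (p ^ k) - 1 ^ (p ^ k) - f \<in> jets k J" using fk[OF m] I(3) idl.subspace_diff by blast
  moreover have "u ^ (p ^ k) - 1 ^ (p ^ k) - f = P ^ j * c" by (simp add: f)
  ultimately have "P ^ j * c \<in> jets k J" by simp
  then have "P ^ j * c \<in> jets j J" using j(2) by (simp add: jets_iff)
  then have "c ^ (p ^ j) \<in> J" by (rule P_power_mult_in_jets_imp[OF J])
  then have "(d * c) ^ (p ^ j) \<in> J" using I(1) idl.subspace_scale by (simp add: power_mult_distrib)
  moreover have "d * c - 1 dvd (d * c) ^ (p ^ j) - 1" by (simp add: power_diff_1_eq)
  then have "(d * c) ^ (p ^ j) - 1 \<in> J" using c I idl_dvd dvd_trans by blast
  ultimately have "1 \<in> J" using idl_cong[OF I(1)] by blast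
  then show ?thesis using idl.subspace_scale[OF I(1), of 1] unfolding J_def by fastforce
qed

end

section \<open>p-power roots of principal units\<close>

lemma one_plus_p_power_p:
  fixes t :: "'a::comm_ring_1"
  assumes "Factorial_Ring.prime p" "odd p" "1 \<le> k"
  shows "\<exists>s. (1 + of_nat p ^ k * t) ^ p = 1 + of_nat p ^ (k + 1) * t + of_nat p ^ (k + 2) * s"
proof -
  let ?P = "of_nat p :: 'a" and ?y = "of_nat p ^ k * t"
  have p3: "3 \<le> p"
    using assms prime_ge_2_nat[of p] by (metis even_numeral le_antisym not_less_eq_eq numeral_2_eq_2 numeral_3_eq_3)
  obtain g where g: "carry_poly p 1 ?y + 1 ^ (p - 1) * ?y = ?y ^ 2 * g"
    using carry_poly_linear_term[OF assms(1)] by (metis dvdE)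
  then have "carry_poly p 1 ?y = ?y ^ 2 * g - ?y" by (simp add: eq_diff_eq)
  then have "?P * carry_poly p 1 ?y = ?P * (?y ^ 2 * g) - ?P * ?y" by (simp only: right_diff_distrib)
  moreover have "(1 + ?y) ^ p = 1 + ?y ^ p - ?P * carry_poly p 1 ?y"
    using of_nat_mult_carry_poly[OF assms(1), of 1 ?y] by simp
  ultimately have "(1 + ?y) ^ p = 1 + ?y ^ p - (?P * (?y ^ 2 * g) - ?P * ?y)" by simp
  moreover have "?P ^ (k + 2) dvd ?y ^ p"
  proof -
    \<comment> \<open>From p \<ge> 3 and k \<ge> 1; for p = 2 and k = 1 the pure power would not be
      negligible.\<close>
    have "k + 2 \<le> k * p" using p3 assms(3) mult_le_mono[of k k 3 p] by linarith
    then show ?thesis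
      unfolding power_mult_distrib power_mult[symmetric] by (intro dvd_mult2 le_imp_power_dvd)
  qed
  moreover have "?P ^ (k + 2) dvd ?P * (?y ^ 2 * g)"
  proof -
    have "?P * (?y ^ 2 * g) = ?P ^ (2 * k + 1) * (t ^ 2 * g)"
      by (simp only: power_mult_distrib power_add power_mult[symmetric] power_one_right mult_ac)
    then show ?thesis using assms(3) by (simp only:) (intro dvd_mult2 le_imp_power_dvd, simp)
  qed
  ultimately obtain a b where "(1 + ?y) ^ p = 1 + ?P ^ (k + 2) * a - (?P ^ (k + 2) * b - ?P * ?y)"
    by (metis dvdE)
  then have "(1 + ?y) ^ p = 1 + ?P ^ (k + 1) * t + ?P ^ (k + 2) * (a - b)"
    by (simp add: algebra_simps)
  then show ?thesis by blast
qed

text \<open>Iteration of \<open>one_plus_p_power_p\<close>; the error of one stage is absorbed into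
  t as \<open>t + P * s\<close>, which leaves the leading term unchanged.\<close>

lemma one_plus_p_power_pk:
  fixes t :: "'a::comm_ring_1"
  assumes "Factorial_Ring.prime p" "odd p" "1 \<le> k"
  shows "\<exists>s. (1 + of_nat p ^ k * t) ^ (p ^ n) = 1 + of_nat p ^ (k + n) * t + of_nat p ^ (k + n + 1) * s"
proof (induction n)
  case 0
  show ?case by (auto intro: exI[of _ 0])
next
  case (Suc n)
  let ?P = "of_nat p :: 'a"
  obtain s where s: "(1 + ?P ^ k * t) ^ (p ^ n) = 1 + ?P ^ (k + n) * (t + ?P * s)"
    using Suc by (auto simp: algebra_simps)
  obtain r where r: "(1 + ?P ^ (k + n) * (t + ?P * s)) ^ p
      = 1 + ?P ^ (k + n + 1) * (t + ?P * s) + ?P ^ (k + n + 2) * r"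
    using one_plus_p_power_p[OF assms(1,2), of "k + n" "t + ?P * s"] assms(3) by auto
  have "(1 + ?P ^ k * t) ^ (p ^ Suc n) = ((1 + ?P ^ k * t) ^ (p ^ n)) ^ p"
    by (simp only: power_mult[symmetric] power_Suc mult.commute)
  also have "\<dots> = 1 + ?P ^ (k + Suc n) * t + ?P ^ (k + Suc n + 1) * (s + r)"
    unfolding s r by (simp add: algebra_simps)
  finally show ?case by blast
qed

text \<open>Newton iteration: a root modulo p^m with error p^m e is corrected by the factor 1 -
  p^(m-\<nu>) e, whose p^\<nu>-th power is 1 - p^m e modulo p^(m+1).\<close>

lemma principal_unit_approximate_root:
  fixes a :: "'a::comm_ring_1"
  assumes "Factorial_Ring.prime p" "odd p" and a: "a \<in> principal_units p (\<nu> + 1)"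
  shows "\<exists>b. of_nat p dvd b - 1 \<and> of_nat p ^ m dvd b ^ (p ^ \<nu>) - a"
proof (induction m)
  case 0
  show ?case by (auto intro: exI[of _ 1])
next
  case (Suc m)
  let ?P = "of_nat p :: 'a"
  show ?case
  proof (cases "m \<le> \<nu>")
    case True
    \<comment> \<open>For m \<le> \<nu> the hypothesis on a already gives precision m + 1 with b =
      1.\<close>
    obtain c where "a = 1 + ?P ^ (\<nu> + 1) * c" using a by (auto simp: principal_units_def)
    moreover have "?P ^ Suc m dvd ?P ^ (\<nu> + 1)" using True by (intro le_imp_power_dvd) auto
    ultimately have "?P ^ Suc m dvd 1 ^ (p ^ \<nu>) - a" by (simp del: power_Suc)
    then show ?thesis by (auto intro!: exI[of _ 1] simp del: power_Suc)
  next
    case False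
    obtain b where b: "?P dvd b - 1" "?P ^ m dvd b ^ (p ^ \<nu>) - a" using Suc by blast
    then obtain e where e: "b ^ (p ^ \<nu>) = a + ?P ^ m * e" by (metis dvdE diff_add_cancel add.commute)
    define k where "k = m - \<nu>"
    have k: "1 \<le> k" "k + \<nu> = m" using False by (auto simp: k_def)
    define b' where "b' = b * (1 + ?P ^ k * (- e))"
    obtain s where s: "(1 + ?P ^ k * (- e)) ^ (p ^ \<nu>) = 1 + ?P ^ m * (- e) + ?P ^ (m + 1) * s"
      using one_plus_p_power_pk[OF assms(1,2) k(1)] k(2) by metis
    \<comment> \<open>The correction is multiplied by b^(p^\<nu>), which is 1 modulo
      \<open>p\<close>; the discrepancy h e goes into the next power of \<open>p\<close>.\<close>
    have "b - 1 dvd b ^ (p ^ \<nu>) - 1" by (simp add: power_diff_1_eq)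
    then obtain h where h: "b ^ (p ^ \<nu>) = 1 + ?P * h"
      using b(1) by (metis dvd_trans dvdE diff_add_cancel add.commute)
    have "b' ^ (p ^ \<nu>) = b ^ (p ^ \<nu>) - b ^ (p ^ \<nu>) * (?P ^ m * e) + b ^ (p ^ \<nu>) * (?P ^ (m + 1) * s)"
      unfolding b'_def power_mult_distrib s by (simp add: algebra_simps)
    also have "b ^ (p ^ \<nu>) * (?P ^ m * e) = ?P ^ m * e + ?P ^ (m + 1) * (h * e)"
      unfolding h by (simp add: algebra_simps)
    finally have "b' ^ (p ^ \<nu>) - a = ?P ^ Suc m * (b ^ (p ^ \<nu>) * s - h * e)"
      using e by (simp add: algebra_simps)
    then have "?P ^ Suc m dvd b' ^ (p ^ \<nu>) - a" by (simp del: power_Suc)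
    moreover have "b' - 1 = (b - 1) + ?P ^ k * (- e * b)" by (simp add: b'_def algebra_simps)
    then have "?P dvd b' - 1" using b(1) k(1) by (simp only:) (intro dvd_add dvd_mult2 dvd_power, auto)
    ultimately show ?thesis by blast
  qed
qed

section \<open>Differential polynomials\<close>

text \<open>Evaluation in which h acts on the coefficients and \<open>g i\<close> replaces the
  variable of index i. Reduction modulo \<open>p\<close>, translations and retractions onto fewer
  variables are all of this form.\<close>

definition dsubst ::
  "('r::comm_ring_1 \<Rightarrow> 'b::comm_ring_1) \<Rightarrow> (nat \<Rightarrow> 'b) \<Rightarrow> 'r dpoly \<Rightarrow> 'b" where
  "dsubst h g Q = (\<Sum>t\<in>Poly_Mapping.keys Q. h (Poly_Mapping.lookup Q t) *
     (\<Prod>i\<in>Poly_Mapping.keys t. g i ^ Poly_Mapping.lookup t i))"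

lemma ring_of_type_algebra_simps [simp]:
  "carrier ring_of_type_algebra = UNIV" "monoid.mult ring_of_type_algebra = (*)"
  "one ring_of_type_algebra = 1" "zero ring_of_type_algebra = 0" "add ring_of_type_algebra = (+)"
  by (simp_all add: ring_of_type_algebra_def fun_eq_iff)

abbreviation type_hom :: "('r::comm_ring_1 \<Rightarrow> 'b::comm_ring_1) \<Rightarrow> bool" where
  "type_hom h \<equiv> h \<in> ring_hom ring_of_type_algebra ring_of_type_algebra"

lemma type_homI:
  "(\<And>x y. h (x + y) = h x + h y) \<Longrightarrow> (\<And>x y. h (x * y) = h x * h y) \<Longrightarrow> h 1 = 1 \<Longrightarrow> type_hom h"
  by (simp add: ring_hom_def)

lemma type_hom_simps:
  assumes "type_hom h"
  shows "h (x + y) = h x + h y" "h (x * y) = h x * h y" "h 1 = 1" "h 0 = 0" "h (- x) = - h x"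
    "h (x - y) = h x - h y" "h (x ^ k) = h x ^ k" "h (of_nat k) = of_nat k"
proof -
  show add: "h (x + y) = h x + h y" and mult: "h (x * y) = h x * h y" and one: "h 1 = 1" for x y
    using assms by (auto simp: ring_hom_def)
  show zero: "h 0 = 0" using add[of 0 0] by simp
  show neg: "h (- x) = - h x" for x using add[of x "- x"] zero by (simp add: add_eq_0_iff)
  show "h (x - y) = h x - h y" using add[of x "- y"] neg by simp
  show "h (x ^ k) = h x ^ k" by (induction k) (simp_all add: one mult)
  show "h (of_nat k) = of_nat k" by (induction k) (simp_all add: one zero add)
qed

lemma prod_powers_superset:
  fixes g :: "nat \<Rightarrow> 'b::comm_ring_1"
  assumes "finite S" "Poly_Mapping.keys t \<subseteq> S"
  shows "(\<Prod>i\<in>Poly_Mapping.keys t. g i ^ Poly_Mapping.lookup t i) = (\<Prod>i\<in>S. g i ^ Poly_Mapping.lookup t i)"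
  using assms by (intro prod.mono_neutral_left) (auto simp: in_keys_iff)

lemma prod_powers_add:
  fixes g :: "nat \<Rightarrow> 'b::comm_ring_1"
  shows "(\<Prod>i\<in>Poly_Mapping.keys (s + t). g i ^ Poly_Mapping.lookup (s + t) i) =
    (\<Prod>i\<in>Poly_Mapping.keys s. g i ^ Poly_Mapping.lookup s i) *
    (\<Prod>i\<in>Poly_Mapping.keys t. g i ^ Poly_Mapping.lookup t i)"
proof -
  let ?S = "Poly_Mapping.keys s \<union> Poly_Mapping.keys t"
  have "Poly_Mapping.keys (s + t) \<subseteq> ?S" by (rule keys_add)
  then have "(\<Prod>i\<in>Poly_Mapping.keys (s + t). g i ^ Poly_Mapping.lookup (s + t) i)
      = (\<Prod>i\<in>?S. g i ^ Poly_Mapping.lookup (s + t) i)"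
    by (intro prod_powers_superset) auto
  then show ?thesis
    by (simp add: prod_powers_superset[of ?S s] prod_powers_superset[of ?S t] lookup_add power_add prod.distrib)
qed

lemma sum_single_keys: "(\<Sum>t\<in>Poly_Mapping.keys Q. Poly_Mapping.single t (Poly_Mapping.lookup Q t)) = Q"
proof (rule poly_mapping_eqI)
  fix k
  have "Poly_Mapping.lookup (\<Sum>t\<in>Poly_Mapping.keys Q. Poly_Mapping.single t (Poly_Mapping.lookup Q t)) k
      = (\<Sum>t\<in>Poly_Mapping.keys Q. if t = k then Poly_Mapping.lookup Q t else 0)"
    by (simp add: lookup_sum lookup_single when_def)
  also have "\<dots> = Poly_Mapping.lookup Q k" by (simp add: in_keys_iff)
  finally show "Poly_Mapping.lookup (\<Sum>t\<in>Poly_Mapping.keys Q. Poly_Mapping.single t (Poly_Mapping.lookup Q t)) k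
      = Poly_Mapping.lookup Q k" .
qed

context
  fixes h :: "'r::comm_ring_1 \<Rightarrow> 'b::comm_ring_1" and g :: "nat \<Rightarrow> 'b"
  assumes h: "type_hom h"
begin

lemma dsubst_add: "dsubst h g (Q + Q') = dsubst h g Q + dsubst h g Q'"
  unfolding dsubst_def
  by (rule setsum_keys_plus_distrib) (simp_all add: type_hom_simps[OF h] algebra_simps)

lemma dsubst_zero: "dsubst h g 0 = 0"
  by (simp add: dsubst_def)

lemma dsubst_sum: "dsubst h g (\<Sum>x\<in>S. F x) = (\<Sum>x\<in>S. dsubst h g (F x))"
  by (induction S rule: infinite_finite_induct) (simp_all add: dsubst_add dsubst_zero)

lemma dsubst_single:
  "dsubst h g (Poly_Mapping.single t c) = h c * (\<Prod>i\<in>Poly_Mapping.keys t. g i ^ Poly_Mapping.lookup t i)"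
  by (simp add: dsubst_def type_hom_simps[OF h])

lemma dsubst_mult: "dsubst h g (Q * Q') = dsubst h g Q * dsubst h g Q'"
proof -
  let ?k = "Poly_Mapping.keys" and ?s = "\<lambda>Q t. Poly_Mapping.single t (Poly_Mapping.lookup Q t)"
  have "Q * Q' = (\<Sum>s\<in>?k Q. \<Sum>t\<in>?k Q'. ?s Q s * ?s Q' t)"
    using sum_product[of "?s Q" "?k Q" "?s Q'" "?k Q'"] by (simp add: sum_single_keys)
  then have "dsubst h g (Q * Q') = (\<Sum>s\<in>?k Q. \<Sum>t\<in>?k Q'. dsubst h g (?s Q s * ?s Q' t))"
    by (simp add: dsubst_sum)
  also have "\<dots> = (\<Sum>s\<in>?k Q. \<Sum>t\<in>?k Q'. dsubst h g (?s Q s) * dsubst h g (?s Q' t))"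
    by (simp add: mult_single dsubst_single prod_powers_add type_hom_simps[OF h] mult_ac)
  also have "\<dots> = (\<Sum>s\<in>?k Q. dsubst h g (?s Q s)) * (\<Sum>t\<in>?k Q'. dsubst h g (?s Q' t))"
    by (simp add: sum_product)
  also have "\<dots> = dsubst h g Q * dsubst h g Q'"
    by (simp add: sum_single_keys flip: dsubst_sum)
  finally show ?thesis .
qed

lemma dsubst_dconst [simp]: "dsubst h g (dconst c) = h c"
  by (simp add: dconst_def dsubst_single)

lemma dsubst_dvar [simp]: "dsubst h g (dvar i) = g i"
  by (simp add: dvar_def dsubst_single type_hom_simps[OF h])

end

lemma dconst_one: "dconst 1 = 1" and dconst_zero: "dconst 0 = 0"
  by (simp_all add: dconst_def)

lemma type_hom_dconst: "type_hom (dconst :: 'r::comm_ring_1 \<Rightarrow> _)"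
  by (rule type_homI) (simp_all add: dconst_def single_add mult_single)

lemma type_hom_dsubst: "type_hom h \<Longrightarrow> type_hom (dsubst h g)"
  by (rule type_homI)
    (simp_all add: dsubst_add dsubst_mult type_hom_simps(3) flip: dconst_one)

lemma type_hom_comp: "type_hom h \<Longrightarrow> type_hom h' \<Longrightarrow> type_hom (\<lambda>x. h' (h x))"
  by (auto simp: ring_hom_def)

lemma single_eq_monomial:
  "Poly_Mapping.single t c = dconst c * (\<Prod>i\<in>Poly_Mapping.keys t. dvar i ^ Poly_Mapping.lookup t i)"
proof -
  have pow: "dvar i ^ k = Poly_Mapping.single (Poly_Mapping.single i k) (1::'a)" for i k
  proof (induction k)
    case (Suc k)
    have "Poly_Mapping.single i 1 + Poly_Mapping.single i k = Poly_Mapping.single i (Suc k)"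
      by (simp flip: single_add)
    with Suc show ?case by (simp add: dvar_def mult_single)
  qed simp
  have prod: "(\<Prod>i\<in>S. Poly_Mapping.single (u i) (1::'a)) = Poly_Mapping.single (\<Sum>i\<in>S. u i) 1"
    for S and u :: "nat \<Rightarrow> (nat \<Rightarrow>\<^sub>0 nat)"
    by (induction S rule: infinite_finite_induct) (simp_all add: mult_single)
  show ?thesis unfolding pow prod sum_single_keys by (simp add: dconst_def mult_single)
qed

section \<open>Polynomials in the variables of index at most n\<close>

lemma carrier_dpoly_ring: "carrier (dpoly_ring n) = {Q. \<forall>t\<in>Poly_Mapping.keys Q. Poly_Mapping.keys t \<subseteq> {..n}}"
  and dpoly_ring_simps [simp]:
  "monoid.mult (dpoly_ring n) = (*)" "one (dpoly_ring n) = 1" "zero (dpoly_ring n) = 0" "add (dpoly_ring n) = (+)"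
  by (simp_all add: dpoly_ring_def)

abbreviation dp :: "nat \<Rightarrow> 'r::comm_ring_1 dpoly set" where "dp n \<equiv> carrier (dpoly_ring n)"

lemma dp_add: "Q \<in> dp n \<Longrightarrow> Q' \<in> dp n \<Longrightarrow> Q + Q' \<in> dp n"
  using keys_add[of Q Q'] unfolding carrier_dpoly_ring by blast

lemma dp_mult: "Q \<in> dp n \<Longrightarrow> Q' \<in> dp n \<Longrightarrow> Q * Q' \<in> dp n"
proof -
  assume Q: "Q \<in> dp n" "Q' \<in> dp n"
  have "Poly_Mapping.keys t \<subseteq> {..n}" if t: "t \<in> Poly_Mapping.keys (Q * Q')" for t
  proof -
    obtain a b where "t = a + b" "a \<in> Poly_Mapping.keys Q" "b \<in> Poly_Mapping.keys Q'"
      using keys_mult[of Q Q'] t by blast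
    then show ?thesis using Q keys_add[of a b] unfolding carrier_dpoly_ring by blast
  qed
  then show ?thesis unfolding carrier_dpoly_ring by blast
qed

lemma dp_dconst [simp]: "dconst c \<in> dp n" by (simp add: carrier_dpoly_ring dconst_def)
lemma dp_one [simp]: "1 \<in> dp n" using dp_dconst[of 1] by (simp add: dconst_one)
lemma dp_zero [simp]: "0 \<in> dp n" using dp_dconst[of 0] by (simp add: dconst_zero)
lemma dp_dvar [simp]: "dvar i \<in> dp n \<longleftrightarrow> i \<le> n"
  by (simp add: carrier_dpoly_ring dvar_def)
lemma dp_uminus: "Q \<in> dp n \<Longrightarrow> - Q \<in> dp n"
  by (simp add: carrier_dpoly_ring)
lemma dp_diff: "Q \<in> dp n \<Longrightarrow> Q' \<in> dp n \<Longrightarrow> Q - Q' \<in> dp n"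
  using dp_add[of Q n "- Q'"] dp_uminus[of Q' n] by simp
lemma dp_power: "Q \<in> dp n \<Longrightarrow> Q ^ k \<in> dp n" by (induction k) (simp_all add: dp_mult)
lemma dp_of_nat [simp]: "of_nat k \<in> dp n" by (induction k) (simp_all add: dp_add)
lemma dp_prod: "(\<And>x. x \<in> S \<Longrightarrow> F x \<in> dp n) \<Longrightarrow> (\<Prod>x\<in>S. F x) \<in> dp n"
  by (induction S rule: infinite_finite_induct) (simp_all add: dp_mult)
lemma dp_sum: "(\<And>x. x \<in> S \<Longrightarrow> F x \<in> dp n) \<Longrightarrow> (\<Sum>x\<in>S. F x) \<in> dp n"
  by (induction S rule: infinite_finite_induct) (simp_all add: dp_add)
lemma dp_mono: "n \<le> m \<Longrightarrow> dp n \<subseteq> dp m" unfolding carrier_dpoly_ring by fastforce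

lemma dp_exhaust: "\<exists>n. Q \<in> dp n"
proof -
  let ?V = "\<Union>t\<in>Poly_Mapping.keys Q. Poly_Mapping.keys t"
  have "finite ?V" by simp
  then have "?V \<subseteq> {..Max ?V}" using Max_ge by blast
  then have "Q \<in> dp (Max ?V)" unfolding carrier_dpoly_ring by blast
  then show ?thesis by blast
qed

lemma dpoly_induct [consumes 1, case_names const var add mult]:
  assumes "Q \<in> dp n" and const: "\<And>c. C (dconst c)" and var: "\<And>i. i \<le> n \<Longrightarrow> C (dvar i)"
    and add: "\<And>A B. C A \<Longrightarrow> C B \<Longrightarrow> C (A + B)" and mult: "\<And>A B. C A \<Longrightarrow> C B \<Longrightarrow> C (A * B)"
  shows "C Q"
proof -
  have one: "C 1" and zero: "C 0" using const[of 1] const[of 0] by (simp_all add: dconst_one dconst_zero)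
  have pow: "C (dvar i ^ k)" if "i \<le> n" for i k
    by (induction k) (simp_all add: one mult var that)
  have prod: "C (\<Prod>i\<in>S. F i)" if "\<And>i. i \<in> S \<Longrightarrow> C (F i)" for S and F :: "nat \<Rightarrow> _"
    using that by (induction S rule: infinite_finite_induct) (simp_all add: one mult)
  have sum: "C (\<Sum>i\<in>S. F i)" if "\<And>i. i \<in> S \<Longrightarrow> C (F i)" for S and F :: "(nat \<Rightarrow>\<^sub>0 nat) \<Rightarrow> _"
    using that by (induction S rule: infinite_finite_induct) (simp_all add: zero add)
  have "C (Poly_Mapping.single t (Poly_Mapping.lookup Q t))" if "t \<in> Poly_Mapping.keys Q" for t
    unfolding single_eq_monomial
  proof (intro mult const prod pow)
    show "i \<le> n" if "i \<in> Poly_Mapping.keys t" for i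
      using that assms(1) \<open>t \<in> Poly_Mapping.keys Q\<close> unfolding carrier_dpoly_ring by blast
  qed
  then have "C (\<Sum>t\<in>Poly_Mapping.keys Q. Poly_Mapping.single t (Poly_Mapping.lookup Q t))" by (rule sum)
  then show ?thesis by (simp add: sum_single_keys)
qed

lemma cring_dpoly_ring: "cring (dpoly_ring n :: 'r::comm_ring_1 dpoly ring)"
proof (rule cringI)
  show "abelian_group (dpoly_ring n :: 'r dpoly ring)"
    by (rule abelian_groupI) (auto simp: dp_add algebra_simps intro!: bexI[of _ "- _"] dp_uminus)
  show "comm_monoid (dpoly_ring n :: 'r dpoly ring)"
    by (rule comm_monoidI) (auto simp: dp_mult mult_ac)
qed (auto simp: algebra_simps)

lemma dpoly_ring_a_inv:
  assumes "(Q :: 'r::comm_ring_1 dpoly) \<in> dp n" shows "a_inv (dpoly_ring n) Q = - Q"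
proof -
  interpret cring "dpoly_ring n :: 'r dpoly ring" by (rule cring_dpoly_ring)
  show ?thesis using assms by (intro minus_equality) (auto simp: dp_uminus)
qed

lemma dpoly_ring_a_minus:
  assumes "Q' \<in> dp n" shows "a_minus (dpoly_ring n) Q Q' = Q - Q'"
  using assms by (simp add: a_minus_def dpoly_ring_a_inv)

lemma dpoly_ring_add_pow: "add_pow (dpoly_ring n) (k::nat) (Q :: 'r::comm_ring_1 dpoly) = of_nat k * Q"
proof -
  interpret cring "dpoly_ring n :: 'r dpoly ring" by (rule cring_dpoly_ring)
  show ?thesis
    by (induction k) (simp_all add: add_pow_def nat_pow_def algebra_simps)
qed

text \<open>The retraction that kills the later variables is the identity on the generators and on
  Q, so extending the ideal to R{x} adds nothing at level n. Ideals can thus be computed in the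
  whole ring, where \<delta> acts.\<close>

lemma Idl_dpoly_ring:
  fixes G :: "'r::comm_ring_1 dpoly set"
  assumes G: "G \<subseteq> dp n" and Q: "Q \<in> dp n"
  shows "Q \<in> Idl\<^bsub>dpoly_ring n\<^esub> G \<longleftrightarrow> Q \<in> idl.span G"
proof -
  interpret cring "dpoly_ring n :: 'r dpoly ring" by (rule cring_dpoly_ring)
  let ?g = "\<lambda>i. if i \<le> n then dvar i else (0 :: 'r dpoly)"
  define r where "r = dsubst (dconst :: 'r \<Rightarrow> _) ?g"
  have "type_hom r" unfolding r_def by (rule type_hom_dsubst[OF type_hom_dconst])
  note hom = type_hom_simps[OF this]
  have "?g i \<in> dp n" for i by simp
  then have r_dp: "r B \<in> dp n" for B
    unfolding r_def dsubst_def by (intro dp_sum dp_mult dp_dconst dp_prod dp_power)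
  have r_id: "r B = B" if "B \<in> dp n" for B
    using that
    by (induction rule: dpoly_induct) (simp_all add: hom(1,2), simp_all add: r_def type_hom_dconst)
  show ?thesis
  proof
    have "ideal (dp n \<inter> idl.span G) (dpoly_ring n)"
    proof (rule idealI)
      show "subgroup (dp n \<inter> idl.span G) (add_monoid (dpoly_ring n))"
        by (rule add.subgroupI)
          (auto simp: dp_add idl.span_add dpoly_ring_a_inv dp_uminus idl.span_neg intro: idl.span_zero dp_zero)
    qed (auto simp: ring_axioms dp_mult idl.span_scale idl_mult_right)
    then have "Idl\<^bsub>dpoly_ring n\<^esub> G \<subseteq> dp n \<inter> idl.span G"
      using G by (intro genideal_minimal) (auto intro: idl.span_base)
    then show "Q \<in> Idl\<^bsub>dpoly_ring n\<^esub> G \<Longrightarrow> Q \<in> idl.span G" by blast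
  next
    interpret I: ideal "Idl\<^bsub>dpoly_ring n\<^esub> G" "dpoly_ring n" by (rule genideal_ideal[OF G])
    have "idl.subspace {B. r B \<in> Idl\<^bsub>dpoly_ring n\<^esub> G}"
      using I.zero_closed I.a_closed I.I_l_closed[OF _ r_dp]
      by (intro idl.subspaceI) (simp_all add: hom)
    moreover have "G \<subseteq> {B. r B \<in> Idl\<^bsub>dpoly_ring n\<^esub> G}"
      using G genideal_self[OF G] r_id by auto
    ultimately have "idl.span G \<subseteq> {B. r B \<in> Idl\<^bsub>dpoly_ring n\<^esub> G}" by (metis idl.span_minimal)
    then show "Q \<in> idl.span G \<Longrightarrow> Q \<in> Idl\<^bsub>dpoly_ring n\<^esub> G" using r_id[OF Q] by auto
  qed
qed

lemma lookup_of_nat_mult: "Poly_Mapping.lookup (of_nat k * Q) t = of_nat k * Poly_Mapping.lookup (Q :: 'r::comm_ring_1 dpoly) t"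
proof -
  have "(of_nat k :: 'r dpoly) = Poly_Mapping.single 0 (of_nat k)" by simp
  then show ?thesis
    by (simp only: flip: mult_map_scale_conv_mult) (simp add: Poly_Mapping.map.rep_eq when_def)
qed

lemma of_nat_dvd_dpoly_iff:
  "of_nat k dvd (Q :: 'r::comm_ring_1 dpoly) \<longleftrightarrow> (\<forall>t. of_nat k dvd Poly_Mapping.lookup Q t)"
proof
  assume "\<forall>t. of_nat k dvd Poly_Mapping.lookup Q t"
  then obtain c where c: "\<And>t. Poly_Mapping.lookup Q t = of_nat k * c t" unfolding dvd_def by metis
  have "Poly_Mapping.single t (Poly_Mapping.lookup Q t) = of_nat k * Poly_Mapping.single t (c t)" for t
    unfolding c by (simp add: mult_single flip: single_of_nat)
  then have "Q = of_nat k * (\<Sum>t\<in>Poly_Mapping.keys Q. Poly_Mapping.single t (c t))"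
    using sum_single_keys[of Q] by (simp add: sum_distrib_left)
  then show "of_nat k dvd Q" by (rule dvdI)
qed (auto simp: lookup_of_nat_mult elim!: dvdE)

text \<open>Ideals of the target of a surjection correspond to ideals of the source that contain the
  kernel, here the principal ideal of c.\<close>

lemma surj_hom_span_iff:
  assumes h: "type_hom h" "surj h" and ker: "\<And>Q. h Q = 0 \<longleftrightarrow> c dvd Q"
  shows "h Q \<in> idl.span (h ` G) \<longleftrightarrow> Q \<in> idl.span (insert c G)"
proof
  note hom = type_hom_simps[OF h(1)]
  have "idl.subspace {B. h B \<in> idl.span (h ` G)}"
    by (rule idl.subspaceI) (simp_all add: hom idl.span_zero idl.span_add idl.span_scale)
  moreover have "h c = 0" using ker by simp
  then have "insert c G \<subseteq> {B. h B \<in> idl.span (h ` G)}" by (auto intro: idl.span_base idl.span_zero)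
  ultimately have "idl.span (insert c G) \<subseteq> {B. h B \<in> idl.span (h ` G)}" by (metis idl.span_minimal)
  then show "Q \<in> idl.span (insert c G) \<Longrightarrow> h Q \<in> idl.span (h ` G)" by blast
next
  note hom = type_hom_simps[OF h(1)]
  let ?I = "idl.span (insert c G)"
  have "idl.subspace (h ` ?I)"
  proof (rule idl.subspaceI)
    show "0 \<in> h ` ?I" using hom(4) idl.span_zero by (metis imageI)
    show "x + y \<in> h ` ?I" if "x \<in> h ` ?I" "y \<in> h ` ?I" for x y
      using that by (auto simp: idl.span_add simp flip: hom(1) intro!: imageI)
    show "r * x \<in> h ` ?I" if "x \<in> h ` ?I" for r x
      using that surjD[OF h(2), of r] by (auto simp: idl.span_scale simp flip: hom(2) intro!: imageI)
  qed
  moreover have "h ` G \<subseteq> h ` ?I" by (auto intro: idl.span_base)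
  ultimately have "idl.span (h ` G) \<subseteq> h ` ?I" by (metis idl.span_minimal)
  moreover assume "h Q \<in> idl.span (h ` G)"
  ultimately obtain Q' where Q': "Q' \<in> ?I" "h Q = h Q'" by auto
  then have "c dvd Q - Q'" using ker[of "Q - Q'"] by (simp add: hom)
  then have "Q - Q' \<in> ?I" using idl_dvd[OF idl.subspace_span] idl.span_base by (metis insertI1)
  then show "Q \<in> ?I" using Q' idl_cong[OF idl.subspace_span] by blast
qed

lemma translation_hom:
  fixes \<rho> :: "'r::comm_ring_1 \<Rightarrow> 'k::comm_ring_1" and e :: "nat \<Rightarrow> 'k"
  assumes \<rho>: "residue_map p \<rho>"
  defines "\<tau> \<equiv> dsubst (\<lambda>c. dconst (\<rho> c)) (\<lambda>i. dvar i + dconst (e i))"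
  shows "type_hom \<tau>" "surj \<tau>" "\<tau> Q = 0 \<longleftrightarrow> of_nat p dvd Q" "\<tau> ` dp n = dp n"
proof -
  have \<rho>h: "type_hom \<rho>" and \<rho>s: "surj \<rho>" and \<rho>k: "\<And>c. \<rho> c = 0 \<longleftrightarrow> of_nat p dvd c"
    using \<rho> by (auto simp: residue_map_def)
  have ch: "type_hom (\<lambda>c. dconst (\<rho> c))" by (rule type_hom_comp[OF \<rho>h type_hom_dconst])
  show th: "type_hom \<tau>" unfolding \<tau>_def by (rule type_hom_dsubst[OF ch])
  note hom = type_hom_simps[OF th]
  have \<tau>c: "\<tau> (dconst c) = dconst (\<rho> c)" and \<tau>v: "\<tau> (dvar i) = dvar i + dconst (e i)" for c i
    by (simp_all add: \<tau>_def ch)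
  have img: "B \<in> \<tau> ` dp n" if "B \<in> dp n" for B n
    using that
  proof (induction rule: dpoly_induct)
    case (const c)
    then show ?case using \<tau>c surjD[OF \<rho>s, of c] by (metis dp_dconst imageI)
  next
    case (var i)
    obtain c where "e i = \<rho> c" using surjD[OF \<rho>s] by blast
    then have "dvar i = \<tau> (dvar i - dconst c)" by (simp add: hom \<tau>c \<tau>v)
    then show ?case using var dp_diff by (metis dp_dconst dp_dvar imageI)
  next
    case (add A B)
    then show ?case by (auto simp: dp_add simp flip: hom(1) intro!: imageI)
  next
    case (mult A B)
    then show ?case by (auto simp: dp_mult simp flip: hom(2) intro!: imageI)
  qed
  then show "surj \<tau>" using dp_exhaust by (metis (no_types, lifting) UNIV_eq_I image_iff rangeI)
  have "\<tau> B \<in> dp n" if "B \<in> dp n" for B n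
    using that by (induction rule: dpoly_induct) (simp_all add: \<tau>c \<tau>v hom dp_add dp_mult)
  then show "\<tau> ` dp n = dp n" using img by blast
  \<comment> \<open>Undoing the translation leaves the plain reduction of coefficients, which
    vanishes exactly when \<open>p\<close> divides every coefficient.\<close>
  define \<sigma> where "\<sigma> = dsubst (dconst :: 'k \<Rightarrow> _) (\<lambda>i. dvar i - dconst (e i))"
  have sh: "type_hom \<sigma>" unfolding \<sigma>_def by (rule type_hom_dsubst[OF type_hom_dconst])
  have rh: "type_hom (dsubst (\<lambda>c. dconst (\<rho> c)) dvar)" by (rule type_hom_dsubst[OF ch])
  obtain n where "Q \<in> dp n" using dp_exhaust by blast
  then have st: "\<sigma> (\<tau> Q) = dsubst (\<lambda>c. dconst (\<rho> c)) dvar Q"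
  proof (induction rule: dpoly_induct)
    case (const c)
    then show ?case by (simp add: \<tau>c ch) (simp add: \<sigma>_def type_hom_dconst)
  next
    case (var i)
    then show ?case by (simp add: \<tau>v ch type_hom_simps[OF sh]) (simp add: \<sigma>_def type_hom_dconst)
  qed (simp_all only: hom(1,2) type_hom_simps(1,2)[OF sh] type_hom_simps(1,2)[OF rh])
  have "dsubst (\<lambda>c. dconst (\<rho> c)) dvar Q = (\<Sum>t\<in>Poly_Mapping.keys Q. Poly_Mapping.single t (\<rho> (Poly_Mapping.lookup Q t)))"
    unfolding dsubst_def by (simp flip: single_eq_monomial)
  then have lk: "Poly_Mapping.lookup (dsubst (\<lambda>c. dconst (\<rho> c)) dvar Q) t = \<rho> (Poly_Mapping.lookup Q t)" for t
    by (simp add: lookup_sum lookup_single when_def in_keys_iff type_hom_simps(4)[OF \<rho>h] if_distrib cong: if_cong)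
  show "\<tau> Q = 0 \<longleftrightarrow> of_nat p dvd Q"
  proof
    assume "\<tau> Q = 0"
    then have "dsubst (\<lambda>c. dconst (\<rho> c)) dvar Q = 0" using st type_hom_simps(4)[OF sh] by simp
    then have "\<rho> (Poly_Mapping.lookup Q t) = 0" for t using lk[of t] by simp
    then show "of_nat p dvd Q" using \<rho>k of_nat_dvd_dpoly_iff by blast
  next
    assume "of_nat p dvd Q"
    moreover have "\<tau> (of_nat p) = 0"
    proof -
      have "\<rho> (of_nat p) = 0" using \<rho>k by simp
      then have "(of_nat p :: 'k) = 0" using type_hom_simps(8)[OF \<rho>h] by simp
      then have "(of_nat p :: 'k dpoly) = 0" by (metis single_of_nat single_zero)
      then show ?thesis using hom(8) by simp
    qed
    ultimately show "\<tau> Q = 0" by (auto simp: hom(2) elim!: dvdE)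
  qed
qed

section \<open>Quotients and completions\<close>

text \<open>Both rings are presented as images of the same A, so it suffices that the two
  surjections identify the same pairs. This spares a direct definition of the isomorphism on nested
  cosets.\<close>

lemma alg_iso_of_surjections:
  assumes A: "ring A" and \<theta>: "\<theta> \<in> ring_hom A B" "\<theta> ` carrier A = carrier B"
    and \<theta>': "\<theta>' \<in> ring_hom A B'" "\<theta>' ` carrier A = carrier B'"
    and ker: "\<And>x y. x \<in> carrier A \<Longrightarrow> y \<in> carrier A \<Longrightarrow> \<theta> x = \<theta> y \<longleftrightarrow> \<theta>' x = \<theta>' y"
    and \<sigma>: "\<And>c. \<sigma> c \<in> carrier A" "\<And>c. s c = \<theta> (\<sigma> c)" "\<And>c. t c = \<theta>' (\<sigma> c)"
  shows "alg_iso B s B' t"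
proof -
  interpret A: ring A by (rule A)
  define h where "h b = \<theta>' (inv_into (carrier A) \<theta> b)" for b
  have h: "h (\<theta> x) = \<theta>' x" if "x \<in> carrier A" for x
    unfolding h_def using that ker by (metis f_inv_into_f imageI inv_into_into)
  have "h \<in> ring_iso B B'"
  proof (rule ring_iso_memI)
    fix x y assume "x \<in> carrier B" "y \<in> carrier B"
    then obtain u v where uv: "u \<in> carrier A" "v \<in> carrier A" "x = \<theta> u" "y = \<theta> v"
      unfolding \<theta>(2)[symmetric] by auto
    show "h (x \<otimes>\<^bsub>B\<^esub> y) = h x \<otimes>\<^bsub>B'\<^esub> h y"
      using uv h[of "u \<otimes>\<^bsub>A\<^esub> v"] by (simp add: ring_hom_mult[OF \<theta>(1)] ring_hom_mult[OF \<theta>'(1)] h)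
    show "h (x \<oplus>\<^bsub>B\<^esub> y) = h x \<oplus>\<^bsub>B'\<^esub> h y"
      using uv h[of "u \<oplus>\<^bsub>A\<^esub> v"] by (simp add: ring_hom_add[OF \<theta>(1)] ring_hom_add[OF \<theta>'(1)] h)
  next
    show "h \<one>\<^bsub>B\<^esub> = \<one>\<^bsub>B'\<^esub>"
      using h[of "\<one>\<^bsub>A\<^esub>"] by (simp add: ring_hom_one[OF \<theta>(1)] ring_hom_one[OF \<theta>'(1)])
    have "inj_on h (carrier B)"
      unfolding \<theta>(2)[symmetric] by (rule inj_onI) (auto simp: h ker)
    moreover have "h ` carrier B = carrier B'"
      unfolding \<theta>(2)[symmetric] \<theta>'(2)[symmetric] image_image by (rule image_cong) (auto simp: h)
    ultimately show "bij_betw h (carrier B) (carrier B')" by (rule bij_betw_imageI)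
    then show "h x \<in> carrier B'" if "x \<in> carrier B" for x using that bij_betwE by blast
  qed
  then show ?thesis unfolding alg_iso_def using h \<sigma> by auto
qed

lemma alg_iso_trans: "alg_iso A r B s \<Longrightarrow> alg_iso B s C t \<Longrightarrow> alg_iso A r C t"
  unfolding alg_iso_def using ring_iso_set_trans by (metis comp_apply)

context
  fixes A (structure) and I
  assumes A: "cring A" and I: "ideal I A"
begin

interpretation cring A by (rule A)
interpretation ideal I A by (rule I)

lemma quot_carrier: "carrier (A Quot I) = {I +> x | x. x \<in> carrier A}"
  by (auto simp: FactRing_simps)

lemma quot_ops:
  assumes "x \<in> carrier A" "y \<in> carrier A"
  shows "(I +> x) \<otimes>\<^bsub>A Quot I\<^esub> (I +> y) = I +> (x \<otimes> y)" "(I +> x) \<oplus>\<^bsub>A Quot I\<^esub> (I +> y) = I +> (x \<oplus> y)"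
  using assms ring_hom_mult[OF rcos_ring_hom] ring_hom_add[OF rcos_ring_hom] by auto

lemma quot_one_zero: "\<one>\<^bsub>A Quot I\<^esub> = I +> \<one>" "\<zero>\<^bsub>A Quot I\<^esub> = I +> \<zero>" "\<zero>\<^bsub>A Quot I\<^esub> = I"
  using a_rcos_zero[OF I zero_closed] by (simp_all add: FactRing_def)

lemma quot_eq_iff:
  "x \<in> carrier A \<Longrightarrow> y \<in> carrier A \<Longrightarrow> I +> x = I +> y \<longleftrightarrow> x \<ominus> y \<in> I"
  using quotient_eq_iff_same_a_r_cos[OF I] by blast

lemma quot_eq_zero_iff: "x \<in> carrier A \<Longrightarrow> I +> x = I \<longleftrightarrow> x \<in> I"
  using quot_eq_iff[of x \<zero>] a_rcos_zero[OF I zero_closed] by (simp add: a_minus_def)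

lemma cring_quot: "cring (A Quot I)"
  by (rule quotient_is_cring[OF A])

end

context
  fixes A :: "('a, 'm) ring_scheme" and B :: "('b, 'n) ring_scheme" and I J g
  assumes A: "cring A" and B: "cring B" and I: "ideal I A" and J: "ideal J B"
    and g: "g \<in> ring_hom A B" and gI: "\<And>x. x \<in> I \<Longrightarrow> g x \<in> J"
begin

lemma coset_map_coset:
  assumes x: "x \<in> carrier A" shows "coset_map B J g (I +>\<^bsub>A\<^esub> x) = J +>\<^bsub>B\<^esub> g x"
proof -
  interpret A: cring A by (rule A)
  interpret B: cring B by (rule B)
  interpret I: ideal I A by (rule I)
  interpret J: ideal J B by (rule J)
  have "J +>\<^bsub>B\<^esub> g y = J +>\<^bsub>B\<^esub> g x" if "y \<in> I +>\<^bsub>A\<^esub> x" for y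
  proof -
    obtain i where i: "i \<in> I" "y = i \<oplus>\<^bsub>A\<^esub> x" using \<open>y \<in> _\<close> by (auto simp: a_r_coset_def')
    then have "g y = g i \<oplus>\<^bsub>B\<^esub> g x" using x I.Icarr ring_hom_add[OF g] by auto
    then have "g y \<in> J +>\<^bsub>B\<^esub> g x" using gI[OF i(1)] by (auto simp: a_r_coset_def')
    then show ?thesis using J.a_repr_independence' ring_hom_closed[OF g x] by blast
  qed
  moreover have "x \<in> I +>\<^bsub>A\<^esub> x" using I.a_rcos_self[OF x] .
  ultimately show ?thesis unfolding coset_map_def by blast
qed

lemma coset_map_hom: "coset_map B J g \<in> ring_hom (A Quot I) (B Quot J)"
proof -
  interpret A: cring A by (rule A)
  interpret B: cring B by (rule B)
  note gc = ring_hom_closed[OF g]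
  show ?thesis
  proof (rule ring_hom_memI)
    fix C D assume "C \<in> carrier (A Quot I)"
    then obtain x where x: "x \<in> carrier A" "C = I +>\<^bsub>A\<^esub> x" by (auto simp: quot_carrier[OF A I])
    then show "coset_map B J g C \<in> carrier (B Quot J)"
      using gc by (auto simp: coset_map_coset quot_carrier[OF B J])
    assume "D \<in> carrier (A Quot I)"
    then obtain y where y: "y \<in> carrier A" "D = I +>\<^bsub>A\<^esub> y" by (auto simp: quot_carrier[OF A I])
    show "coset_map B J g (C \<otimes>\<^bsub>A Quot I\<^esub> D) = coset_map B J g C \<otimes>\<^bsub>B Quot J\<^esub> coset_map B J g D"
      "coset_map B J g (C \<oplus>\<^bsub>A Quot I\<^esub> D) = coset_map B J g C \<oplus>\<^bsub>B Quot J\<^esub> coset_map B J g D"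
      using x y gc
      by (simp_all add: quot_ops[OF A I] quot_ops[OF B J] coset_map_coset ring_hom_mult[OF g] ring_hom_add[OF g])
  next
    show "coset_map B J g \<one>\<^bsub>A Quot I\<^esub> = \<one>\<^bsub>B Quot J\<^esub>"
      by (simp add: quot_one_zero(1)[OF A I] quot_one_zero(1)[OF B J] coset_map_coset ring_hom_one[OF g])
  qed
qed

end

lemma hom_add_pow:
  assumes "ring A" "ring B" "g \<in> ring_hom A B" "x \<in> carrier A"
  shows "g (add_pow A (k::nat) x) = add_pow B k (g x)"
proof -
  interpret A: ring A by fact
  interpret B: ring B by fact
  show ?thesis
    by (induction k) (simp_all add: assms(4) ring_hom_add[OF assms(3)] ring_hom_zero[OF assms(3,1,2)])
qed

lemma hom_a_minus:
  assumes "ring A" "ring B" "g \<in> ring_hom A B" "x \<in> carrier A" "y \<in> carrier A"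
  shows "g (x \<ominus>\<^bsub>A\<^esub> y) = g x \<ominus>\<^bsub>B\<^esub> g y"
proof -
  interpret ring_hom_ring A B g using assms by (intro ring_hom_ringI2)
  show ?thesis using assms by (simp add: a_minus_def)
qed

lemma (in cring) padic_ideal_eq: "padic_ideal p R m = {add_pow R (p ^ m) y | y. y \<in> carrier R}"
proof -
  have "y \<otimes> add_pow R (p ^ m) \<one> = add_pow R (p ^ m) y" if "y \<in> carrier R" for y
    using that by (simp add: add_pow_rdistr)
  then show ?thesis unfolding padic_ideal_def cgenideal_def by (intro Collect_cong) metis
qed

context
  fixes p :: nat and A (structure)
  assumes A: "cring A"
begin

interpretation cring A by (rule A)

lemma ideal_padic_ideal: "ideal (padic_ideal p A m) A"
  unfolding padic_ideal_def by (intro cgenideal_ideal) simp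

lemma padic_ideal_Suc_subset: "padic_ideal p A (Suc m) \<subseteq> padic_ideal p A m"
proof
  fix x assume "x \<in> padic_ideal p A (Suc m)"
  then obtain y where y: "y \<in> carrier A" "x = add_pow A (p ^ Suc m) y" by (auto simp: padic_ideal_eq)
  then have "x = add_pow A (p ^ m) (add_pow A p y)" by (simp add: add.nat_pow_pow)
  then show "x \<in> padic_ideal p A m" using y by (auto simp: padic_ideal_eq)
qed

abbreviation (input) "PI \<equiv> padic_ideal p A"

text \<open>Elements of the inverse limit are handled through compatible representatives in A;
  \<open>completion_cosetE\<close> is the converse.\<close>

lemma completion_cosetI:
  assumes "\<And>m. r m \<in> carrier A" "\<And>m. r (Suc m) \<ominus> r m \<in> PI m"
  shows "(\<lambda>m. PI m +> r m) \<in> carrier (padic_completion p A)"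
proof -
  have "coset_map A (PI m) id (PI (Suc m) +> r (Suc m)) = PI m +> r m" for m
  proof -
    have "coset_map A (PI m) id (PI (Suc m) +> r (Suc m)) = PI m +> id (r (Suc m))"
      using padic_ideal_Suc_subset assms(1)
      by (intro coset_map_coset[OF A A ideal_padic_ideal ideal_padic_ideal]) (auto simp: ring_hom_def)
    then show ?thesis using assms quot_eq_iff[OF A ideal_padic_ideal] by simp
  qed
  then show ?thesis
    using assms(1) by (auto simp: padic_completion_def quot_carrier[OF A ideal_padic_ideal])
qed

lemma completion_cosetE:
  assumes "s \<in> carrier (padic_completion p A)"
  obtains r where "\<And>m. r m \<in> carrier A" "\<And>m. r (Suc m) \<ominus> r m \<in> PI m" "s = (\<lambda>m. PI m +> r m)"
proof -
  have "s m \<in> carrier (A Quot PI m)" for m using assms by (simp add: padic_completion_def)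
  then have "\<forall>m. \<exists>x. x \<in> carrier A \<and> s m = PI m +> x"
    unfolding quot_carrier[OF A ideal_padic_ideal] by blast
  then obtain r where r: "\<And>m. r m \<in> carrier A" "\<And>m. s m = PI m +> r m" by metis
  have "r (Suc m) \<ominus> r m \<in> PI m" for m
  proof -
    have "coset_map A (PI m) id (PI (Suc m) +> r (Suc m)) = PI m +> id (r (Suc m))"
      using padic_ideal_Suc_subset r(1)
      by (intro coset_map_coset[OF A A ideal_padic_ideal ideal_padic_ideal]) (auto simp: ring_hom_def)
    moreover have "coset_map A (PI m) id (s (Suc m)) = s m" using assms by (simp add: padic_completion_def)
    ultimately have "PI m +> r (Suc m) = PI m +> r m" using r(2) by simp
    then show ?thesis using r(1) quot_eq_iff[OF A ideal_padic_ideal] by blast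
  qed
  moreover have "s = (\<lambda>m. PI m +> r m)" using r(2) by blast
  ultimately show ?thesis using r(1) that by blast
qed

lemma completion_ops:
  "s \<otimes>\<^bsub>padic_completion p A\<^esub> t = (\<lambda>m. s m \<otimes>\<^bsub>A Quot PI m\<^esub> t m)"
  "s \<oplus>\<^bsub>padic_completion p A\<^esub> t = (\<lambda>m. s m \<oplus>\<^bsub>A Quot PI m\<^esub> t m)"
  "\<one>\<^bsub>padic_completion p A\<^esub> = (\<lambda>m. PI m +> \<one>)" "\<zero>\<^bsub>padic_completion p A\<^esub> = (\<lambda>m. PI m +> \<zero>)"
  by (simp_all add: padic_completion_def quot_one_zero(1,2)[OF A ideal_padic_ideal])

lemma completion_coset_ops:
  assumes "\<And>m. r m \<in> carrier A" "\<And>m. r' m \<in> carrier A"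
  shows "(\<lambda>m. PI m +> r m) \<otimes>\<^bsub>padic_completion p A\<^esub> (\<lambda>m. PI m +> r' m) = (\<lambda>m. PI m +> (r m \<otimes> r' m))"
    "(\<lambda>m. PI m +> r m) \<oplus>\<^bsub>padic_completion p A\<^esub> (\<lambda>m. PI m +> r' m) = (\<lambda>m. PI m +> (r m \<oplus> r' m))"
  using assms by (simp_all add: completion_ops quot_ops[OF A ideal_padic_ideal])

text \<open>The identities hold in each component A/p^m; only closure and negatives require the
  compatibility between components.\<close>

lemma cring_completion: "cring (padic_completion p A)"
proof -
  let ?C = "padic_completion p A"
  have closed: "s \<otimes>\<^bsub>?C\<^esub> t \<in> carrier ?C" "s \<oplus>\<^bsub>?C\<^esub> t \<in> carrier ?C"
    if st: "s \<in> carrier ?C" "t \<in> carrier ?C" for s t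
  proof -
    obtain r where r: "\<And>m. r m \<in> carrier A" "\<And>m. r (Suc m) \<ominus> r m \<in> PI m" "s = (\<lambda>m. PI m +> r m)"
      by (rule completion_cosetE[OF st(1)]) (rule that)
    obtain r' where r': "\<And>m. r' m \<in> carrier A" "\<And>m. r' (Suc m) \<ominus> r' m \<in> PI m" "t = (\<lambda>m. PI m +> r' m)"
      by (rule completion_cosetE[OF st(2)]) (rule that)
    have q: "PI m +> r (Suc m) = PI m +> r m" "PI m +> r' (Suc m) = PI m +> r' m" for m
      using r r' quot_eq_iff[OF A ideal_padic_ideal] by blast+
    have "PI m +> (r (Suc m) \<otimes> r' (Suc m)) = PI m +> (r m \<otimes> r' m)"
      "PI m +> (r (Suc m) \<oplus> r' (Suc m)) = PI m +> (r m \<oplus> r' m)" for m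
      using r(1) r'(1) q by (simp_all flip: quot_ops[OF A ideal_padic_ideal])
    then have "r (Suc m) \<otimes> r' (Suc m) \<ominus> r m \<otimes> r' m \<in> PI m"
      "(r (Suc m) \<oplus> r' (Suc m)) \<ominus> (r m \<oplus> r' m) \<in> PI m" for m
      using r(1) r'(1) quot_eq_iff[OF A ideal_padic_ideal] by simp_all
    then show "s \<otimes>\<^bsub>?C\<^esub> t \<in> carrier ?C" "s \<oplus>\<^bsub>?C\<^esub> t \<in> carrier ?C"
      using r(1) r'(1) unfolding r(3) r'(3) completion_coset_ops[OF r(1) r'(1)]
      by (auto intro!: completion_cosetI)
  qed
  have quot: "cring (A Quot PI m)" for m by (rule cring_quot[OF A ideal_padic_ideal])
  have car: "s m \<in> carrier (A Quot PI m)" if "s \<in> carrier ?C" for s m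
    using that by (simp add: padic_completion_def)
  note ops = completion_ops(1,2)
  have one: "\<one>\<^bsub>?C\<^esub> = (\<lambda>m. \<one>\<^bsub>A Quot PI m\<^esub>)" and zero: "\<zero>\<^bsub>?C\<^esub> = (\<lambda>m. \<zero>\<^bsub>A Quot PI m\<^esub>)"
    by (simp_all add: padic_completion_def)
  have const: "(\<lambda>m. PI m +> x) \<in> carrier ?C" if "x \<in> carrier A" for x
    using that additive_subgroup.zero_closed[OF ideal.axioms(1)[OF ideal_padic_ideal]]
    by (intro completion_cosetI) (auto simp: a_minus_def r_neg)
  have one_closed': "\<one>\<^bsub>?C\<^esub> \<in> carrier ?C" and zero_closed': "\<zero>\<^bsub>?C\<^esub> \<in> carrier ?C"
    unfolding completion_ops(3,4) by (simp_all add: const)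
  note ax = cring.cring_simprules(7,8,10,11,12,14)[OF quot]
  show ?thesis
  proof (rule cringI)
    show "abelian_group ?C"
    proof (rule abelian_groupI)
      show "\<exists>y\<in>carrier ?C. y \<oplus>\<^bsub>?C\<^esub> x = \<zero>\<^bsub>?C\<^esub>" if "x \<in> carrier ?C" for x
      proof -
        from that obtain r where r: "\<And>m. r m \<in> carrier A" "\<And>m. r (Suc m) \<ominus> r m \<in> PI m" "x = (\<lambda>m. PI m +> r m)"
          by (metis completion_cosetE)
        have "(\<ominus> r (Suc m)) \<ominus> (\<ominus> r m) \<in> PI m" for m
        proof -
          have "(\<ominus> r (Suc m)) \<ominus> (\<ominus> r m) = \<ominus> (r (Suc m) \<ominus> r m)"
            using r(1) by (simp add: a_minus_def minus_add)
          then show ?thesis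
            using r(2) additive_subgroup.a_inv_closed[OF ideal.axioms(1)[OF ideal_padic_ideal]] by metis
        qed
        then have "(\<lambda>m. PI m +> (\<ominus> r m)) \<in> carrier ?C" using r(1) by (intro completion_cosetI) auto
        moreover have "(\<lambda>m. PI m +> (\<ominus> r m)) \<oplus>\<^bsub>?C\<^esub> x = \<zero>\<^bsub>?C\<^esub>"
          using r by (simp add: completion_coset_ops completion_ops(4) l_neg)
        ultimately show ?thesis by blast
      qed
    qed (simp_all only: closed zero_closed', simp_all add: ops zero car ax(1-3))
    show "comm_monoid ?C"
      by (rule comm_monoidI) (simp_all only: closed one_closed', simp_all add: ops one car ax(4-6))
    show "(x \<oplus>\<^bsub>?C\<^esub> y) \<otimes>\<^bsub>?C\<^esub> z = x \<otimes>\<^bsub>?C\<^esub> z \<oplus>\<^bsub>?C\<^esub> y \<otimes>\<^bsub>?C\<^esub> z"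
      if "x \<in> carrier ?C" "y \<in> carrier ?C" "z \<in> carrier ?C" for x y z
      using that by (simp add: ops car cring.cring_simprules(13)[OF quot])
  qed
qed

lemma to_completion_hom: "to_completion p A \<in> ring_hom A (padic_completion p A)"
proof (rule ring_hom_memI)
  show "to_completion p A x \<in> carrier (padic_completion p A)" if "x \<in> carrier A" for x
    unfolding to_completion_def
    using that additive_subgroup.zero_closed[OF ideal.axioms(1)[OF ideal_padic_ideal]]
    by (intro completion_cosetI) (auto simp: a_minus_def r_neg)
qed (simp_all add: to_completion_def completion_coset_ops completion_ops(3))

lemma completion_add_pow:
  assumes "\<And>m. r m \<in> carrier A" "(\<lambda>m. PI m +> r m) \<in> carrier (padic_completion p A)"
  shows "add_pow (padic_completion p A) (k::nat) (\<lambda>m. PI m +> r m) = (\<lambda>m. PI m +> add_pow A k (r m))"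
proof -
  interpret C: cring "padic_completion p A" by (rule cring_completion)
  show ?thesis
    by (induction k) (simp_all add: assms completion_coset_ops completion_ops(4))
qed

text \<open>In the torsion free case, \<open>p\<close> times a class modulo \<open>p\<^sup>m\<close> is a well defined class modulo \<open>p\<^sup>m\<^sup>+\<^sup>1\<close>.\<close>

context
  assumes tf: "\<And>x. x \<in> carrier A \<Longrightarrow> add_pow A p x = \<zero> \<Longrightarrow> x = \<zero>"
begin

lemma padic_ideal_cancel:
  assumes x: "x \<in> carrier A" and "add_pow A p x \<in> PI (Suc m)"
  shows "x \<in> PI m"
proof -
  obtain y where y: "y \<in> carrier A" "add_pow A p x = add_pow A (p ^ Suc m) y"
    using assms(2) by (auto simp: padic_ideal_eq)
  have "add_pow A (p ^ Suc m) y = add_pow A p (add_pow A (p ^ m) y)"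
    using y by (simp add: add.nat_pow_pow mult.commute)
  then have "add_pow A p (x \<ominus> add_pow A (p ^ m) y) = \<zero>"
    using x y by (simp add: a_minus_def add.nat_pow_distrib add.nat_pow_inv r_neg)
  then have "x \<ominus> add_pow A (p ^ m) y = \<zero>" using tf x y by simp
  then have "x = add_pow A (p ^ m) y" using x y by (simp add: r_right_minus_eq)
  then show ?thesis using y by (auto simp: padic_ideal_eq)
qed

text \<open>If p r(m+1) lies in p^(m+1) A, then r(m+1) lies in p^m A, and it agrees with r(m) modulo
  p^m: vanishing at one level comes from the next.\<close>

lemma completion_torsion_free:
  assumes s: "s \<in> carrier (padic_completion p A)"
    and ps: "add_pow (padic_completion p A) p s = \<zero>\<^bsub>padic_completion p A\<^esub>"
  shows "s = \<zero>\<^bsub>padic_completion p A\<^esub>"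
proof -
  obtain r where r: "\<And>m. r m \<in> carrier A" "\<And>m. r (Suc m) \<ominus> r m \<in> PI m" "s = (\<lambda>m. PI m +> r m)"
    using s by (metis completion_cosetE)
  have "PI m +> r m = PI m +> \<zero>" for m
  proof -
    have "PI (Suc m) +> add_pow A p (r (Suc m)) = PI (Suc m) +> \<zero>"
      using fun_cong[OF ps, of "Suc m"] completion_add_pow[OF r(1)] s unfolding r(3)
      by (simp add: completion_ops)
    then have "add_pow A p (r (Suc m)) \<in> PI (Suc m)"
      using quot_eq_iff[OF A ideal_padic_ideal] r(1) by (simp add: a_minus_def)
    then have "r (Suc m) \<in> PI m" using padic_ideal_cancel r(1) by blast
    then have "PI m +> r (Suc m) = PI m +> \<zero>"
      using quot_eq_iff[OF A ideal_padic_ideal] r(1) by (simp add: a_minus_def)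
    then show ?thesis using r quot_eq_iff[OF A ideal_padic_ideal] by metis
  qed
  then show ?thesis by (simp add: r(3) completion_ops)
qed

text \<open>The kernel of the map from the completion to A/p is generated by \<open>p\<close>: the
  representatives r(m+1) are p q(m), and by torsion freeness the q(m) are compatible again.\<close>

lemma completion_divisible:
  assumes s: "s \<in> carrier (padic_completion p A)" and s1: "s 1 = PI 1"
  shows "s \<in> padic_ideal p (padic_completion p A) 1"
proof -
  obtain r where r: "\<And>m. r m \<in> carrier A" "\<And>m. r (Suc m) \<ominus> r m \<in> PI m" "s = (\<lambda>m. PI m +> r m)"
    using s by (metis completion_cosetE)
  have dec: "PI (m + 1) \<subseteq> PI 1" for m
    by (induction m) (use padic_ideal_Suc_subset in auto)
  interpret I1: ideal "PI 1" A by (rule ideal_padic_ideal)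
  have mem: "r (Suc m) \<in> PI 1" for m
  proof (induction m)
    case 0
    then show ?case using s1 quot_eq_zero_iff[OF A ideal_padic_ideal, of "r 1" 1] r by simp
  next
    case (Suc m)
    have "r (Suc (Suc m)) \<ominus> r (Suc m) \<in> PI 1" using r(2)[of "Suc m"] dec[of m] by auto
    then have "(r (Suc (Suc m)) \<ominus> r (Suc m)) \<oplus> r (Suc m) \<in> PI 1" using Suc I1.a_closed by blast
    then show ?case using r(1) by (simp add: a_minus_def a_assoc l_neg)
  qed
  have "\<exists>y. y \<in> carrier A \<and> r (Suc m) = add_pow A p y" for m
    using mem[of m] unfolding padic_ideal_eq power_one_right by blast
  then obtain q where q: "\<And>m. q m \<in> carrier A" "\<And>m. r (Suc m) = add_pow A p (q m)" by metis
  have "q (Suc m) \<ominus> q m \<in> PI m" for m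
  proof -
    have "add_pow A p (q (Suc m) \<ominus> q m) = r (Suc (Suc m)) \<ominus> r (Suc m)"
      using q by (simp add: a_minus_def add.nat_pow_distrib add.nat_pow_inv)
    then show ?thesis using r(2)[of "Suc m"] padic_ideal_cancel q(1) by simp
  qed
  then have Q: "(\<lambda>m. PI m +> q m) \<in> carrier (padic_completion p A)" using q(1) by (intro completion_cosetI)
  \<comment> \<open>The shift by one index is harmless since r(m+1) and r(m) agree modulo
    p^m.\<close>
  have "s = (\<lambda>m. PI m +> r (Suc m))" unfolding r(3) using r quot_eq_iff[OF A ideal_padic_ideal] by metis
  also have "\<dots> = add_pow (padic_completion p A) p (\<lambda>m. PI m +> q m)"
    using completion_add_pow[OF q(1) Q] q(2) by simp
  finally have "s = add_pow (padic_completion p A) (p ^ 1) (\<lambda>m. PI m +> q m)" by simp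
  then show ?thesis unfolding cring.padic_ideal_eq[OF cring_completion] using Q by blast
qed

end

end

lemma hom_padic_ideal:
  assumes "cring A" "cring B" "g \<in> ring_hom A B" "x \<in> padic_ideal p A m"
  shows "g x \<in> padic_ideal p B m"
proof -
  obtain y where y: "y \<in> carrier A" "x = add_pow A (p ^ m) y"
    using assms(4) unfolding cring.padic_ideal_eq[OF assms(1)] by blast
  then have "g x = add_pow B (p ^ m) (g y)"
    using hom_add_pow[OF cring.axioms(1)[OF assms(1)] cring.axioms(1)[OF assms(2)] assms(3)] by simp
  then show ?thesis
    unfolding cring.padic_ideal_eq[OF assms(2)] using ring_hom_closed[OF assms(3)] y(1) by blast
qed

context
  fixes p :: nat and A :: "('a, 'm) ring_scheme" and B :: "('b, 'n) ring_scheme" and g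
  assumes A: "cring A" and B: "cring B" and g: "g \<in> ring_hom A B"
begin

lemma completion_map_coset:
  assumes "\<And>m. r m \<in> carrier A"
  shows "completion_map p B g (\<lambda>m. padic_ideal p A m +>\<^bsub>A\<^esub> r m) = (\<lambda>m. padic_ideal p B m +>\<^bsub>B\<^esub> g (r m))"
  unfolding completion_map_def
  using coset_map_coset[OF A B ideal_padic_ideal[OF A] ideal_padic_ideal[OF B] g hom_padic_ideal[OF A B g]] assms
  by simp

lemma completion_map_to_completion:
  "x \<in> carrier A \<Longrightarrow> completion_map p B g (to_completion p A x) = to_completion p B (g x)"
  unfolding to_completion_def by (rule completion_map_coset)

lemma completion_map_hom: "completion_map p B g \<in> ring_hom (padic_completion p A) (padic_completion p B)"
proof (rule ring_hom_memI)
  interpret A: cring A by (rule A)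
  interpret B: cring B by (rule B)
  note gc = ring_hom_closed[OF g]
  fix s t assume "s \<in> carrier (padic_completion p A)"
  then obtain r where r: "\<And>m. r m \<in> carrier A" "\<And>m. r (Suc m) \<ominus>\<^bsub>A\<^esub> r m \<in> padic_ideal p A m"
    "s = (\<lambda>m. padic_ideal p A m +>\<^bsub>A\<^esub> r m)" by (metis completion_cosetE[OF A])
  show "completion_map p B g s \<in> carrier (padic_completion p B)"
    unfolding r(3) completion_map_coset[OF r(1)]
    using r gc hom_padic_ideal[OF A B g] hom_a_minus[OF A.ring_axioms B.ring_axioms g]
    by (intro completion_cosetI[OF B]) (auto, metis)
  assume "t \<in> carrier (padic_completion p A)"
  then obtain r' where r': "\<And>m. r' m \<in> carrier A" "t = (\<lambda>m. padic_ideal p A m +>\<^bsub>A\<^esub> r' m)"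
    by (metis completion_cosetE[OF A])
  show "completion_map p B g (s \<otimes>\<^bsub>padic_completion p A\<^esub> t) = completion_map p B g s \<otimes>\<^bsub>padic_completion p B\<^esub> completion_map p B g t"
    "completion_map p B g (s \<oplus>\<^bsub>padic_completion p A\<^esub> t) = completion_map p B g s \<oplus>\<^bsub>padic_completion p B\<^esub> completion_map p B g t"
    using r(1) r'(1) gc unfolding r(3) r'(2)
    by (simp_all add: completion_coset_ops[OF A] completion_coset_ops[OF B] completion_map_coset ring_hom_mult[OF g] ring_hom_add[OF g])
next
  interpret A: cring A by (rule A)
  show "completion_map p B g \<one>\<^bsub>padic_completion p A\<^esub> = \<one>\<^bsub>padic_completion p B\<^esub>"
    by (simp add: completion_ops[OF A] completion_ops[OF B] completion_map_coset ring_hom_one[OF g])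
qed

end

section \<open>Direct limits\<close>

locale direct_system =
  fixes A :: "nat \<Rightarrow> ('a, 'm) ring_scheme" and t :: "nat \<Rightarrow> 'a \<Rightarrow> 'a"
  assumes cring_A: "cring (A n)" and t_hom: "t n \<in> ring_hom (A n) (A (Suc n))"
begin

text \<open>Indexed by the target level instead of the number of steps, so that composites obey
  \<open>lift_trans\<close>.\<close>

definition lift :: "nat \<Rightarrow> nat \<Rightarrow> 'a \<Rightarrow> 'a" where "lift n k x = dl_shift t n (k - n) x"

lemma lift_refl [simp]: "lift n n x = x"
  by (simp add: lift_def)

lemma lift_Suc: "n \<le> k \<Longrightarrow> lift n (Suc k) x = t k (lift n k x)"
  by (simp add: lift_def Suc_diff_le)

lemma lift_trans: "m \<le> k \<Longrightarrow> n \<le> m \<Longrightarrow> lift m k (lift n m x) = lift n k x"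
  by (induction k rule: nat_induct_at_least) (simp_all add: lift_Suc)

lemma lift_hom: "n \<le> k \<Longrightarrow> lift n k \<in> ring_hom (A n) (A k)"
proof (induction k rule: nat_induct_at_least)
  case base
  show ?case by (simp add: ring_hom_def)
next
  case (Suc k)
  have "lift n (Suc k) = t k \<circ> lift n k" using Suc.hyps by (auto simp: lift_Suc)
  then show ?case using ring_hom_trans[OF Suc.IH t_hom] by metis
qed

lemma lift_closed: "n \<le> k \<Longrightarrow> x \<in> carrier (A n) \<Longrightarrow> lift n k x \<in> carrier (A k)"
  using ring_hom_closed[OF lift_hom] .

lemma dl_class_iff:
  "(m, y) \<in> dl_class A t n x \<longleftrightarrow> y \<in> carrier (A m) \<and> (\<exists>k\<ge>max n m. lift n k x = lift m k y)"
proof -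
  have "(\<exists>d e. n + d = m + e \<and> dl_shift t n d x = dl_shift t m e y) \<longleftrightarrow>
      (\<exists>k\<ge>max n m. lift n k x = lift m k y)" (is "?l \<longleftrightarrow> ?r")
  proof
    assume ?l
    then obtain d e where de: "n + d = m + e" "dl_shift t n d x = dl_shift t m e y" by blast
    then have "n + d - n = d" "n + d - m = e" by auto
    then have "lift n (n + d) x = lift m (n + d) y" using de(2) by (simp only: lift_def)
    moreover have "n + d \<ge> max n m" using de(1) by simp
    ultimately show ?r by blast
  next
    assume ?r
    then obtain k where "k \<ge> max n m" "lift n k x = lift m k y" by blast
    then have "n + (k - n) = m + (k - m)" "dl_shift t n (k - n) x = dl_shift t m (k - m) y"
      by (simp_all add: lift_def)
    then show ?l by blast
  qed
  then show ?thesis by (simp add: dl_class_def)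
qed

lemma lift_eq_mono:
  assumes "lift n k x = lift m k y" "max n m \<le> k" "k \<le> l" shows "lift n l x = lift m l y"
  using assms lift_trans[of k l n x] lift_trans[of k l m y] by simp

lemma dl_class_eq_iff:
  assumes x: "x \<in> carrier (A n)" and y: "y \<in> carrier (A m)"
  shows "dl_class A t n x = dl_class A t m y \<longleftrightarrow> (\<exists>k\<ge>max n m. lift n k x = lift m k y)" (is "?l \<longleftrightarrow> ?r")
proof
  have "(m, y) \<in> dl_class A t m y" using y by (auto simp: dl_class_iff)
  then show "?l \<Longrightarrow> ?r" by (metis dl_class_iff)
next
  have sub: "dl_class A t m y \<subseteq> dl_class A t n x"
    if k: "k \<ge> max n m" "lift n k x = lift m k y" for k n m x y
  proof
    fix z assume "z \<in> dl_class A t m y"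
    then obtain q w l where z: "z = (q, w)" "w \<in> carrier (A q)" "l \<ge> max m q" "lift m l y = lift q l w"
      by (cases z) (auto simp: dl_class_iff)
    have "lift n (max k l) x = lift m (max k l) y" using k by (intro lift_eq_mono[OF k(2)]) auto
    also have "\<dots> = lift q (max k l) w" using z by (intro lift_eq_mono[OF z(4)]) auto
    finally have "lift n (max k l) x = lift q (max k l) w" .
    moreover have "max k l \<ge> max n q" using k z by auto
    ultimately show "z \<in> dl_class A t n x" using z by (auto simp: dl_class_iff)
  qed
  assume ?r
  then obtain k where k: "k \<ge> max n m" "lift n k x = lift m k y" by blast
  then show ?l using sub[of n m k x y] sub[of m n k y x] by (auto simp: max.commute)
qed

lemma dl_class_lift: "n \<le> k \<Longrightarrow> x \<in> carrier (A n) \<Longrightarrow> dl_class A t k (lift n k x) = dl_class A t n x"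
  using lift_closed by (subst dl_class_eq_iff) (auto intro!: exI[of _ k])

text \<open>F stands for addition or multiplication in all the rings \<open>A n\<close> at once. The
  union in \<open>direct_limit\<close> runs over all pairs of representatives; lifted to a common
  level M, they all give the same class.\<close>

lemma dl_union_op:
  assumes closed: "\<And>n x y. x \<in> carrier (A n) \<Longrightarrow> y \<in> carrier (A n) \<Longrightarrow> F n x y \<in> carrier (A n)"
    and lift_F: "\<And>n k x y. n \<le> k \<Longrightarrow> x \<in> carrier (A n) \<Longrightarrow> y \<in> carrier (A n) \<Longrightarrow>
      lift n k (F n x y) = F k (lift n k x) (lift n k y)"
    and u: "u \<in> carrier (A N)" and v: "v \<in> carrier (A N)"
  shows "(\<Union>(n, x)\<in>dl_class A t N u. \<Union>(m, y)\<in>dl_class A t N v.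
      dl_class A t (n + m) (F (n + m) (dl_shift t n m x) (dl_shift t m n y))) = dl_class A t N (F N u v)"
proof -
  have "dl_class A t (n + m) (F (n + m) (dl_shift t n m x) (dl_shift t m n y)) = dl_class A t N (F N u v)"
    if "(n, x) \<in> dl_class A t N u" "(m, y) \<in> dl_class A t N v" for n x m y
  proof -
    from that obtain k l where k: "x \<in> carrier (A n)" "k \<ge> max N n" "lift N k u = lift n k x"
      and l: "y \<in> carrier (A m)" "l \<ge> max N m" "lift N l v = lift m l y" by (auto simp: dl_class_iff)
    define M where "M = max (n + m) (max k l)"
    have sh: "dl_shift t n m x = lift n (n + m) x" "dl_shift t m n y = lift m (n + m) y"
      by (simp_all add: lift_def)
    have M: "n + m \<le> M" "N \<le> M" "n \<le> M" "m \<le> M" using k l by (auto simp: M_def)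
    have c: "lift n (n + m) x \<in> carrier (A (n + m))" "lift m (n + m) y \<in> carrier (A (n + m))"
      using k l by (auto intro: lift_closed)
    have "lift N M u = lift n M x" using k by (intro lift_eq_mono[OF k(3)]) (auto simp: M_def)
    moreover have "lift N M v = lift m M y" using l by (intro lift_eq_mono[OF l(3)]) (auto simp: M_def)
    ultimately have "lift (n + m) M (F (n + m) (lift n (n + m) x) (lift m (n + m) y)) = lift N M (F N u v)"
      using M c u v by (simp add: lift_F lift_trans)
    then show ?thesis unfolding sh using M c u v closed
      by (subst dl_class_eq_iff) (auto intro!: exI[of _ M])
  qed
  moreover have "(N, u) \<in> dl_class A t N u" "(N, v) \<in> dl_class A t N v"
    using u v by (auto simp: dl_class_iff)
  ultimately show ?thesis by fast
qed

abbreviation "L \<equiv> direct_limit A t"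

lemma L_carrier: "carrier L = {dl_class A t n x | n x. x \<in> carrier (A n)}"
  by (simp add: direct_limit_def)

lemma L_ops:
  assumes "u \<in> carrier (A N)" "v \<in> carrier (A N)"
  shows "dl_class A t N u \<otimes>\<^bsub>L\<^esub> dl_class A t N v = dl_class A t N (u \<otimes>\<^bsub>A N\<^esub> v)"
    and "dl_class A t N u \<oplus>\<^bsub>L\<^esub> dl_class A t N v = dl_class A t N (u \<oplus>\<^bsub>A N\<^esub> v)"
proof -
  have R: "ring (A n)" for n using cring_A cring.axioms(1) by blast
  show "dl_class A t N u \<otimes>\<^bsub>L\<^esub> dl_class A t N v = dl_class A t N (u \<otimes>\<^bsub>A N\<^esub> v)"
    using assms unfolding direct_limit_def
    by (simp, intro dl_union_op) (auto intro: ring.ring_simprules(5)[OF R] ring_hom_mult[OF lift_hom])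
  show "dl_class A t N u \<oplus>\<^bsub>L\<^esub> dl_class A t N v = dl_class A t N (u \<oplus>\<^bsub>A N\<^esub> v)"
    using assms unfolding direct_limit_def
    by (simp, intro dl_union_op) (auto intro: ring.ring_simprules(1)[OF R] ring_hom_add[OF lift_hom])
qed

lemma L_one_zero: "\<one>\<^bsub>L\<^esub> = dl_class A t N \<one>\<^bsub>A N\<^esub>" "\<zero>\<^bsub>L\<^esub> = dl_class A t N \<zero>\<^bsub>A N\<^esub>"
proof -
  interpret A0: cring "A 0" by (rule cring_A)
  have R: "ring (A n)" for n using cring_A cring.axioms(1) by blast
  show "\<one>\<^bsub>L\<^esub> = dl_class A t N \<one>\<^bsub>A N\<^esub>" "\<zero>\<^bsub>L\<^esub> = dl_class A t N \<zero>\<^bsub>A N\<^esub>"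
    using dl_class_lift[of 0 N "\<one>\<^bsub>A 0\<^esub>"] dl_class_lift[of 0 N "\<zero>\<^bsub>A 0\<^esub>"]
      ring_hom_one[OF lift_hom, of 0 N] ring_hom_zero[OF lift_hom R R, of 0 N]
    by (simp_all add: direct_limit_def)
qed

lemma dl_class_hom: "dl_class A t N \<in> ring_hom (A N) L"
  by (rule ring_hom_memI) (auto simp: L_carrier L_ops L_one_zero(1)[of N])

text \<open>Ring axioms involve at most three elements; moved to one level N, they follow from the
  axioms of \<open>A N\<close>.\<close>

lemma common_level:
  assumes "C \<in> carrier L" "D \<in> carrier L" "E \<in> carrier L"
  obtains N u v w where "u \<in> carrier (A N)" "v \<in> carrier (A N)" "w \<in> carrier (A N)"
    "C = dl_class A t N u" "D = dl_class A t N v" "E = dl_class A t N w"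
proof -
  obtain a x b y c z where xyz: "x \<in> carrier (A a)" "C = dl_class A t a x"
    "y \<in> carrier (A b)" "D = dl_class A t b y" "z \<in> carrier (A c)" "E = dl_class A t c z"
    using assms by (auto simp: L_carrier)
  define N where "N = max a (max b c)"
  have le: "a \<le> N" "b \<le> N" "c \<le> N" by (auto simp: N_def)
  show ?thesis
    by (rule that[of "lift a N x" N "lift b N y" "lift c N z"])
      (use xyz le lift_closed dl_class_lift in auto)
qed

lemma cring_L: "cring L"
proof (rule cringI)
  have R: "cring (A n)" for n by (rule cring_A)
  note ax = cring.cring_simprules[OF R]
  have closed: "C \<otimes>\<^bsub>L\<^esub> D \<in> carrier L" "C \<oplus>\<^bsub>L\<^esub> D \<in> carrier L"
    and assoc: "(C \<oplus>\<^bsub>L\<^esub> D) \<oplus>\<^bsub>L\<^esub> E = C \<oplus>\<^bsub>L\<^esub> (D \<oplus>\<^bsub>L\<^esub> E)" "(C \<otimes>\<^bsub>L\<^esub> D) \<otimes>\<^bsub>L\<^esub> E = C \<otimes>\<^bsub>L\<^esub> (D \<otimes>\<^bsub>L\<^esub> E)"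
    and comm: "C \<oplus>\<^bsub>L\<^esub> D = D \<oplus>\<^bsub>L\<^esub> C" "C \<otimes>\<^bsub>L\<^esub> D = D \<otimes>\<^bsub>L\<^esub> C"
    and neut: "\<zero>\<^bsub>L\<^esub> \<oplus>\<^bsub>L\<^esub> C = C" "\<one>\<^bsub>L\<^esub> \<otimes>\<^bsub>L\<^esub> C = C"
    and neg: "\<exists>y\<in>carrier L. y \<oplus>\<^bsub>L\<^esub> C = \<zero>\<^bsub>L\<^esub>"
    and distr: "(C \<oplus>\<^bsub>L\<^esub> D) \<otimes>\<^bsub>L\<^esub> E = C \<otimes>\<^bsub>L\<^esub> E \<oplus>\<^bsub>L\<^esub> D \<otimes>\<^bsub>L\<^esub> E"
    if cde: "C \<in> carrier L" "D \<in> carrier L" "E \<in> carrier L" for C D E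
  proof -
    obtain N u v w where *: "u \<in> carrier (A N)" "v \<in> carrier (A N)" "w \<in> carrier (A N)"
      "C = dl_class A t N u" "D = dl_class A t N v" "E = dl_class A t N w"
      by (rule common_level[OF cde]) (rule that)
    have car: "dl_class A t N x \<in> carrier L" if "x \<in> carrier (A N)" for x using that by (auto simp: L_carrier)
    note N = L_one_zero[of N]
    show "C \<otimes>\<^bsub>L\<^esub> D \<in> carrier L" "C \<oplus>\<^bsub>L\<^esub> D \<in> carrier L"
      using * ax(1,5) by (simp_all add: L_ops car)
    show "(C \<oplus>\<^bsub>L\<^esub> D) \<oplus>\<^bsub>L\<^esub> E = C \<oplus>\<^bsub>L\<^esub> (D \<oplus>\<^bsub>L\<^esub> E)" "(C \<otimes>\<^bsub>L\<^esub> D) \<otimes>\<^bsub>L\<^esub> E = C \<otimes>\<^bsub>L\<^esub> (D \<otimes>\<^bsub>L\<^esub> E)"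
      "(C \<oplus>\<^bsub>L\<^esub> D) \<otimes>\<^bsub>L\<^esub> E = C \<otimes>\<^bsub>L\<^esub> E \<oplus>\<^bsub>L\<^esub> D \<otimes>\<^bsub>L\<^esub> E"
      using * by (simp_all add: L_ops ax(1,5,7,11,13))
    show "C \<oplus>\<^bsub>L\<^esub> D = D \<oplus>\<^bsub>L\<^esub> C" "C \<otimes>\<^bsub>L\<^esub> D = D \<otimes>\<^bsub>L\<^esub> C"
      using * by (simp_all add: L_ops ax(10)[of u N v] ax(14)[of u N v])
    show "\<zero>\<^bsub>L\<^esub> \<oplus>\<^bsub>L\<^esub> C = C" "\<one>\<^bsub>L\<^esub> \<otimes>\<^bsub>L\<^esub> C = C"
      using * unfolding N by (simp_all add: L_ops ax(2,6,8,12))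
    have "dl_class A t N (\<ominus>\<^bsub>A N\<^esub> u) \<oplus>\<^bsub>L\<^esub> C = \<zero>\<^bsub>L\<^esub>"
      using * unfolding N by (simp add: L_ops ax(3,9))
    then show "\<exists>y\<in>carrier L. y \<oplus>\<^bsub>L\<^esub> C = \<zero>\<^bsub>L\<^esub>" using car ax(3) *(1) by blast
  qed
  have z: "\<zero>\<^bsub>L\<^esub> \<in> carrier L" "\<one>\<^bsub>L\<^esub> \<in> carrier L"
    using ax(2,6) by (auto simp: L_carrier L_one_zero[of 0])
  show "abelian_group L"
    by (rule abelian_groupI) (simp_all add: closed assoc neut neg z, use comm(1) z in blast)
  show "comm_monoid L"
    by (rule comm_monoidI) (simp_all add: closed assoc neut z, use comm(2) z in blast)
  show "(x \<oplus>\<^bsub>L\<^esub> y) \<otimes>\<^bsub>L\<^esub> w = x \<otimes>\<^bsub>L\<^esub> w \<oplus>\<^bsub>L\<^esub> y \<otimes>\<^bsub>L\<^esub> w"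
    if "x \<in> carrier L" "y \<in> carrier L" "w \<in> carrier L" for x y w using distr that by blast
qed

text \<open>An equation in the limit already holds at some finite level, and divisibility by p^m is
  such an equation.\<close>

lemma dl_class_in_padic_ideal_iff:
  assumes x: "x \<in> carrier (A n)"
  shows "dl_class A t n x \<in> padic_ideal p L m \<longleftrightarrow> (\<exists>k\<ge>n. lift n k x \<in> padic_ideal p (A k) m)"
proof
  have R: "ring (A n)" "ring L" for n using cring_A cring_L cring.axioms(1) by blast+
  assume "dl_class A t n x \<in> padic_ideal p L m"
  then obtain Y where Y: "Y \<in> carrier L" "dl_class A t n x = add_pow L (p ^ m) Y"
    by (auto simp: cring.padic_ideal_eq[OF cring_L])
  then obtain l y where y: "y \<in> carrier (A l)" "Y = dl_class A t l y" by (auto simp: L_carrier)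
  have c: "add_pow (A l) (p ^ m) y \<in> carrier (A l)"
  proof -
    interpret cring "A l" by (rule cring_A)
    show ?thesis using y by simp
  qed
  have "dl_class A t n x = dl_class A t l (add_pow (A l) (p ^ m) y)"
    using Y(2) y hom_add_pow[OF R(1,2) dl_class_hom] by simp
  then obtain k where k: "k \<ge> max n l" "lift n k x = lift l k (add_pow (A l) (p ^ m) y)"
    using dl_class_eq_iff[OF x c] by blast
  then have "lift n k x = add_pow (A k) (p ^ m) (lift l k y)"
    using hom_add_pow[OF R(1,1) lift_hom] y(1) by simp
  then have "lift n k x \<in> padic_ideal p (A k) m"
    using lift_closed[of l k y] k y by (auto simp: cring.padic_ideal_eq[OF cring_A])
  then show "\<exists>k\<ge>n. lift n k x \<in> padic_ideal p (A k) m" using k by auto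
next
  assume "\<exists>k\<ge>n. lift n k x \<in> padic_ideal p (A k) m"
  then obtain k where k: "k \<ge> n" "lift n k x \<in> padic_ideal p (A k) m" by blast
  then have "dl_class A t k (lift n k x) \<in> padic_ideal p L m"
    using hom_padic_ideal[OF cring_A cring_L dl_class_hom] by blast
  then show "dl_class A t n x \<in> padic_ideal p L m" using dl_class_lift[OF k(1) x] by simp
qed

end

section \<open>Jet rings modulo \<open>p\<close>\<close>

lemma ring_hom_ring_of_cring: "cring A \<Longrightarrow> cring B \<Longrightarrow> h \<in> ring_hom A B \<Longrightarrow> ring_hom_ring A B h"
  by (rule ring_hom_ringI2) (auto intro: cring.axioms(1))

lemma hom_image_genideal:
  assumes "cring A" "cring B" "h \<in> ring_hom A B" "ideal J B" "G \<subseteq> carrier A" "\<And>x. x \<in> G \<Longrightarrow> h x \<in> J"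
    and "x \<in> Idl\<^bsub>A\<^esub> G"
  shows "h x \<in> J"
proof -
  interpret ring_hom_ring A B h by (rule ring_hom_ring_of_cring[OF assms(1-3)])
  have "Idl\<^bsub>A\<^esub> G \<subseteq> {r \<in> carrier A. h r \<in> J}"
    using assms(5,6) by (intro R.genideal_minimal ideal_vimage assms(4)) auto
  then show ?thesis using assms(7) by blast
qed

lemma rcos_hom: "ideal J A \<Longrightarrow> (\<lambda>x. J +>\<^bsub>A\<^esub> x) \<in> ring_hom A (A Quot J)"
  by (rule ideal.rcos_ring_hom)

lemma dpoly_ring_inclusion: "n \<le> m \<Longrightarrow> id \<in> ring_hom (dpoly_ring n) (dpoly_ring m)"
  by (rule ring_hom_memI) (simp_all add: dp_mono[THEN subsetD])

text \<open>The two conditions place \<open>(\<delta> ^^ i) f\<close> in \<open>dp i\<close>, as the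
  generators of the jet ideals require.\<close>

locale jet_system = delta_ring p \<delta> for p and \<delta> :: "'r::comm_ring_1 dpoly \<Rightarrow> 'r dpoly" +
  fixes f :: "'r dpoly"
  assumes delta_dp: "Q \<in> dp n \<Longrightarrow> \<delta> Q \<in> dp (Suc n)" and f_dp: "f \<in> dp 0"
begin

abbreviation "Cn n \<equiv> padic_completion p (dpoly_ring n :: 'r dpoly ring)"
abbreviation "Jn n \<equiv> jet_ideal p \<delta> f n"
abbreviation "JR n \<equiv> jet_ring p \<delta> f n"
abbreviation "gens n \<equiv> (\<lambda>i. (\<delta> ^^ i) f) ` {..n}"

lemma gens_dp: "gens n \<subseteq> dp n"
proof -
  have "(\<delta> ^^ i) f \<in> dp i" for i by (induction i) (simp_all add: f_dp delta_dp)
  then show ?thesis using dp_mono by blast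
qed

lemma cring_Cn: "cring (Cn n)"
  by (rule cring_completion[OF cring_dpoly_ring])

lemma gens_Cn: "to_completion p (dpoly_ring n) ` gens n \<subseteq> carrier (Cn n)"
  using gens_dp ring_hom_closed[OF to_completion_hom[OF cring_dpoly_ring]] by blast

lemma Jn_eq: "Jn n = Idl\<^bsub>Cn n\<^esub> (to_completion p (dpoly_ring n) ` gens n)"
  by (simp add: jet_ideal_def image_image)

lemma ideal_Jn: "ideal (Jn n) (Cn n)"
  unfolding Jn_eq by (rule ring.genideal_ideal[OF cring.axioms(1)[OF cring_Cn] gens_Cn])

lemma cring_JR: "cring (JR n)"
  unfolding jet_ring_def by (rule cring_quot[OF cring_Cn ideal_Jn])

definition jr :: "nat \<Rightarrow> 'r dpoly \<Rightarrow> (nat \<Rightarrow> 'r dpoly set) set" where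
  "jr n Q = Jn n +>\<^bsub>Cn n\<^esub> to_completion p (dpoly_ring n) Q"

lemma jr_hom: "jr n \<in> ring_hom (dpoly_ring n) (JR n)"
proof -
  have "jr n = (\<lambda>s. Jn n +>\<^bsub>Cn n\<^esub> s) \<circ> to_completion p (dpoly_ring n)" by (auto simp: jr_def)
  then show ?thesis unfolding jet_ring_def
    using ring_hom_trans[OF to_completion_hom[OF cring_dpoly_ring] rcos_hom[OF ideal_Jn]] by metis
qed

definition Kn :: "nat \<Rightarrow> 'r dpoly set" where "Kn n = Idl\<^bsub>dpoly_ring n\<^esub> (insert P (gens n))"

lemma Kn_gens: "insert P (gens n) \<subseteq> dp n"
  using gens_dp by auto

lemma ideal_Kn: "ideal (Kn n) (dpoly_ring n)"
  unfolding Kn_def by (rule ring.genideal_ideal[OF cring.axioms(1)[OF cring_dpoly_ring] Kn_gens])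

lemma Kn_iff: "Q \<in> dp n \<Longrightarrow> Q \<in> Kn n \<longleftrightarrow> Q \<in> jet_span f n"
  unfolding Kn_def jet_span_def by (rule Idl_dpoly_ring[OF Kn_gens])

lemma P_mult_Kn: "Q \<in> dp n \<Longrightarrow> P * Q \<in> Kn n"
  using Kn_iff[of "P * Q" n] by (simp add: dp_mult jet_span_def idl_mult_right idl.span_base)

text \<open>
  Reading off the component modulo \<open>p\<close> maps the completion to the polynomials modulo \<open>Kn\<close>; this bounds
  the kernel of the reduction of the jet ring from above.
\<close>

definition eps :: "nat \<Rightarrow> (nat \<Rightarrow> 'r dpoly set) \<Rightarrow> 'r dpoly set" where
  "eps n s = coset_map (dpoly_ring n) (Kn n) id (s 1)"

lemma eps_coset:
  assumes "s 1 = padic_ideal p (dpoly_ring n) 1 +>\<^bsub>dpoly_ring n\<^esub> Q" "Q \<in> dp n"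
  shows "eps n s = Kn n +>\<^bsub>dpoly_ring n\<^esub> Q"
proof -
  have "id x \<in> Kn n" if "x \<in> padic_ideal p (dpoly_ring n) 1" for x
    using that P_mult_Kn by (auto simp: cring.padic_ideal_eq[OF cring_dpoly_ring] dpoly_ring_add_pow)
  then show ?thesis unfolding eps_def assms(1)
    using coset_map_coset[OF cring_dpoly_ring cring_dpoly_ring ideal_padic_ideal[OF cring_dpoly_ring] ideal_Kn
        dpoly_ring_inclusion[OF order_refl] _ assms(2)] by simp
qed

lemma eps_hom: "eps n \<in> ring_hom (Cn n) (dpoly_ring n Quot Kn n)"
proof (rule ring_hom_memI)
  let ?D = "dpoly_ring n :: 'r dpoly ring" and ?PI = "padic_ideal p (dpoly_ring n)"
  note D = cring_dpoly_ring[where 'r = 'r and n = n]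
  interpret D: cring ?D by (rule D)
  fix s t assume "s \<in> carrier (Cn n)"
  then obtain r where r: "\<And>m. r m \<in> dp n" "s = (\<lambda>m. ?PI m +>\<^bsub>?D\<^esub> r m)"
    by (metis completion_cosetE[OF D])
  show "eps n s \<in> carrier (?D Quot Kn n)"
    using eps_coset[of s n "r 1"] r by (auto simp: quot_carrier[OF D ideal_Kn])
  assume "t \<in> carrier (Cn n)"
  then obtain r' where r': "\<And>m. r' m \<in> dp n" "t = (\<lambda>m. ?PI m +>\<^bsub>?D\<^esub> r' m)"
    by (metis completion_cosetE[OF D])
  have st: "eps n s = Kn n +>\<^bsub>?D\<^esub> r 1" "eps n t = Kn n +>\<^bsub>?D\<^esub> r' 1"
    using eps_coset[of s n "r 1"] eps_coset[of t n "r' 1"] r r' by simp_all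
  have "eps n (s \<otimes>\<^bsub>Cn n\<^esub> t) = Kn n +>\<^bsub>?D\<^esub> (r 1 \<otimes>\<^bsub>?D\<^esub> r' 1)"
    unfolding r(2) r'(2) completion_coset_ops[OF D r(1) r'(1)] using r(1) r'(1) by (intro eps_coset) (auto simp: dp_mult)
  then show "eps n (s \<otimes>\<^bsub>Cn n\<^esub> t) = eps n s \<otimes>\<^bsub>?D Quot Kn n\<^esub> eps n t"
    unfolding st using quot_ops(1)[OF D ideal_Kn r(1) r'(1)] by simp
  have "eps n (s \<oplus>\<^bsub>Cn n\<^esub> t) = Kn n +>\<^bsub>?D\<^esub> (r 1 \<oplus>\<^bsub>?D\<^esub> r' 1)"
    unfolding r(2) r'(2) completion_coset_ops[OF D r(1) r'(1)] using r(1) r'(1) by (intro eps_coset) (auto simp: dp_add)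
  then show "eps n (s \<oplus>\<^bsub>Cn n\<^esub> t) = eps n s \<oplus>\<^bsub>?D Quot Kn n\<^esub> eps n t"
    unfolding st using quot_ops(2)[OF D ideal_Kn r(1) r'(1)] by simp
next
  note D = cring_dpoly_ring[where 'r = 'r and n = n]
  show "eps n \<one>\<^bsub>Cn n\<^esub> = \<one>\<^bsub>dpoly_ring n Quot Kn n\<^esub>"
    unfolding quot_one_zero(1)[OF D ideal_Kn] by (rule eps_coset) (simp_all add: completion_ops[OF D])
qed

lemma eps_to_completion: "Q \<in> dp n \<Longrightarrow> eps n (to_completion p (dpoly_ring n) Q) = Kn n +>\<^bsub>dpoly_ring n\<^esub> Q"
  by (rule eps_coset) (simp_all add: to_completion_def)

lemma eps_Jn: "s \<in> Jn n \<Longrightarrow> eps n s = Kn n"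
proof -
  note D = cring_dpoly_ring[where 'r = 'r and n = n]
  let ?Q = "dpoly_ring n Quot Kn n"
  have Q: "cring ?Q" by (rule cring_quot[OF D ideal_Kn])
  have "ideal {\<zero>\<^bsub>?Q\<^esub>} ?Q" by (rule ring.zeroideal[OF cring.axioms(1)[OF Q]])
  moreover have "eps n x \<in> {\<zero>\<^bsub>?Q\<^esub>}" if x: "x \<in> to_completion p (dpoly_ring n) ` gens n" for x
  proof -
    obtain g where g: "g \<in> gens n" "x = to_completion p (dpoly_ring n) g" using x by blast
    then have "g \<in> dp n" "g \<in> Kn n"
      using gens_dp ring.genideal_self[OF cring.axioms(1)[OF D] Kn_gens] unfolding Kn_def by blast+
    then show ?thesis unfolding g(2)
      by (simp add: eps_to_completion quot_one_zero(3)[OF D ideal_Kn] quot_eq_zero_iff[OF D ideal_Kn])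
  qed
  moreover assume "s \<in> Jn n"
  ultimately have "eps n s \<in> {\<zero>\<^bsub>?Q\<^esub>}"
    unfolding Jn_eq by (rule hom_image_genideal[OF cring_Cn Q eps_hom _ gens_Cn])
  then show ?thesis by (simp add: quot_one_zero(3)[OF D ideal_Kn])
qed

text \<open>\<open>p\<close> and the derivatives of f become divisible by \<open>p\<close> in the
  jet ring. That nothing more does follows from \<open>eps\<close>, which kills the jet ideal and
  all multiples of \<open>p\<close>.\<close>

lemma jr_in_padic_ideal_iff:
  assumes Q: "Q \<in> dp n"
  shows "jr n Q \<in> padic_ideal p (JR n) 1 \<longleftrightarrow> Q \<in> jet_span f n"
proof
  note D = cring_dpoly_ring[where 'r = 'r and n = n]
  interpret C: cring "Cn n" by (rule cring_Cn)
  interpret D: cring "dpoly_ring n :: 'r dpoly ring" by (rule D)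
  note tc = to_completion_hom[OF D, of p]
  have R: "ring (Cn n)" "ring (JR n)" using cring_Cn cring_JR cring.axioms(1) by blast+
  {
    assume "jr n Q \<in> padic_ideal p (JR n) 1"
    then obtain Y where Y: "Y \<in> carrier (JR n)" "jr n Q = add_pow (JR n) p Y"
      by (auto simp: cring.padic_ideal_eq[OF cring_JR])
    then obtain s where s: "s \<in> carrier (Cn n)" "Y = Jn n +>\<^bsub>Cn n\<^esub> s"
      by (auto simp: jet_ring_def quot_carrier[OF cring_Cn ideal_Jn])
    have "(\<lambda>x. Jn n +>\<^bsub>Cn n\<^esub> x) \<in> ring_hom (Cn n) (JR n)" unfolding jet_ring_def by (rule rcos_hom[OF ideal_Jn])
    then have "jr n Q = Jn n +>\<^bsub>Cn n\<^esub> add_pow (Cn n) p s"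
      using hom_add_pow[OF R _ s(1)] Y(2) s(2) by metis
    then have "to_completion p (dpoly_ring n) Q \<ominus>\<^bsub>Cn n\<^esub> add_pow (Cn n) p s \<in> Jn n"
      unfolding jr_def using quot_eq_iff[OF cring_Cn ideal_Jn] ring_hom_closed[OF tc Q] s(1) by simp
    moreover obtain r where r: "\<And>m. r m \<in> dp n" "s = (\<lambda>m. padic_ideal p (dpoly_ring n) m +>\<^bsub>dpoly_ring n\<^esub> r m)"
      using s(1) by (metis completion_cosetE[OF D])
    have "eps n (add_pow (Cn n) p s) = Kn n +>\<^bsub>dpoly_ring n\<^esub> (P * r 1)"
      using s(1) unfolding r(2)
      by (intro eps_coset) (simp_all add: completion_add_pow[OF D r(1)] dpoly_ring_add_pow dp_mult r(1))
    then have "eps n (add_pow (Cn n) p s) = Kn n"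
      using quot_eq_zero_iff[OF D ideal_Kn] P_mult_Kn r(1) by (simp add: dp_mult)
    moreover have "to_completion p (dpoly_ring n) Q =
        (to_completion p (dpoly_ring n) Q \<ominus>\<^bsub>Cn n\<^esub> add_pow (Cn n) p s) \<oplus>\<^bsub>Cn n\<^esub> add_pow (Cn n) p s"
      using ring_hom_closed[OF tc Q] s(1) by (simp add: C.minus_eq C.a_assoc C.l_neg)
    ultimately have "eps n (to_completion p (dpoly_ring n) Q) = Kn n \<oplus>\<^bsub>dpoly_ring n Quot Kn n\<^esub> Kn n"
      using ring_hom_add[OF eps_hom] eps_Jn ring_hom_closed[OF tc Q] s(1)
      by (metis C.add.nat_pow_closed C.minus_closed)
    also have "\<dots> = Kn n"
      using ring.ring_simprules(8,2)[OF cring.axioms(1)[OF cring_quot[OF D ideal_Kn]]]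
      by (metis quot_one_zero(3)[OF D ideal_Kn])
    finally show "Q \<in> jet_span f n"
      using Q by (simp add: eps_to_completion quot_eq_zero_iff[OF D ideal_Kn] Kn_iff)
  next
    have "jr n x \<in> padic_ideal p (JR n) 1" if x: "x \<in> insert P (gens n)" for x
    proof (cases "x = P")
      case True
      have "jr n P = add_pow (JR n) p (jr n 1)"
        using hom_add_pow[OF D.ring_axioms R(2) jr_hom, of 1 p] by (simp add: dpoly_ring_add_pow)
      then show ?thesis
        using True ring_hom_closed[OF jr_hom, of 1 n] by (auto simp: cring.padic_ideal_eq[OF cring_JR])
    next
      case False
      then have "x \<in> gens n" using x by blast
      then have "to_completion p (dpoly_ring n) x \<in> Jn n"
        unfolding Jn_eq using C.genideal_self[OF gens_Cn] by blast
      then have "jr n x = \<zero>\<^bsub>JR n\<^esub>"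
        unfolding jr_def jet_ring_def quot_one_zero(3)[OF cring_Cn ideal_Jn]
        using quot_eq_zero_iff[OF cring_Cn ideal_Jn] ideal.Icarr[OF ideal_Jn] by blast
      then show ?thesis
        using additive_subgroup.zero_closed[OF ideal.axioms(1)[OF ideal_padic_ideal[OF cring_JR]]] by simp
    qed
    moreover assume "Q \<in> jet_span f n"
    then have "Q \<in> Idl\<^bsub>dpoly_ring n\<^esub> (insert P (gens n))" using Kn_iff[OF Q] Kn_def by blast
    ultimately show "jr n Q \<in> padic_ideal p (JR n) 1"
      by (rule hom_image_genideal[OF D cring_JR jr_hom ideal_padic_ideal[OF cring_JR] Kn_gens])
  }
qed

section \<open>Reductions modulo p as images of polynomial rings\<close>

definition to_bar :: "nat \<Rightarrow> 'r dpoly \<Rightarrow> (nat \<Rightarrow> 'r dpoly set) set set" where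
  "to_bar n Q = padic_ideal p (JR n) 1 +>\<^bsub>JR n\<^esub> jr n Q"

lemma to_bar_hom: "to_bar n \<in> ring_hom (dpoly_ring n) (jet_bar p \<delta> f n)"
proof -
  have "to_bar n = (\<lambda>s. padic_ideal p (JR n) 1 +>\<^bsub>JR n\<^esub> s) \<circ> jr n" by (auto simp: to_bar_def)
  then show ?thesis unfolding jet_bar_def mod_p_def
    using ring_hom_trans[OF jr_hom rcos_hom[OF ideal_padic_ideal[OF cring_JR]]] by metis
qed

lemma to_bar_surj: "to_bar n ` dp n = carrier (jet_bar p \<delta> f n)"
proof
  show "to_bar n ` dp n \<subseteq> carrier (jet_bar p \<delta> f n)" using ring_hom_closed[OF to_bar_hom] by blast
  note D = cring_dpoly_ring[where 'r = 'r and n = n]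
  let ?PJ = "padic_ideal p (JR n) 1" and ?PI = "padic_ideal p (dpoly_ring n)"
  interpret C: cring "Cn n" by (rule cring_Cn)
  have tf: "Q = \<zero>\<^bsub>dpoly_ring n\<^esub>" if "add_pow (dpoly_ring n) p Q = \<zero>\<^bsub>dpoly_ring n\<^esub>" for Q :: "'r dpoly"
    using that torsion_free[of Q] by (simp add: dpoly_ring_add_pow)
  show "carrier (jet_bar p \<delta> f n) \<subseteq> to_bar n ` dp n"
  proof
    fix Z assume "Z \<in> carrier (jet_bar p \<delta> f n)"
    then obtain s where s: "s \<in> carrier (Cn n)" "Z = ?PJ +>\<^bsub>JR n\<^esub> (Jn n +>\<^bsub>Cn n\<^esub> s)"
      unfolding jet_bar_def mod_p_def quot_carrier[OF cring_JR ideal_padic_ideal[OF cring_JR]]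
      by (auto simp: jet_ring_def quot_carrier[OF cring_Cn ideal_Jn])
    obtain r where r: "\<And>m. r m \<in> dp n" "s = (\<lambda>m. ?PI m +>\<^bsub>dpoly_ring n\<^esub> r m)"
      using s(1) by (metis completion_cosetE[OF D])
    \<comment> \<open>A polynomial representing s modulo \<open>p\<close>; the difference has
      trivial component at level 1, so \<open>completion_divisible\<close> makes it a multiple of
      \<open>p\<close>.\<close>
    define Q where "Q = r 1"
    have Q: "Q \<in> dp n" using r by (simp add: Q_def)
    have tQ: "to_completion p (dpoly_ring n) Q \<in> carrier (Cn n)"
      using ring_hom_closed[OF to_completion_hom[OF D] Q] .
    define d where "d = s \<ominus>\<^bsub>Cn n\<^esub> to_completion p (dpoly_ring n) Q"
    have d: "d \<in> carrier (Cn n)" "s = d \<oplus>\<^bsub>Cn n\<^esub> to_completion p (dpoly_ring n) Q"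
      using s(1) tQ by (simp_all add: d_def C.minus_eq C.a_assoc C.l_neg)
    have "d 1 = ?PI 1"
    proof -
      obtain r' where r': "\<And>m. r' m \<in> dp n" "d = (\<lambda>m. ?PI m +>\<^bsub>dpoly_ring n\<^esub> r' m)"
        using d(1) by (metis completion_cosetE[OF D])
      interpret D: cring "dpoly_ring n :: 'r dpoly ring" by (rule D)
      have "s = (\<lambda>m. ?PI m +>\<^bsub>dpoly_ring n\<^esub> (r' m \<oplus>\<^bsub>dpoly_ring n\<^esub> Q))"
        unfolding d(2) r'(2) to_completion_def by (rule completion_coset_ops(2)[OF D r'(1) Q])
      then have "?PI 1 +>\<^bsub>dpoly_ring n\<^esub> (r' 1 \<oplus>\<^bsub>dpoly_ring n\<^esub> Q) = ?PI 1 +>\<^bsub>dpoly_ring n\<^esub> Q"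
        using fun_cong[OF r(2), of 1] unfolding Q_def by metis
      then have "(r' 1 \<oplus>\<^bsub>dpoly_ring n\<^esub> Q) \<ominus>\<^bsub>dpoly_ring n\<^esub> Q \<in> ?PI 1"
        using quot_eq_iff[OF D ideal_padic_ideal[OF D]] r'(1) Q D.a_closed by blast
      then have "r' 1 \<in> ?PI 1" using Q by (simp add: dpoly_ring_a_minus)
      then show ?thesis using quot_eq_zero_iff[OF D ideal_padic_ideal[OF D]] r' by simp
    qed
    then have "d \<in> padic_ideal p (Cn n) 1" using completion_divisible[OF D tf d(1)] by blast
    then have "Jn n +>\<^bsub>Cn n\<^esub> d \<in> ?PJ"
      using hom_padic_ideal[OF cring_Cn cring_JR] rcos_hom[OF ideal_Jn] unfolding jet_ring_def by metis
    moreover have "Jn n +>\<^bsub>Cn n\<^esub> s = (Jn n +>\<^bsub>Cn n\<^esub> d) \<oplus>\<^bsub>JR n\<^esub> jr n Q"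
      unfolding jr_def jet_ring_def using quot_ops(2)[OF cring_Cn ideal_Jn d(1) tQ] d(2) by simp
    ultimately have "Jn n +>\<^bsub>Cn n\<^esub> s \<in> ?PJ +>\<^bsub>JR n\<^esub> jr n Q" by (auto simp: a_r_coset_def')
    then have "Z = to_bar n Q"
    proof -
      interpret J: ideal ?PJ "JR n" by (rule ideal_padic_ideal[OF cring_JR])
      show ?thesis unfolding s(2) to_bar_def
        using \<open>_ \<in> ?PJ +>\<^bsub>JR n\<^esub> jr n Q\<close> J.a_repr_independence' ring_hom_closed[OF jr_hom Q] by metis
    qed
    then show "Z \<in> to_bar n ` dp n" using Q by blast
  qed
qed

lemma to_bar_eq_iff:
  assumes Q: "Q \<in> dp n" "Q' \<in> dp n"
  shows "to_bar n Q = to_bar n Q' \<longleftrightarrow> Q - Q' \<in> jet_span f n"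
proof -
  have R: "ring (dpoly_ring n :: 'r dpoly ring)" "ring (JR n)"
    using cring_dpoly_ring cring_JR cring.axioms(1) by blast+
  have "to_bar n Q = to_bar n Q' \<longleftrightarrow> jr n Q \<ominus>\<^bsub>JR n\<^esub> jr n Q' \<in> padic_ideal p (JR n) 1"
    unfolding to_bar_def using quot_eq_iff[OF cring_JR ideal_padic_ideal[OF cring_JR]] ring_hom_closed[OF jr_hom] Q by blast
  also have "jr n Q \<ominus>\<^bsub>JR n\<^esub> jr n Q' = jr n (Q - Q')"
    using hom_a_minus[OF R jr_hom Q] by (simp add: dpoly_ring_a_minus Q)
  finally show ?thesis using jr_in_padic_ideal_iff dp_diff Q by blast
qed

lemma completion_map_Jn: "s \<in> Jn n \<Longrightarrow> completion_map p (dpoly_ring (Suc n)) id s \<in> Jn (Suc n)"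
proof -
  note D = cring_dpoly_ring[where 'r = 'r]
  have inc: "id \<in> ring_hom (dpoly_ring n :: 'r dpoly ring) (dpoly_ring (Suc n))"
    by (rule dpoly_ring_inclusion) simp
  assume s: "s \<in> Jn n"
  show ?thesis
  proof (rule hom_image_genideal[OF cring_Cn cring_Cn completion_map_hom[OF D D inc] ideal_Jn gens_Cn _ s[unfolded Jn_eq]])
    fix x assume "x \<in> to_completion p (dpoly_ring n) ` gens n"
    then obtain i where i: "i \<le> n" "x = to_completion p (dpoly_ring n) ((\<delta> ^^ i) f)" by auto
    then have "completion_map p (dpoly_ring (Suc n)) id x = to_completion p (dpoly_ring (Suc n)) ((\<delta> ^^ i) f)"
      using completion_map_to_completion[OF D D inc] gens_dp[of n] by auto
    also have "\<dots> \<in> to_completion p (dpoly_ring (Suc n)) ` gens (Suc n)" using i by auto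
    also have "\<dots> \<subseteq> Jn (Suc n)"
      unfolding Jn_eq by (rule ring.genideal_self[OF cring.axioms(1)[OF cring_Cn] gens_Cn])
    finally show "completion_map p (dpoly_ring (Suc n)) id x \<in> Jn (Suc n)" .
  qed
qed

lemma jet_step_hom: "jet_step p \<delta> f n \<in> ring_hom (JR n) (JR (Suc n))"
  unfolding jet_step_def jet_ring_def
  by (rule coset_map_hom[OF cring_Cn cring_Cn ideal_Jn ideal_Jn
        completion_map_hom[OF cring_dpoly_ring cring_dpoly_ring dpoly_ring_inclusion] completion_map_Jn]) simp_all

lemma jet_step_jr:
  assumes "Q \<in> dp n" shows "jet_step p \<delta> f n (jr n Q) = jr (Suc n) Q"
proof -
  note D = cring_dpoly_ring[where 'r = 'r]
  have inc: "id \<in> ring_hom (dpoly_ring n :: 'r dpoly ring) (dpoly_ring (Suc n))"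
    by (rule dpoly_ring_inclusion) simp
  show ?thesis
    unfolding jet_step_def jr_def
    using coset_map_coset[OF cring_Cn cring_Cn ideal_Jn ideal_Jn completion_map_hom[OF D D inc] completion_map_Jn
        ring_hom_closed[OF to_completion_hom[OF D] assms]]
      completion_map_to_completion[OF D D inc assms] by simp
qed

sublocale ds: direct_system "jet_ring p \<delta> f" "jet_step p \<delta> f"
  by (rule direct_system.intro) (rule cring_JR, rule jet_step_hom)

lemma lift_jr: "n \<le> k \<Longrightarrow> Q \<in> dp n \<Longrightarrow> ds.lift n k (jr n Q) = jr k Q"
proof (induction k rule: nat_induct_at_least)
  case (Suc k)
  then have "Q \<in> dp k" using dp_mono by blast
  then show ?case using Suc by (simp add: ds.lift_Suc jet_step_jr)
qed simp

definition to_tilde :: "nat \<Rightarrow> 'r dpoly \<Rightarrow> (nat \<times> (nat \<Rightarrow> 'r dpoly set) set) set set" where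
  "to_tilde n Q = padic_ideal p (jet_ring_inf p \<delta> f) 1 +>\<^bsub>jet_ring_inf p \<delta> f\<^esub>
     dl_class (jet_ring p \<delta> f) (jet_step p \<delta> f) n (jr n Q)"

lemma cring_inf: "cring (jet_ring_inf p \<delta> f)"
  unfolding jet_ring_inf_def by (rule ds.cring_L)

lemma dl_hom: "dl_class (jet_ring p \<delta> f) (jet_step p \<delta> f) n \<in> ring_hom (JR n) (jet_ring_inf p \<delta> f)"
  unfolding jet_ring_inf_def by (rule ds.dl_class_hom)

lemma to_tilde_surj: "to_tilde n ` dp n = carrier (jet_tilde p \<delta> f n)"
proof -
  have "coset_map (jet_ring_inf p \<delta> f) (padic_ideal p (jet_ring_inf p \<delta> f) 1)
      (dl_class (jet_ring p \<delta> f) (jet_step p \<delta> f) n) (to_bar n Q) = to_tilde n Q" if "Q \<in> dp n" for Q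
    unfolding to_bar_def to_tilde_def
    using coset_map_coset[OF cring_JR cring_inf ideal_padic_ideal[OF cring_JR] ideal_padic_ideal[OF cring_inf]
        dl_hom hom_padic_ideal[OF cring_JR cring_inf dl_hom]] ring_hom_closed[OF jr_hom that] by blast
  then show ?thesis
    by (simp add: jet_tilde_def image_image flip: to_bar_surj)
qed

lemma to_tilde_hom: "to_tilde n \<in> ring_hom (dpoly_ring n) (jet_tilde p \<delta> f n)"
proof -
  let ?I = "padic_ideal p (jet_ring_inf p \<delta> f) 1"
  have "to_tilde n = (\<lambda>s. ?I +>\<^bsub>jet_ring_inf p \<delta> f\<^esub> s) \<circ> (dl_class (jet_ring p \<delta> f) (jet_step p \<delta> f) n \<circ> jr n)"
    by (auto simp: to_tilde_def)
  then have h: "to_tilde n \<in> ring_hom (dpoly_ring n) (mod_p p (jet_ring_inf p \<delta> f))"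
    unfolding mod_p_def
    using ring_hom_trans[OF ring_hom_trans[OF jr_hom dl_hom] rcos_hom[OF ideal_padic_ideal[OF cring_inf]]] by metis
  show ?thesis
  proof (rule ring_hom_memI)
    show "to_tilde n x \<in> carrier (jet_tilde p \<delta> f n)" if "x \<in> dp n" for x
      using that to_tilde_surj by blast
  qed (use ring_hom_mult[OF h] ring_hom_add[OF h] ring_hom_one[OF h] in \<open>simp_all add: jet_tilde_def\<close>)
qed

text \<open>Divisibility by \<open>p\<close> in the direct limit is reached at a finite level k
  \<ge> n, where \<open>jr_in_padic_ideal_iff\<close> applies. The kernel is the union of the ideals
  of these levels cut down to \<open>dp n\<close>.\<close>

lemma to_tilde_eq_iff:
  assumes Q: "Q \<in> dp n" "Q' \<in> dp n"
  shows "to_tilde n Q = to_tilde n Q' \<longleftrightarrow> (\<exists>k\<ge>n. Q - Q' \<in> jet_span f k)"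
proof -
  let ?dl = "dl_class (jet_ring p \<delta> f) (jet_step p \<delta> f) n"
  have R: "ring (dpoly_ring n :: 'r dpoly ring)" "ring (JR n)" "ring (jet_ring_inf p \<delta> f)"
    using cring_dpoly_ring cring_JR cring_inf cring.axioms(1) by blast+
  have c: "jr n Q \<in> carrier (JR n)" "jr n Q' \<in> carrier (JR n)" "jr n (Q - Q') \<in> carrier (JR n)"
    using ring_hom_closed[OF jr_hom] Q dp_diff by blast+
  have "to_tilde n Q = to_tilde n Q' \<longleftrightarrow>
      ?dl (jr n Q) \<ominus>\<^bsub>jet_ring_inf p \<delta> f\<^esub> ?dl (jr n Q') \<in> padic_ideal p (jet_ring_inf p \<delta> f) 1"
    unfolding to_tilde_def
    using quot_eq_iff[OF cring_inf ideal_padic_ideal[OF cring_inf]] ring_hom_closed[OF dl_hom] c by blast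
  also have "?dl (jr n Q) \<ominus>\<^bsub>jet_ring_inf p \<delta> f\<^esub> ?dl (jr n Q') = ?dl (jr n Q \<ominus>\<^bsub>JR n\<^esub> jr n Q')"
    using hom_a_minus[OF R(2,3) dl_hom c(1,2)] by simp
  also have "jr n Q \<ominus>\<^bsub>JR n\<^esub> jr n Q' = jr n (Q - Q')"
    using hom_a_minus[OF R(1,2) jr_hom Q] by (simp add: dpoly_ring_a_minus Q)
  also have "?dl (jr n (Q - Q')) \<in> padic_ideal p (jet_ring_inf p \<delta> f) 1 \<longleftrightarrow>
      (\<exists>k\<ge>n. jr k (Q - Q') \<in> padic_ideal p (JR k) 1)"
    unfolding jet_ring_inf_def ds.dl_class_in_padic_ideal_iff[OF c(3)]
    using lift_jr[OF _ dp_diff[OF Q]] by metis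
  also have "\<dots> \<longleftrightarrow> (\<exists>k\<ge>n. Q - Q' \<in> jet_span f k)"
    using jr_in_padic_ideal_iff dp_diff[OF Q] dp_mono by blast
  finally show ?thesis .
qed

lemma jet_consts:
  "jet_bar_const p \<delta> f n c = to_bar n (dconst c)" "jet_tilde_const p \<delta> f n c = to_tilde n (dconst c)"
  by (simp_all add: jet_bar_const_def jet_tilde_const_def jet_const_def to_bar_def to_tilde_def jr_def)

end

section \<open>The schemes \<open>\<mu>\<close>\<close>

lemma padic_integers_p_neq_zero:
  assumes "Factorial_Ring.prime p"
  shows "add_pow (padic_integers p) p \<one>\<^bsub>padic_integers p\<^esub> \<noteq> \<zero>\<^bsub>padic_integers p\<^esub>"
proof
  have Z: "cring \<Z>" by (rule int_is_cring)
  interpret Z: cring \<Z> by (rule Z)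
  interpret C: cring "padic_integers p" by (rule cring_completion[OF Z])
  have pow: "add_pow \<Z> k y = int k * y" for k :: nat and y
    by (induction k) (simp_all add: algebra_simps)
  have p: "1 < p" using assms prime_gt_1_nat by blast
  have tf: "x = \<zero>\<^bsub>\<Z>\<^esub>" if "add_pow \<Z> p x = \<zero>\<^bsub>\<Z>\<^esub>" for x
    using that p by (simp add: pow)
  assume "add_pow (padic_integers p) p \<one>\<^bsub>padic_integers p\<^esub> = \<zero>\<^bsub>padic_integers p\<^esub>"
  \<comment> \<open>By torsion freeness p 1 = 0 would give 1 = 0, which is refuted in the component
    modulo \<open>p\<close>.\<close>
  then have "\<one>\<^bsub>padic_integers p\<^esub> = \<zero>\<^bsub>padic_integers p\<^esub>"
    using completion_torsion_free[OF Z tf C.one_closed] by blast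
  then have "\<one>\<^bsub>padic_integers p\<^esub> 1 = \<zero>\<^bsub>padic_integers p\<^esub> 1" by simp
  then have "padic_ideal p \<Z> 1 +>\<^bsub>\<Z>\<^esub> 1 = padic_ideal p \<Z> 1 +>\<^bsub>\<Z>\<^esub> 0"
    unfolding completion_ops(3,4)[OF Z] by simp
  then have "1 \<in> padic_ideal p \<Z> 1"
    using quot_eq_zero_iff[OF Z ideal_padic_ideal[OF Z], of 1] quot_one_zero(2,3)[OF Z ideal_padic_ideal[OF Z]] by simp
  then obtain y where "1 = int p * y"
    by (auto simp: cring.padic_ideal_eq[OF Z] pow)
  then have "int p dvd 1" by (rule dvdI)
  then show False using p by simp
qed

text \<open>A is a domain into which the p-adic integers embed, so the image of \<open>p\<close> in
  it is a nonzero element.\<close>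

lemma unramified_torsion_free:
  assumes p: "Factorial_Ring.prime p" and A: "unramified_extension p A \<iota>"
    and x: "x \<in> carrier A" "add_pow A p x = \<zero>\<^bsub>A\<^esub>"
  shows "x = \<zero>\<^bsub>A\<^esub>"
proof -
  interpret A: domain A using A by (simp add: unramified_extension_def)
  interpret C: cring "padic_integers p" by (rule cring_completion[OF int_is_cring])
  have \<iota>: "\<iota> \<in> ring_hom (padic_integers p) A" "inj_on \<iota> (carrier (padic_integers p))"
    using A by (auto simp: unramified_extension_def)
  have "\<iota> (add_pow (padic_integers p) p \<one>\<^bsub>padic_integers p\<^esub>) \<noteq> \<iota> \<zero>\<^bsub>padic_integers p\<^esub>"
    using padic_integers_p_neq_zero[OF p] \<iota>(2) by (metis C.add.nat_pow_closed C.one_closed C.zero_closed inj_onD)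
  then have "add_pow A p \<one>\<^bsub>A\<^esub> \<noteq> \<zero>\<^bsub>A\<^esub>"
    using hom_add_pow[OF C.ring_axioms A.ring_axioms \<iota>(1)] ring_hom_one[OF \<iota>(1)]
      ring_hom_zero[OF \<iota>(1) C.ring_axioms A.ring_axioms] by simp
  moreover have "add_pow A p \<one>\<^bsub>A\<^esub> \<otimes>\<^bsub>A\<^esub> x = \<zero>\<^bsub>A\<^esub>" using x by (simp add: A.add_pow_ldistr)
  ultimately show ?thesis using x(1) A.integral by (metis A.add.nat_pow_closed A.one_closed)
qed

lemma completed_unramified_torsion_free:
  assumes p: "Factorial_Ring.prime p" and A: "unramified_extension p A \<iota>"
    and iso: "(ring_of_type_algebra :: 'r::comm_ring_1 ring) \<simeq> padic_completion p A"
    and x: "of_nat p * x = (0 :: 'r)"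
  shows "x = 0"
proof -
  have cA: "cring A" using A by (auto simp: unramified_extension_def dest: domain.axioms(1))
  interpret C: cring "padic_completion p A" by (rule cring_completion[OF cA])
  interpret T: cring "ring_of_type_algebra :: 'r ring" by (rule cring_from_type_algebra)
  obtain h where h: "h \<in> ring_hom (ring_of_type_algebra :: 'r ring) (padic_completion p A)"
    "bij_betw h UNIV (carrier (padic_completion p A))"
    using iso by (auto simp: is_ring_iso_def ring_iso_def)
  have pow: "add_pow (ring_of_type_algebra :: 'r ring) k y = of_nat k * y" for k :: nat and y
    by (induction k) (simp_all add: algebra_simps)
  have z: "h 0 = \<zero>\<^bsub>padic_completion p A\<^esub>"
    using ring_hom_zero[OF h(1) T.ring_axioms C.ring_axioms] by simp
  have "add_pow (padic_completion p A) p (h x) = h (of_nat p * x)"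
    using hom_add_pow[OF T.ring_axioms C.ring_axioms h(1), of x p] by (simp add: pow)
  then have "add_pow (padic_completion p A) p (h x) = \<zero>\<^bsub>padic_completion p A\<^esub>" using x z by simp
  moreover have "h x \<in> carrier (padic_completion p A)" using h(2) bij_betwE by blast
  ultimately have "h x = \<zero>\<^bsub>padic_completion p A\<^esub>"
    using completion_torsion_free[OF cA unramified_torsion_free[OF p A]] by blast
  then show ?thesis using z h(2) by (metis UNIV_I bij_betw_def inj_onD)
qed

lemma delta_dp_of_prolongation:
  assumes "prolongation p \<delta>\<^sub>0 \<delta>" and Q: "Q \<in> dp n"
  shows "\<delta> Q \<in> dp (Suc n)"
proof -
  have add: "\<delta> (x + y) = \<delta> x + \<delta> y + carry_poly p x y"
    and mult: "\<delta> (x * y) = x ^ p * \<delta> y + y ^ p * \<delta> x + of_nat p * \<delta> x * \<delta> y"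
    and cv: "\<delta> (dconst c) = dconst (\<delta>\<^sub>0 c)" "\<delta> (dvar i) = dvar (Suc i)" for x y c i
    using assms(1) by (auto simp: prolongation_def p_derivation_def)
  have carry: "carry_poly p x y \<in> dp m" if "x \<in> dp m" "y \<in> dp m" for x y :: "'a dpoly" and m
    unfolding carry_poly_def using that by (intro dp_uminus dp_sum dp_mult dp_power) simp_all
  \<comment> \<open>Strengthened by the membership of Q, since the sum and product rules also
    contain the arguments themselves.\<close>
  have "Q \<in> dp (Suc n) \<and> \<delta> Q \<in> dp (Suc n)"
    using Q
    by (induction rule: dpoly_induct) (auto simp: cv add mult intro!: dp_add dp_mult dp_power carry)
  then show ?thesis by blast
qed

lemma char_p_power_diff:
  fixes x y :: "'a::comm_ring_1"
  assumes p: "Factorial_Ring.prime p" and char: "of_nat p = (0 :: 'a)"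
  shows "(x - y) ^ (p ^ k) = x ^ (p ^ k) - y ^ (p ^ k)"
proof (induction k)
  case (Suc k)
  have *: "(u - v) ^ p = u ^ p - v ^ p" for u v :: 'a
    using of_nat_mult_carry_poly[OF p, of "u - v" v] by (simp add: char algebra_simps)
  have "(x - y) ^ (p ^ Suc k) = ((x - y) ^ (p ^ k)) ^ p"
    by (simp only: power_Suc mult.commute[of p] power_mult)
  then show ?case using Suc * by (simp only: power_Suc mult.commute[of p] power_mult)
qed simp

text \<open>The quotient is the image of R[x, ..., x^(n)] under \<tau> followed by the projection,
  and \<theta> identifies the same pairs. Both directions are given so that the rings for a and for
  1 can be joined through this model.\<close>

lemma dpoly_quotient_iso:
  fixes \<tau> :: "'r::comm_ring_1 dpoly \<Rightarrow> 'k::comm_ring_1 dpoly"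
  assumes \<theta>: "\<theta> \<in> ring_hom (dpoly_ring n) B" "\<theta> ` dp n = carrier B"
    and ker: "\<And>Q Q'. Q \<in> dp n \<Longrightarrow> Q' \<in> dp n \<Longrightarrow> \<theta> Q = \<theta> Q' \<longleftrightarrow> \<tau> (Q - Q') \<in> idl.span G"
    and \<tau>: "type_hom \<tau>" "\<tau> ` dp n = dp n" "\<And>c. \<tau> (dconst c) = dconst (\<rho> c)" and G: "G \<subseteq> dp n"
    and s: "\<And>c. s c = \<theta> (dconst c)"
  shows "alg_iso B s (dpoly_ring n Quot (Idl\<^bsub>dpoly_ring n\<^esub> G)) (quot_const n G \<circ> \<rho>)"
    and "alg_iso (dpoly_ring n Quot (Idl\<^bsub>dpoly_ring n\<^esub> G)) (quot_const n G \<circ> \<rho>) B s"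
proof -
  note D = cring_dpoly_ring[where 'r = 'k and n = n] and D' = cring_dpoly_ring[where 'r = 'r and n = n]
  note hom = type_hom_simps[OF \<tau>(1)]
  let ?I = "Idl\<^bsub>dpoly_ring n\<^esub> G"
  have I: "ideal ?I (dpoly_ring n)" by (rule ring.genideal_ideal[OF cring.axioms(1)[OF D] G])
  define \<theta>' where "\<theta>' Q = ?I +>\<^bsub>dpoly_ring n\<^esub> \<tau> Q" for Q
  have \<tau>c: "\<tau> Q \<in> dp n" if "Q \<in> dp n" for Q using that \<tau>(2) by blast
  have "\<tau> \<in> ring_hom (dpoly_ring n) (dpoly_ring n)"
    by (rule ring_hom_memI) (simp_all add: hom \<tau>c)
  moreover have "\<theta>' = (\<lambda>s. ?I +>\<^bsub>dpoly_ring n\<^esub> s) \<circ> \<tau>" by (auto simp: \<theta>'_def)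
  ultimately have h: "\<theta>' \<in> ring_hom (dpoly_ring n) (dpoly_ring n Quot ?I)"
    using ring_hom_trans[OF _ rcos_hom[OF I]] by metis
  have "\<theta>' ` dp n = (\<lambda>s. ?I +>\<^bsub>dpoly_ring n\<^esub> s) ` (\<tau> ` dp n)" by (auto simp: \<theta>'_def)
  then have surj: "\<theta>' ` dp n = carrier (dpoly_ring n Quot ?I)"
    unfolding \<tau>(2) by (auto simp: quot_carrier[OF D I])
  have k: "\<theta> Q = \<theta> Q' \<longleftrightarrow> \<theta>' Q = \<theta>' Q'" if Q: "Q \<in> dp n" "Q' \<in> dp n" for Q Q'
  proof -
    have "\<theta>' Q = \<theta>' Q' \<longleftrightarrow> \<tau> Q - \<tau> Q' \<in> ?I"
      unfolding \<theta>'_def quot_eq_iff[OF D I \<tau>c[OF Q(1)] \<tau>c[OF Q(2)]] by (simp add: dpoly_ring_a_minus \<tau>c Q)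
    also have "\<dots> \<longleftrightarrow> \<tau> (Q - Q') \<in> idl.span G"
      using Idl_dpoly_ring[OF G dp_diff[OF \<tau>c[OF Q(1)] \<tau>c[OF Q(2)]]] by (simp add: hom)
    finally show ?thesis using ker[OF Q] by blast
  qed
  have t: "(quot_const n G \<circ> \<rho>) c = \<theta>' (dconst c)" for c by (simp add: quot_const_def \<theta>'_def \<tau>(3))
  have dc: "dconst c \<in> dp n" for c :: 'r by simp
  show "alg_iso B s (dpoly_ring n Quot ?I) (quot_const n G \<circ> \<rho>)"
    by (rule alg_iso_of_surjections[OF cring.axioms(1)[OF D'] \<theta> h surj k dc s t])
  show "alg_iso (dpoly_ring n Quot ?I) (quot_const n G \<circ> \<rho>) B s"
    by (rule alg_iso_of_surjections[OF cring.axioms(1)[OF D'] h surj \<theta> k[symmetric] dc t s])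
qed

section \<open>Jets of the equation x^(p^\<nu>) = c\<close>

locale mu_jets =
  fixes p \<nu> :: nat and \<rho> :: "'r::comm_ring_1 \<Rightarrow> 'k::field"
    and \<delta>\<^sub>0 :: "'r \<Rightarrow> 'r" and \<delta> :: "'r dpoly \<Rightarrow> 'r dpoly"
  assumes prime: "Factorial_Ring.prime p" and odd: "odd p"
    and base_torsion_free: "of_nat p * x = (0 :: 'r) \<Longrightarrow> x = 0"
    and residue: "residue_map p \<rho>"
    and prolongation: "prolongation p \<delta>\<^sub>0 \<delta>" and delta0_one: "\<delta>\<^sub>0 1 = 0"
begin

abbreviation q :: nat where "q \<equiv> p ^ \<nu>"

lemma delta_dconst: "\<delta> (dconst c) = dconst (\<delta>\<^sub>0 c)" and delta_dvar: "\<delta> (dvar i) = dvar (Suc i)"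
  using prolongation by (auto simp: prolongation_def)

sublocale delta_ring p \<delta>
proof
  show "Q = 0" if "of_nat p * Q = 0" for Q :: "'r dpoly"
    using that base_torsion_free lookup_of_nat_mult[of p Q] by (metis lookup_zero poly_mapping_eqI)
  show "\<delta> 1 = 0" using delta_dconst[of 1] delta0_one by (simp add: dconst_one dconst_zero)
qed (use prime odd prolongation in \<open>auto simp: prolongation_def\<close>)

lemma jet_system_mu: "jet_system p \<delta> (mu_poly p \<nu> c)"
proof
  show "mu_poly p \<nu> c \<in> dp 0" unfolding mu_poly_def by (intro dp_diff dp_power) simp_all
qed (rule delta_dp_of_prolongation[OF prolongation])

lemma delta_funpow_dvar: "(\<delta> ^^ i) (dvar 0) = dvar i"
  and delta_funpow_dconst: "(\<delta> ^^ i) (dconst c) = dconst ((\<delta>\<^sub>0 ^^ i) c)"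
  by (induction i) (simp_all add: delta_dvar delta_dconst)

lemma rho: "type_hom \<rho>" "surj \<rho>" "\<rho> c = 0 \<longleftrightarrow> of_nat p dvd c"
  using residue by (auto simp: residue_map_def)

lemma of_nat_p_target: "of_nat p = (0 :: 'k dpoly)"
proof -
  have "\<rho> (of_nat p) = 0" using rho(3) by simp
  then have "(of_nat p :: 'k) = 0" using type_hom_simps(8)[OF rho(1)] by simp
  then show ?thesis by (metis single_of_nat single_zero)
qed

lemma P_power_dconst: "P ^ k = dconst (of_nat p ^ k)"
  by (simp add: type_hom_simps[OF type_hom_dconst])

lemma dconst_dvd: "x dvd y \<Longrightarrow> dconst x dvd (dconst y :: 'r dpoly)"
  by (auto simp: type_hom_simps[OF type_hom_dconst] elim!: dvdE)

text \<open>The precision is m + 1 because the ideals of order m contain all multiples of p^(m+1),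
  by \<open>P_power_mult_in_jets\<close>.\<close>

definition approx_root :: "'r \<Rightarrow> nat \<Rightarrow> 'r \<Rightarrow> bool" where
  "approx_root c m b \<longleftrightarrow> of_nat p dvd b - 1 \<and> of_nat p ^ Suc m dvd b ^ q - c"

definition gen :: "'r \<Rightarrow> nat \<Rightarrow> 'r dpoly" where
  "gen b i = (dvar i - dconst ((\<delta>\<^sub>0 ^^ i) b)) ^ q"

text \<open>The normal form reached by translation: x is centred at 1 and the higher variables at
  0.\<close>

definition target_gens :: "nat \<Rightarrow> 'k dpoly set" where
  "target_gens j = insert ((dvar 0 - 1) ^ q) ((\<lambda>i. dvar i ^ q) ` {1..j})"

lemma jet_span_mu:
  assumes b: "approx_root c m b"
  shows "jet_span (mu_poly p \<nu> c) m = idl.span (insert P (gen b ` {..m - \<nu>}))"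
proof -
  have "P dvd dconst b - 1"
    using b dconst_dvd[of "of_nat p" "b - 1"] P_power_dconst[of 1] by (simp add: approx_root_def type_hom_simps[OF type_hom_dconst])
  moreover have "P ^ Suc m dvd (dvar 0 ^ q - dconst b ^ q) - mu_poly p \<nu> c"
  proof -
    have "P ^ Suc m dvd dconst (b ^ q - c)"
      unfolding P_power_dconst using b dconst_dvd by (simp add: approx_root_def del: power_Suc)
    then have "P ^ Suc m dvd - dconst (b ^ q - c)" by (simp only: dvd_minus_iff)
    then show ?thesis by (simp add: mu_poly_def type_hom_simps[OF type_hom_dconst] algebra_simps del: power_Suc)
  qed
  ultimately show ?thesis
    using jet_span_power_diff[of "dconst b" m "dvar 0" \<nu> "mu_poly p \<nu> c"] by (simp add: gen_def delta_funpow_dvar delta_funpow_dconst)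
qed

lemma ex_approx_root: "c \<in> principal_units p (\<nu> + 1) \<Longrightarrow> \<exists>b. approx_root c m b"
  unfolding approx_root_def by (rule principal_unit_approximate_root[OF prime odd])

lemma approx_root_mono: "approx_root c m b \<Longrightarrow> m' \<le> m \<Longrightarrow> approx_root c m' b"
  unfolding approx_root_def by (meson Suc_le_mono dvd_trans le_imp_power_dvd)

text \<open>A generator of index i > n involves only x^(i) and vanishes when \<delta>^i b is
  substituted for it. This substitution fixes \<open>dp n\<close>, so only the generators of index
  at most n survive, and these are present from level n + \<nu> on.\<close>

lemma jet_span_mu_stable:
  assumes c: "c \<in> principal_units p (\<nu> + 1)" and Q: "Q \<in> dp n"
  shows "(\<exists>k\<ge>n. Q \<in> jet_span (mu_poly p \<nu> c) k) \<longleftrightarrow> Q \<in> jet_span (mu_poly p \<nu> c) (n + \<nu>)"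
proof
  assume "\<exists>k\<ge>n. Q \<in> jet_span (mu_poly p \<nu> c) k"
  then obtain k where k: "Q \<in> jet_span (mu_poly p \<nu> c) k" by blast
  \<comment> \<open>A single root b has to serve both level k and level n + \<nu>.\<close>
  define m where "m = max k (n + \<nu>)"
  have "jet_span (mu_poly p \<nu> c) k \<subseteq> jet_span (mu_poly p \<nu> c) m"
    unfolding jet_span_def by (intro idl.span_mono) (auto simp: m_def)
  then have Qm: "Q \<in> jet_span (mu_poly p \<nu> c) m" using k by blast
  obtain b where b: "approx_root c m b" using ex_approx_root[OF c] by blast
  let ?I = "idl.span (insert P (gen b ` {..n}))"
  let ?g = "\<lambda>i. if i \<le> n then dvar i else dconst ((\<delta>\<^sub>0 ^^ i) b)"
  define r where "r = dsubst (dconst :: 'r \<Rightarrow> _) ?g"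
  have "type_hom r" unfolding r_def by (rule type_hom_dsubst[OF type_hom_dconst])
  note hom = type_hom_simps[OF this]
  have rv: "r (dvar i) = ?g i" and rc: "r (dconst d) = dconst d" for i d
    by (simp_all add: r_def type_hom_dconst)
  have "r B = B" if "B \<in> dp n" for B
    using that by (induction rule: dpoly_induct) (simp_all add: hom(1,2) rv rc)
  then have rQ: "r Q = Q" using Q by blast
  have "idl.subspace {B. r B \<in> ?I}"
    by (rule idl.subspaceI) (simp_all add: hom idl.span_zero idl.span_add idl.span_scale)
  moreover have "r (gen b i) \<in> ?I" for i
    using idl.span_base[of "gen b i" "insert P (gen b ` {..n})"] idl.span_zero prime
    by (auto simp: gen_def hom rv rc power_0_left prime_gt_0_nat)
  then have "insert P (gen b ` {..m - \<nu>}) \<subseteq> {B. r B \<in> ?I}"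
    by (auto simp: hom intro: idl.span_base)
  ultimately have "idl.span (insert P (gen b ` {..m - \<nu>})) \<subseteq> {B. r B \<in> ?I}" by (metis idl.span_minimal)
  then have "r Q \<in> ?I" using Qm jet_span_mu[OF b] by blast
  moreover have "approx_root c (n + \<nu>) b" by (rule approx_root_mono[OF b]) (simp add: m_def)
  ultimately show "Q \<in> jet_span (mu_poly p \<nu> c) (n + \<nu>)" using jet_span_mu rQ by simp
qed (auto intro: exI[of _ "n + \<nu>"])

lemma target_gens_dp: "j \<le> n \<Longrightarrow> target_gens j \<subseteq> dp n"
  by (auto simp: target_gens_def intro!: dp_power dp_diff)

text \<open>Translating x^(i) moves the centre of its generator from \<delta>^i b to 1 or 0. The
  resulting ideal no longer depends on c, which is why c can be compared with 1.\<close>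

lemma ex_translation:
  assumes c: "c \<in> principal_units p (\<nu> + 1)"
  obtains \<tau> :: "'r dpoly \<Rightarrow> 'k dpoly" where "type_hom \<tau>" "\<tau> ` dp n = dp n" "\<And>d. \<tau> (dconst d) = dconst (\<rho> d)"
    "\<And>Q. Q \<in> jet_span (mu_poly p \<nu> c) m \<longleftrightarrow> \<tau> Q \<in> idl.span (target_gens (m - \<nu>))"
proof -
  obtain b where b: "approx_root c m b" using ex_approx_root[OF c] by blast
  \<comment> \<open>The centres kept after translation. Since b is 1 modulo \<open>p\<close>, the
    value \<open>?e 0\<close> is 0 and x itself does not move.\<close>
  let ?d = "\<lambda>i::nat. if i = 0 then 1 else (0::'k)"
  let ?e = "\<lambda>i. \<rho> ((\<delta>\<^sub>0 ^^ i) b) - ?d i"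
  define \<tau> where "\<tau> = dsubst (\<lambda>c. dconst (\<rho> c)) (\<lambda>i. dvar i + dconst (?e i))"
  note \<tau> = translation_hom[OF residue, of ?e, folded \<tau>_def]
  note hom = type_hom_simps[OF \<tau>(1)] and chom = type_hom_simps[OF type_hom_dconst[where 'r = 'k]]
  have "type_hom (\<lambda>c. dconst (\<rho> c))" by (rule type_hom_comp[OF rho(1) type_hom_dconst])
  then have \<tau>c: "\<tau> (dconst d) = dconst (\<rho> d)" and \<tau>v: "\<tau> (dvar i) = dvar i + dconst (?e i)" for d i
    by (simp_all add: \<tau>_def)
  have "\<tau> (gen b i) = (dvar i - dconst (?d i)) ^ q" for i
    unfolding gen_def hom(6,7) \<tau>c \<tau>v by (simp add: chom)
  then have "\<tau> ` gen b ` {..j} = (\<lambda>i. (dvar i - dconst (?d i)) ^ q) ` {..j}" for j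
    by (simp add: image_image)
  also have "\<dots> j = target_gens j" for j
  proof -
    have "{..j} = insert 0 {1..j}" by auto
    then show ?thesis by (auto simp: target_gens_def dconst_one dconst_zero)
  qed
  finally have "\<tau> ` gen b ` {..j} = target_gens j" for j .
  then have "\<tau> Q \<in> idl.span (target_gens (m - \<nu>)) \<longleftrightarrow> Q \<in> jet_span (mu_poly p \<nu> c) m" for Q
    using surj_hom_span_iff[OF \<tau>(1,2,3), of Q "gen b ` {..m - \<nu>}"] jet_span_mu[OF b] by simp
  then show ?thesis using that \<tau>(1,4) \<tau>c by blast
qed

text \<open>By \<open>jet_span_mu_stable\<close> the kernel comes from the ideal of level n + \<nu>,
  whose generators have index at most n.\<close>

lemma jet_tilde_mu_iso:
  assumes c: "c \<in> principal_units p (\<nu> + 1)"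
  shows "alg_iso (jet_tilde p \<delta> (mu_poly p \<nu> c) n) (jet_tilde_const p \<delta> (mu_poly p \<nu> c) n)
      (dpoly_ring n Quot (Idl\<^bsub>dpoly_ring n\<^esub> target_gens n)) (quot_const n (target_gens n) \<circ> \<rho>)"
    and "alg_iso (dpoly_ring n Quot (Idl\<^bsub>dpoly_ring n\<^esub> target_gens n)) (quot_const n (target_gens n) \<circ> \<rho>)
      (jet_tilde p \<delta> (mu_poly p \<nu> c) n) (jet_tilde_const p \<delta> (mu_poly p \<nu> c) n)"
proof -
  interpret Fc: jet_system p \<delta> "mu_poly p \<nu> c" by (rule jet_system_mu)
  obtain \<tau> :: "'r dpoly \<Rightarrow> 'k dpoly" where \<tau>: "type_hom \<tau>" "\<tau> ` dp n = dp n" "\<And>d. \<tau> (dconst d) = dconst (\<rho> d)"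
    and k: "\<And>Q. Q \<in> jet_span (mu_poly p \<nu> c) (n + \<nu>) \<longleftrightarrow> \<tau> Q \<in> idl.span (target_gens (n + \<nu> - \<nu>))"
    by (rule ex_translation[OF c, of n "n + \<nu>"]) (rule that)
  have "Fc.to_tilde n Q = Fc.to_tilde n Q' \<longleftrightarrow> \<tau> (Q - Q') \<in> idl.span (target_gens n)" if "Q \<in> dp n" "Q' \<in> dp n" for Q Q'
    using Fc.to_tilde_eq_iff[OF that] jet_span_mu_stable[OF c dp_diff[OF that]] k by simp
  note iso = dpoly_quotient_iso[OF Fc.to_tilde_hom Fc.to_tilde_surj this \<tau> target_gens_dp[OF order_refl] Fc.jet_consts(2)]
  show "alg_iso (jet_tilde p \<delta> (mu_poly p \<nu> c) n) (jet_tilde_const p \<delta> (mu_poly p \<nu> c) n)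
      (dpoly_ring n Quot (Idl\<^bsub>dpoly_ring n\<^esub> target_gens n)) (quot_const n (target_gens n) \<circ> \<rho>)"
    "alg_iso (dpoly_ring n Quot (Idl\<^bsub>dpoly_ring n\<^esub> target_gens n)) (quot_const n (target_gens n) \<circ> \<rho>)
      (jet_tilde p \<delta> (mu_poly p \<nu> c) n) (jet_tilde_const p \<delta> (mu_poly p \<nu> c) n)"
    using iso by blast+
qed

text \<open>Here the kernel comes from the ideal of level n itself, whose generators stop at index n
  - \<nu>.\<close>

lemma jet_bar_mu_iso:
  assumes c: "c \<in> principal_units p (\<nu> + 1)"
  shows "alg_iso (jet_bar p \<delta> (mu_poly p \<nu> c) n) (jet_bar_const p \<delta> (mu_poly p \<nu> c) n)
      (dpoly_ring n Quot (Idl\<^bsub>dpoly_ring n\<^esub> target_gens (n - \<nu>))) (quot_const n (target_gens (n - \<nu>)) \<circ> \<rho>)"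
    and "alg_iso (dpoly_ring n Quot (Idl\<^bsub>dpoly_ring n\<^esub> target_gens (n - \<nu>))) (quot_const n (target_gens (n - \<nu>)) \<circ> \<rho>)
      (jet_bar p \<delta> (mu_poly p \<nu> c) n) (jet_bar_const p \<delta> (mu_poly p \<nu> c) n)"
proof -
  interpret Fc: jet_system p \<delta> "mu_poly p \<nu> c" by (rule jet_system_mu)
  obtain \<tau> :: "'r dpoly \<Rightarrow> 'k dpoly" where \<tau>: "type_hom \<tau>" "\<tau> ` dp n = dp n" "\<And>d. \<tau> (dconst d) = dconst (\<rho> d)"
    and k: "\<And>Q. Q \<in> jet_span (mu_poly p \<nu> c) n \<longleftrightarrow> \<tau> Q \<in> idl.span (target_gens (n - \<nu>))"
    by (rule ex_translation[OF c, of n "n"]) (rule that)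
  have "Fc.to_bar n Q = Fc.to_bar n Q' \<longleftrightarrow> \<tau> (Q - Q') \<in> idl.span (target_gens (n - \<nu>))" if "Q \<in> dp n" "Q' \<in> dp n" for Q Q'
    using Fc.to_bar_eq_iff[OF that] k by simp
  note iso = dpoly_quotient_iso[OF Fc.to_bar_hom Fc.to_bar_surj this \<tau> target_gens_dp[OF diff_le_self] Fc.jet_consts(1)]
  show "alg_iso (jet_bar p \<delta> (mu_poly p \<nu> c) n) (jet_bar_const p \<delta> (mu_poly p \<nu> c) n)
      (dpoly_ring n Quot (Idl\<^bsub>dpoly_ring n\<^esub> target_gens (n - \<nu>))) (quot_const n (target_gens (n - \<nu>)) \<circ> \<rho>)"
    "alg_iso (dpoly_ring n Quot (Idl\<^bsub>dpoly_ring n\<^esub> target_gens (n - \<nu>))) (quot_const n (target_gens (n - \<nu>)) \<circ> \<rho>)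
      (jet_bar p \<delta> (mu_poly p \<nu> c) n) (jet_bar_const p \<delta> (mu_poly p \<nu> c) n)"
    using iso by blast+
qed

lemma jet_tilde_mu_trivial:
  assumes nu: "1 \<le> \<nu>" and a: "a \<in> principal_units p 1" and na: "a \<notin> principal_units p (\<nu> + 1)"
  shows "carrier (jet_tilde p \<delta> (mu_poly p \<nu> a) n) = {\<zero>\<^bsub>jet_tilde p \<delta> (mu_poly p \<nu> a) n\<^esub>}"
proof -
  define f where "f = mu_poly p \<nu> a"
  interpret F: jet_system p \<delta> f unfolding f_def by (rule jet_system_mu)
  \<comment> \<open>With j maximal, a - 1 is p^j c where \<open>p\<close> does not divide c: for j <
    \<nu> by maximality, for j = \<nu> by the hypothesis on a.\<close>
  define j where "j = (GREATEST j. j \<le> \<nu> \<and> a \<in> principal_units p j)"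
  have "1 \<le> \<nu> \<and> a \<in> principal_units p 1" using nu a by blast
  then have j: "j \<le> \<nu>" "a \<in> principal_units p j" "1 \<le> j"
    unfolding j_def using GreatestI_nat[of "\<lambda>j. j \<le> \<nu> \<and> a \<in> principal_units p j" 1 \<nu>]
      Greatest_le_nat[of "\<lambda>j. j \<le> \<nu> \<and> a \<in> principal_units p j" 1 \<nu>] by auto
  have notSuc: "a \<notin> principal_units p (Suc j)"
  proof (cases "j = \<nu>")
    case True
    then show ?thesis using na by simp
  next
    case False
    then show ?thesis
      using j Greatest_le_nat[of "\<lambda>j. j \<le> \<nu> \<and> a \<in> principal_units p j" "Suc j" \<nu>] unfolding j_def by fastforce
  qed
  obtain c where c: "a = 1 + of_nat (p ^ j) * c" using j(2) by (auto simp: principal_units_def)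
  have "\<not> of_nat p dvd c"
  proof
    assume "of_nat p dvd c"
    then obtain c' where "c = of_nat p * c'" by blast
    then have "a = 1 + of_nat (p ^ Suc j) * c'" using c by (simp add: mult_ac)
    then show False using notSuc by (auto simp: principal_units_def)
  qed
  then have "\<rho> c \<noteq> 0" using rho(3) by blast
  \<comment> \<open>k is a field and \<rho> is onto, so an inverse of c modulo \<open>p\<close>
    lifts to R.\<close>
  obtain d where "\<rho> d = inverse (\<rho> c)" using rho(2) by (metis surjD)
  then have "\<rho> (d * c - 1) = 0" using \<open>\<rho> c \<noteq> 0\<close> by (simp add: type_hom_simps[OF rho(1)])
  then have "P dvd dconst (d * c - 1)"
    using rho(3) dconst_dvd[of "of_nat p" "d * c - 1"] P_power_dconst[of 1] by (simp add: type_hom_simps[OF type_hom_dconst])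
  then have d: "P dvd dconst d * dconst c - 1" by (simp add: type_hom_simps[OF type_hom_dconst])
  have "f = dvar 0 ^ q - (1 + P ^ j * dconst c)"
    unfolding f_def mu_poly_def c by (simp add: type_hom_simps[OF type_hom_dconst])
  \<comment> \<open>The level n + \<nu> is at least n, as the limit requires, and at least \<nu>, as
    \<open>jet_span_eq_UNIV\<close> requires.\<close>
  then have "jet_span f (n + \<nu>) = UNIV"
    using jet_span_eq_UNIV[OF j(3,1) d, of f "dvar 0" "n + \<nu>"] by simp
  then have "F.to_tilde n Q = F.to_tilde n 0" if "Q \<in> dp n" for Q
    using F.to_tilde_eq_iff[OF that dp_zero] by (auto intro!: exI[of _ "n + \<nu>"])
  then have "F.to_tilde n ` dp n = {F.to_tilde n 0}" using dp_zero by blast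
  moreover have "F.to_tilde n 0 = \<zero>\<^bsub>jet_tilde p \<delta> f n\<^esub>"
  proof -
    have R: "ring (dpoly_ring n :: 'r dpoly ring)" "ring (jet_ring p \<delta> f n)" "ring (jet_ring_inf p \<delta> f)"
      using cring_dpoly_ring F.cring_JR F.cring_inf cring.axioms(1) by blast+
    have "F.to_tilde n 0 = \<zero>\<^bsub>mod_p p (jet_ring_inf p \<delta> f)\<^esub>"
      unfolding F.to_tilde_def mod_p_def quot_one_zero(2)[OF F.cring_inf ideal_padic_ideal[OF F.cring_inf]]
      using ring_hom_zero[OF F.jr_hom R(1,2)] ring_hom_zero[OF F.dl_hom R(2,3)] by simp
    then show ?thesis by (simp add: jet_tilde_def)
  qed
  ultimately show ?thesis using F.to_tilde_surj unfolding f_def by metis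
qed

end

theorem theorem5p6:
  fixes p n \<nu> :: nat
    and A :: "'a ring"
    and \<iota> :: "(nat \<Rightarrow> int set) \<Rightarrow> 'a"
    and \<phi> :: "'r::comm_ring_1 \<Rightarrow> 'r"
    and \<rho> :: "'r \<Rightarrow> 'k::field"
    and \<delta> :: "'r dpoly \<Rightarrow> 'r dpoly"
    and a :: 'r
  assumes "Factorial_Ring.prime p" and "odd p"
    and "maximal_unramified_extension p A \<iota>"
    and "(ring_of_type_algebra :: 'r ring) \<simeq> padic_completion p A"
    and "residue_map p \<rho>"
    and "frobenius_lift p \<phi>"
    and "prolongation p (frobenius_derivation p \<phi>) \<delta>"
    and "n \<ge> 1" and "\<nu> \<ge> 1"
    and "a \<in> principal_units p 1"
  defines "f \<equiv> mu_poly p \<nu> a"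
    and "f\<^sub>1 \<equiv> mu_poly p \<nu> 1"
    and "T \<equiv> insert ((dvar 0 - 1) ^ (p ^ \<nu>)) ((\<lambda>i. (dvar i :: 'k dpoly) ^ (p ^ \<nu>)) ` {1..n})"
    and "S \<equiv> {(dvar 0 :: 'k dpoly) ^ (p ^ \<nu>) - 1}"
    and "S' \<equiv> insert (dvar 0 ^ (p ^ \<nu>) - 1) ((\<lambda>i. (dvar i :: 'k dpoly) ^ (p ^ \<nu>)) ` {1..n - \<nu>})"
  shows "(a \<notin> principal_units p (\<nu> + 1) \<longrightarrow>
            carrier (jet_tilde p \<delta> f n) = {\<zero>\<^bsub>jet_tilde p \<delta> f n\<^esub>}) \<and>
         (a \<in> principal_units p (\<nu> + 1) \<longrightarrow>
            alg_iso (jet_tilde p \<delta> f n) (jet_tilde_const p \<delta> f n)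
                    (jet_tilde p \<delta> f\<^sub>1 n) (jet_tilde_const p \<delta> f\<^sub>1 n) \<and>
            alg_iso (jet_tilde p \<delta> f\<^sub>1 n) (jet_tilde_const p \<delta> f\<^sub>1 n)
                    (dpoly_ring n Quot (Idl\<^bsub>dpoly_ring n\<^esub> T)) (quot_const n T \<circ> \<rho>) \<and>
            alg_iso (jet_bar p \<delta> f n) (jet_bar_const p \<delta> f n)
                    (jet_bar p \<delta> f\<^sub>1 n) (jet_bar_const p \<delta> f\<^sub>1 n) \<and>
            (n \<le> \<nu> \<longrightarrow>
               alg_iso (jet_bar p \<delta> f\<^sub>1 n) (jet_bar_const p \<delta> f\<^sub>1 n)
                       (dpoly_ring n Quot (Idl\<^bsub>dpoly_ring n\<^esub> S)) (quot_const n S \<circ> \<rho>)) \<and>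
            (n \<ge> \<nu> + 1 \<longrightarrow>
               alg_iso (jet_bar p \<delta> f\<^sub>1 n) (jet_bar_const p \<delta> f\<^sub>1 n)
                       (dpoly_ring n Quot (Idl\<^bsub>dpoly_ring n\<^esub> S')) (quot_const n S' \<circ> \<rho>)))"
proof -
  have unr: "unramified_extension p A \<iota>" using assms(3) by (simp add: maximal_unramified_extension_def)
  have tf: "x = 0" if "of_nat p * x = (0 :: 'r)" for x
    using completed_unramified_torsion_free[OF assms(1) unr assms(4) that] .
  have "frobenius_derivation p \<phi> 1 = 0"
  proof -
    have "\<phi> 1 = 1" using assms(6) by (auto simp: frobenius_lift_def type_hom_simps)
    \<comment> \<open>The derivation is a definite description; torsion freeness supplies
      uniqueness.\<close>
    then show ?thesis unfolding frobenius_derivation_def using tf by (intro the_equality) auto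
  qed
  then interpret mu_jets p \<nu> \<rho> "frobenius_derivation p \<phi>" \<delta>
    using assms(1,2,5,7) tf by (intro mu_jets.intro)
  have one: "(1 :: 'r) \<in> principal_units p (\<nu> + 1)"
    unfolding principal_units_def by (auto intro!: exI[of _ 0])
  \<comment> \<open>In characteristic p this turns the first generator of the common model into the
    one of \<open>S\<close> and \<open>S'\<close>.\<close>
  have fresh: "(dvar 0 - 1) ^ q = (dvar 0 :: 'k dpoly) ^ q - 1"
    using char_p_power_diff[OF assms(1) of_nat_p_target, of "dvar 0" 1 \<nu>] by simp
  have TT: "target_gens n = T" by (simp add: target_gens_def T_def)
  have TS': "target_gens (n - \<nu>) = S'" by (simp add: target_gens_def S'_def fresh)
  \<comment> \<open>For n \<le> \<nu> the truncated difference is 0, and the index range starting at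
    1 is empty.\<close>
  have TS: "n \<le> \<nu> \<Longrightarrow> target_gens (n - \<nu>) = S" by (simp add: target_gens_def S_def fresh)
  note tilde = jet_tilde_mu_iso[where n = n] and bar = jet_bar_mu_iso[where n = n]
  show ?thesis
    using jet_tilde_mu_trivial[OF assms(9,10)] alg_iso_trans[OF tilde(1) tilde(2)[OF one]] tilde(1)[OF one]
      alg_iso_trans[OF bar(1) bar(2)[OF one]] bar(1)[OF one] TS
    unfolding TT TS' f_def f\<^sub>1_def by auto
qed

end
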